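(* Let $u(t)=S(t)u_0-\mathrm{i}\int_0^tS(t-r)\,\mathrm{d}W(r)$ be the exact (mild) solution of the linear stochastic Schr\"odinger equation with additive noise $\mathrm{i}\,\mathrm{d}u-\Delta u\,\mathrm{d}t=\mathrm{d}W$ on $\mathbb{R}^d\times(0,\infty)$, $u(0)=u_0$, where $u_0$ is an $\mathcal{F}_0$-measurable random variable and $W$ is a $Q$-Wiener process. Let $$p(u)=\mathrm{i}\int_{\mathbb{R}^d}(u\nabla\bar u-\bar u\nabla u)\,\mathrm{d}x$$ denote the momentum. Assume that $\mathbb{E}[p(u_0)]<\infty$ and that $Q^{1/2}\in\mathcal{L}_2^1$. Then $$\mathbb{E}[p(u(t))]=\mathbb{E}[p(u_0)]-2t\,\mathrm{Im}\,\langle Q^{1/2},\nabla Q^{1/2}\rangle_{\mathcal{L}_2^0}\qquad\text{for all times }t\ge0.$$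
   Context: $d\ge1$ is arbitrary. $L^2=L^2(\mathbb{R}^d)$ is the space of complex-valued square integrable functions, with real inner product $(u,v)=\mathrm{Re}\int_{\mathbb{R}^d}u\bar v\,\mathrm{d}x$; also $\langle u,v\rangle=\int_{\mathbb{R}^d}u\bar v\,\mathrm{d}x$ (the usual complex-valued $L^2$ inner product; for a vector field $v=\nabla w$ it is taken componentwise). $H^1=H^1(\mathbb{R}^d)$ is the Sobolev space of order 1; $\mathcal{L}_2^1$ is the space of Hilbert--Schmidt operators from $L^2$ to $H^1$. $\langle\cdot,\cdot\rangle_{\mathcal{L}_2^0}$ is the Hilbert--Schmidt inner product from $L^2$ to $L^2$ built from $\langle\cdot,\cdot\rangle$: $\langle Q^{1/2},\nabla Q^{1/2}\rangle_{\mathcal{L}_2^0}=\sum_j\langle Q^{1/2}e_j,\nabla Q^{1/2}e_j\rangle$, with $(e_j)$ an orthonormal basis of $L^2$. $S(t)=\mathrm{e}^{-\mathrm{i}t\Delta}$ is the unitary group generated by $-\mathrm{i}\Delta$. $(\Omega,\mathcal{F},\mathbb{P},\{\mathcal{F}_t\}_{t\ge0})$ is a filtered probability space with a normal filtration, and $W$ is a complex-valued (i.e. $L^2$-valued), square integrable $Q$-Wiener process with respect to $\{\mathcal{F}_t\}$, where the covariance operator $Q$ is a nonnegative self-adjoint operator on $L^2$; thus $W(t)=\sum_j\beta_j(t)Q^{1/2}e_j$ with independent standard Brownian motions $\beta_j$.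
   Formalization: The identity is stated for those t at which p(u(t)) is integrable, since E[p(u_0)]<∞ alone does not make E[p(u(t))] exist; integrability is proved when E‖u_0‖_{L²}<∞. E[p(u_0)]<∞ is read as u_0 in H¹ a.s. with p(u_0) integrable. *)

theory Defs
  imports "HOL-Probability.Probability"
begin

section \<open>The space of square integrable functions\<close>

definition square_integrable :: "(real ^ 'd \<Rightarrow> complex) \<Rightarrow> bool" where
  "square_integrable f \<longleftrightarrow>
     f \<in> borel_measurable lborel \<and> integrable lborel (\<lambda>x. (norm (f x))\<^sup>2)"

lemma square_integrable_zero: "square_integrable (\<lambda>x. 0)"
  unfolding square_integrable_def by simp

lemma square_integrable_mult:
  assumes "square_integrable f"
  shows "square_integrable (\<lambda>x. c * f x)"
proof -
  have [measurable]: "f \<in> borel_measurable lborel" and "integrable lborel (\<lambda>x. (norm (f x))\<^sup>2)"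
    using assms by (simp_all add: square_integrable_def)
  then have "integrable lborel (\<lambda>x. (norm c)\<^sup>2 * (norm (f x))\<^sup>2)"
    by (intro integrable_mult_right)
  moreover have "(\<lambda>x. c * f x) \<in> borel_measurable lborel" by measurable
  ultimately show ?thesis by (simp only: square_integrable_def norm_mult power_mult_distrib)
qed

lemma square_integrable_add:
  assumes "square_integrable f" "square_integrable g"
  shows "square_integrable (\<lambda>x. f x + g x)"
proof -
  have [measurable]: "f \<in> borel_measurable lborel" "g \<in> borel_measurable lborel"
    and int: "integrable lborel (\<lambda>x. (norm (f x))\<^sup>2)" "integrable lborel (\<lambda>x. (norm (g x))\<^sup>2)"
    using assms unfolding square_integrable_def by blast+
  have bound: "norm ((norm (f x + g x))\<^sup>2) \<le> norm (2 * (norm (f x))\<^sup>2 + 2 * (norm (g x))\<^sup>2)" for x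
  proof -
    have "(norm (f x + g x))\<^sup>2 \<le> (norm (f x) + norm (g x))\<^sup>2"
      by (intro power_mono norm_triangle_ineq) simp
    also have "\<dots> \<le> 2 * (norm (f x))\<^sup>2 + 2 * (norm (g x))\<^sup>2"
      using zero_le_power2[of "norm (f x) - norm (g x)"] by (simp add: power2_sum power2_diff)
    finally show ?thesis by simp
  qed
  have meas: "(\<lambda>x. f x + g x) \<in> borel_measurable lborel"
    "(\<lambda>x. (norm (f x + g x))\<^sup>2) \<in> borel_measurable lborel" by measurable
  have "integrable lborel (\<lambda>x. 2 * (norm (f x))\<^sup>2 + 2 * (norm (g x))\<^sup>2)"
    by (intro Bochner_Integration.integrable_add integrable_mult_right int)
  then have "integrable lborel (\<lambda>x. (norm (f x + g x))\<^sup>2)"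
    by (rule Bochner_Integration.integrable_bound) (rule meas, rule AE_I2, rule bound)
  with meas show ?thesis
    unfolding square_integrable_def by blast
qed

lemma square_integrable_minus:
  assumes "square_integrable f" "square_integrable g"
  shows "square_integrable (\<lambda>x. f x - g x)"
  using square_integrable_add[OF assms(1) square_integrable_mult[OF assms(2), of "-1"]] by simp

lemma square_integrable_prod:
  assumes "square_integrable f" "square_integrable g"
  shows "integrable lborel (\<lambda>x. f x * cnj (g x))"
proof -
  have [measurable]: "f \<in> borel_measurable lborel" "g \<in> borel_measurable lborel"
    and int: "integrable lborel (\<lambda>x. (norm (f x))\<^sup>2)" "integrable lborel (\<lambda>x. (norm (g x))\<^sup>2)"
    using assms unfolding square_integrable_def by blast+
  have bound: "norm (f x * cnj (g x)) \<le> norm ((norm (f x))\<^sup>2 + (norm (g x))\<^sup>2)" for x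
  proof -
    have "norm (f x) * norm (g x) \<le> (norm (f x))\<^sup>2 + (norm (g x))\<^sup>2"
      using sum_squares_bound[of "norm (f x)" "norm (g x)"]
        mult_nonneg_nonneg[OF norm_ge_zero[of "f x"] norm_ge_zero[of "g x"]]
      by linarith
    then show ?thesis by (simp add: norm_mult)
  qed
  have meas: "(\<lambda>x. f x * cnj (g x)) \<in> borel_measurable lborel"
    by (intro borel_measurable_times borel_measurable_continuous_on[of cnj] continuous_intros)
      measurable
  have "integrable lborel (\<lambda>x. (norm (f x))\<^sup>2 + (norm (g x))\<^sup>2)"
    by (intro Bochner_Integration.integrable_add int)
  then show ?thesis
    by (rule Bochner_Integration.integrable_bound) (rule meas, rule AE_I2, rule bound)
qed

definition l2_rel :: "(real ^ 'd \<Rightarrow> complex) \<Rightarrow> (real ^ 'd \<Rightarrow> complex) \<Rightarrow> bool" where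
  "l2_rel f g \<longleftrightarrow> square_integrable f \<and> square_integrable g \<and> (AE x in lborel. f x = g x)"

lemma l2_relI:
  "square_integrable f \<Longrightarrow> square_integrable g \<Longrightarrow> AE x in lborel. f x = g x \<Longrightarrow> l2_rel f g"
  by (simp add: l2_rel_def)

lemma part_equivp_l2_rel: "part_equivp l2_rel"
proof (rule part_equivpI)
  show "\<exists>f. l2_rel f f"
    using square_integrable_zero by (auto simp: l2_rel_def)
  show "symp l2_rel"
    by (rule sympI) (auto simp: l2_rel_def elim: eventually_mono)
  show "transp l2_rel"
  proof (rule transpI)
    fix f g h :: "real ^ 'd \<Rightarrow> complex"
    assume "l2_rel f g" "l2_rel g h"
    moreover from this have "AE x in lborel. f x = h x"
      unfolding l2_rel_def by (auto elim: eventually_elim2)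
    ultimately show "l2_rel f h" by (simp add: l2_rel_def)
  qed
qed

text \<open>The Lebesgue space \<open>L\<^sup>2(\<real>\<^sup>d; \<complex>)\<close>, where \<open>d\<close> is the cardinality of the index type.  It is
  a real Hilbert space with inner product \<open>(u, v) = Re \<integral> u cnj v\<close>.\<close>

quotient_type (overloaded) 'd l2 = "real ^ 'd::finite \<Rightarrow> complex" / partial: l2_rel
  by (rule part_equivp_l2_rel)

lemma l2_rel_rep: "l2_rel (rep_l2 u) (rep_l2 u)"
  by (rule Quotient3_rep_reflp[OF Quotient3_l2])

lemma square_integrable_rep: "square_integrable (rep_l2 u)"
  using l2_rel_rep[of u] by (simp add: l2_rel_def)

lift_definition cinner :: "'d::finite l2 \<Rightarrow> 'd l2 \<Rightarrow> complex"
  is "\<lambda>f g. \<integral>x. f x * cnj (g x) \<partial>lborel"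
proof -
  fix f f' g g' :: "real ^ 'd \<Rightarrow> complex"
  assume "l2_rel f f'" "l2_rel g g'"
  then have *: "square_integrable f" "square_integrable f'" "square_integrable g"
    "square_integrable g'" "AE x in lborel. f x = f' x" "AE x in lborel. g x = g' x"
    by (auto simp: l2_rel_def)
  show "(\<integral>x. f x * cnj (g x) \<partial>lborel) = (\<integral>x. f' x * cnj (g' x) \<partial>lborel)"
  proof (rule integral_cong_AE)
    show "(\<lambda>x. f x * cnj (g x)) \<in> borel_measurable lborel"
      "(\<lambda>x. f' x * cnj (g' x)) \<in> borel_measurable lborel"
      using square_integrable_prod[OF *(1,3)] square_integrable_prod[OF *(2,4)]
      by (auto dest: borel_measurable_integrable)
    show "AE x in lborel. f x * cnj (g x) = f' x * cnj (g' x)"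
      using *(5,6) by eventually_elim simp
  qed
qed

lift_definition cscale :: "complex \<Rightarrow> 'd::finite l2 \<Rightarrow> 'd l2" is "\<lambda>c f x. c * f x"
  by (auto simp: l2_rel_def square_integrable_mult elim: eventually_mono)

instantiation l2 :: (finite) real_vector
begin

lift_definition zero_l2 :: "'a l2" is "\<lambda>x. 0"
  by (simp add: l2_rel_def square_integrable_zero)

lift_definition plus_l2 :: "'a l2 \<Rightarrow> 'a l2 \<Rightarrow> 'a l2" is "\<lambda>f g x. f x + g x"
  by (auto simp: l2_rel_def square_integrable_add elim: eventually_elim2)

lift_definition minus_l2 :: "'a l2 \<Rightarrow> 'a l2 \<Rightarrow> 'a l2" is "\<lambda>f g x. f x - g x"
  by (auto simp: l2_rel_def square_integrable_minus elim: eventually_elim2)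

definition uminus_l2 :: "'a l2 \<Rightarrow> 'a l2" where "uminus_l2 u = 0 - u"

definition scaleR_l2 :: "real \<Rightarrow> 'a l2 \<Rightarrow> 'a l2" where
  "scaleR_l2 r u = cscale (complex_of_real r) u"

instance
proof
  fix u v w :: "'a l2" and a b :: real
  note intros = l2_relI square_integrable_add square_integrable_minus square_integrable_mult
    square_integrable_zero
  show "u + v + w = u + (v + w)"
    by transfer (auto simp: l2_rel_def add.assoc intro!: intros)
  show "u + v = v + u"
    by transfer (auto simp: l2_rel_def add.commute intro!: intros)
  show "0 + u = u"
    by transfer (auto simp: l2_rel_def intro!: intros)
  show "- u + u = 0"
    unfolding uminus_l2_def by transfer (auto simp: l2_rel_def intro!: intros)
  show "u - v = u + - v"
    unfolding uminus_l2_def by transfer (auto simp: l2_rel_def intro!: intros)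
  show "a *\<^sub>R (u + v) = a *\<^sub>R u + a *\<^sub>R v"
    unfolding scaleR_l2_def by transfer (auto simp: l2_rel_def distrib_left distrib_right mult.assoc intro!: intros)
  show "(a + b) *\<^sub>R u = a *\<^sub>R u + b *\<^sub>R u"
    unfolding scaleR_l2_def by transfer (auto simp: l2_rel_def distrib_left distrib_right mult.assoc intro!: intros)
  show "a *\<^sub>R b *\<^sub>R u = (a * b) *\<^sub>R u"
    unfolding scaleR_l2_def by transfer (auto simp: l2_rel_def distrib_left distrib_right mult.assoc intro!: intros)
  show "1 *\<^sub>R u = u"
    unfolding scaleR_l2_def by transfer (auto simp: l2_rel_def intro!: intros)
qed

end

lemma cinner_commute: "cinner u v = cnj (cinner v u)"
proof transfer
  fix f g :: "real ^ 'a \<Rightarrow> complex"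
  have "(\<integral>x. f x * cnj (g x) \<partial>lborel) = (\<integral>x. cnj (g x * cnj (f x)) \<partial>lborel)"
    by (simp add: mult.commute)
  then show "(\<integral>x. f x * cnj (g x) \<partial>lborel) = cnj (\<integral>x. g x * cnj (f x) \<partial>lborel)"
    by (simp only: Bochner_Integration.integral_cnj)
qed

lemma cinner_add_left: "cinner (u + v) w = cinner u w + cinner v w"
proof transfer
  fix f g h :: "real ^ 'a \<Rightarrow> complex"
  assume "l2_rel f f" "l2_rel g g" "l2_rel h h"
  then show "(\<integral>x. (f x + g x) * cnj (h x) \<partial>lborel)
      = (\<integral>x. f x * cnj (h x) \<partial>lborel) + (\<integral>x. g x * cnj (h x) \<partial>lborel)"
    by (simp add: l2_rel_def square_integrable_prod distrib_right)
qed

lemma cinner_cscale_left: "cinner (cscale c u) v = c * cinner u v"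
  by transfer (simp add: mult.assoc)

lemma integral_mult_cnj_self:
  "(\<integral>x. f x * cnj (f x) \<partial>lborel) = complex_of_real (\<integral>x. (norm (f x))\<^sup>2 \<partial>lborel)"
  by (simp only: complex_norm_square[symmetric] integral_complex_of_real)

lemma cinner_self: "cinner u u = complex_of_real (\<integral>x. (norm (rep_l2 u x))\<^sup>2 \<partial>lborel)"
  unfolding cinner.rep_eq by (rule integral_mult_cnj_self)

lemma cinner_self_eq_0: "Re (cinner u u) = 0 \<Longrightarrow> u = 0"
proof (transfer)
  fix f :: "real ^ 'a \<Rightarrow> complex"
  assume f: "l2_rel f f" and "Re (\<integral>x. f x * cnj (f x) \<partial>lborel) = 0"
  then have "(\<integral>x. (norm (f x))\<^sup>2 \<partial>lborel) = 0"
    by (simp only: integral_mult_cnj_self Re_complex_of_real)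
  moreover have "integrable lborel (\<lambda>x. (norm (f x))\<^sup>2)"
    using f unfolding l2_rel_def square_integrable_def by blast
  ultimately have "AE x in lborel. (norm (f x))\<^sup>2 = 0"
    by (subst (asm) integral_nonneg_eq_0_iff_AE) auto
  then show "l2_rel f (\<lambda>x. 0)"
    using f by (auto simp: l2_rel_def square_integrable_zero)
qed

instantiation l2 :: (finite) real_inner
begin

definition inner_l2 :: "'a l2 \<Rightarrow> 'a l2 \<Rightarrow> real" where "inner_l2 u v = Re (cinner u v)"
definition norm_l2 :: "'a l2 \<Rightarrow> real" where "norm_l2 u = sqrt (inner u u)"
definition sgn_l2 :: "'a l2 \<Rightarrow> 'a l2" where "sgn_l2 u = u /\<^sub>R norm u"
definition dist_l2 :: "'a l2 \<Rightarrow> 'a l2 \<Rightarrow> real" where "dist_l2 u v = norm (u - v)"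
definition uniformity_l2 :: "('a l2 \<times> 'a l2) filter" where
  "uniformity_l2 = (INF e\<in>{0<..}. principal {(u, v). dist u v < e})"
definition open_l2 :: "'a l2 set \<Rightarrow> bool" where
  "open_l2 U = (\<forall>u\<in>U. eventually (\<lambda>(u', v). u' = u \<longrightarrow> v \<in> U) uniformity)"

instance
proof
  fix u v w :: "'a l2" and r :: real and U :: "'a l2 set"
  show "dist u v = norm (u - v)" by (rule dist_l2_def)
  show "sgn u = u /\<^sub>R norm u" by (rule sgn_l2_def)
  show "uniformity = (INF e\<in>{0<..}. principal {(u :: 'a l2, v). dist u v < e})"
    by (rule uniformity_l2_def)
  show "open U = (\<forall>u\<in>U. eventually (\<lambda>(u', v). u' = u \<longrightarrow> v \<in> U) uniformity)"
    by (rule open_l2_def)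
  show "inner u v = inner v u"
    unfolding inner_l2_def by (subst cinner_commute) simp
  show "inner (u + v) w = inner u w + inner v w"
    by (simp add: inner_l2_def cinner_add_left)
  show "inner (r *\<^sub>R u) v = r * inner u v"
    by (simp add: inner_l2_def scaleR_l2_def cinner_cscale_left)
  show "0 \<le> inner u u"
    by (simp add: inner_l2_def cinner_self)
  have "inner (0 :: 'a l2) 0 = 0"
    unfolding inner_l2_def by transfer simp
  then show "(inner u u = 0) = (u = 0)"
    using cinner_self_eq_0[of u] by (auto simp: inner_l2_def)
  show "norm u = sqrt (inner u u)" by (rule norm_l2_def)
qed

end

section \<open>Weak derivatives, the Sobolev space of order 1 and momentum\<close>

definition partial_deriv :: "'d \<Rightarrow> (real ^ 'd \<Rightarrow> real) \<Rightarrow> real ^ 'd \<Rightarrow> real" where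
  "partial_deriv i f x = frechet_derivative f (at x) (axis i 1)"

primrec C_k :: "nat \<Rightarrow> (real ^ 'd \<Rightarrow> real) \<Rightarrow> bool" where
  "C_k 0 f \<longleftrightarrow> continuous_on UNIV f"
| "C_k (Suc k) f \<longleftrightarrow> (\<forall>x. f differentiable (at x)) \<and> (\<forall>i. C_k k (partial_deriv i f))"

definition test_function :: "(real ^ 'd \<Rightarrow> real) \<Rightarrow> bool" where
  "test_function \<phi> \<longleftrightarrow> (\<forall>k. C_k k \<phi>) \<and> compact (closure {x. \<phi> x \<noteq> 0})"

definition laplacian :: "(real ^ 'd \<Rightarrow> real) \<Rightarrow> real ^ 'd \<Rightarrow> real" where
  "laplacian f x = (\<Sum>i\<in>UNIV. partial_deriv i (partial_deriv i f) x)"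

definition has_weak_partial :: "'d::finite \<Rightarrow> 'd l2 \<Rightarrow> 'd l2 \<Rightarrow> bool" where
  "has_weak_partial i u g \<longleftrightarrow> (\<forall>\<phi>. test_function \<phi> \<longrightarrow>
     (\<integral>x. partial_deriv i \<phi> x *\<^sub>R rep_l2 u x \<partial>lborel) = - (\<integral>x. \<phi> x *\<^sub>R rep_l2 g x \<partial>lborel))"

definition has_weak_laplacian :: "'d::finite l2 \<Rightarrow> 'd l2 \<Rightarrow> bool" where
  "has_weak_laplacian u w \<longleftrightarrow> (\<forall>\<phi>. test_function \<phi> \<longrightarrow>
     (\<integral>x. laplacian \<phi> x *\<^sub>R rep_l2 u x \<partial>lborel) = (\<integral>x. \<phi> x *\<^sub>R rep_l2 w x \<partial>lborel))"

definition H1 :: "'d::finite l2 set" where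
  "H1 = {u. \<forall>i. \<exists>g. has_weak_partial i u g}"

definition weak_partial :: "'d::finite \<Rightarrow> 'd l2 \<Rightarrow> 'd l2" where
  "weak_partial i u = (THE g. has_weak_partial i u g)"

definition H1_norm :: "'d::finite l2 \<Rightarrow> real" where
  "H1_norm u = sqrt ((norm u)\<^sup>2 + (\<Sum>i\<in>UNIV. (norm (weak_partial i u))\<^sup>2))"

text \<open>\<open>p(u) = \<i> \<integral> (u \<nabla>(cnj u) - cnj u \<nabla>u)\<close>, meaningful for \<open>u \<in> H1\<close>.  The expression has the form
  \<open>\<i> (z - cnj z)\<close> and is real (lemma \<open>of_real_momentum\<close>); \<open>Re\<close> only changes the type.\<close>

definition momentum :: "'d::finite l2 \<Rightarrow> real ^ 'd" where
  "momentum u = (\<chi> i. Re (\<i> * (\<integral>x. rep_l2 u x * cnj (rep_l2 (weak_partial i u) x)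
                                   - cnj (rep_l2 u x) * rep_l2 (weak_partial i u) x \<partial>lborel)))"

lemma of_real_momentum:
  "complex_of_real (momentum u $ i) =
     \<i> * (\<integral>x. rep_l2 u x * cnj (rep_l2 (weak_partial i u) x)
               - cnj (rep_l2 u x) * rep_l2 (weak_partial i u) x \<partial>lborel)"
proof -
  let ?I = "\<integral>x. rep_l2 u x * cnj (rep_l2 (weak_partial i u) x)
               - cnj (rep_l2 u x) * rep_l2 (weak_partial i u) x \<partial>lborel"
  have "cnj ?I = (\<integral>x. - (rep_l2 u x * cnj (rep_l2 (weak_partial i u) x)
               - cnj (rep_l2 u x) * rep_l2 (weak_partial i u) x) \<partial>lborel)"
    by (subst Bochner_Integration.integral_cnj[symmetric]) (simp only: complex_cnj_diff complex_cnj_mult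
        complex_cnj_cnj minus_diff_eq)
  then have "cnj ?I = - ?I"
    by (simp only: Bochner_Integration.integral_minus)
  then have "Re (cnj ?I) = Re (- ?I)" by (simp only:)
  then have "Re ?I = 0" by simp
  then show ?thesis by (simp add: momentum_def complex_eq_iff)
qed

section \<open>Operators and the Schroedinger group\<close>

text \<open>Orthonormal basis of \<open>L\<^sup>2\<close> as a real Hilbert space, i.e. with respect to the real inner
  product.\<close>

definition orthonormal_basis :: "(nat \<Rightarrow> 'h::real_inner) \<Rightarrow> bool" where
  "orthonormal_basis e \<longleftrightarrow>
     (\<forall>j k. inner (e j) (e k) = (if j = k then 1 else 0)) \<and> closure (span (range e)) = UNIV"

definition nonneg_selfadjoint :: "('h::real_inner \<Rightarrow> 'h) \<Rightarrow> bool" where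
  "nonneg_selfadjoint Q \<longleftrightarrow> bounded_linear Q \<and>
     (\<forall>u v. inner (Q u) v = inner u (Q v)) \<and> (\<forall>u. 0 \<le> inner (Q u) u)"

definition is_sqrt_operator :: "('h::real_inner \<Rightarrow> 'h) \<Rightarrow> ('h \<Rightarrow> 'h) \<Rightarrow> bool" where
  "is_sqrt_operator Q R \<longleftrightarrow> nonneg_selfadjoint R \<and> (\<forall>u. R (R u) = Q u)"

text \<open>Squared Hilbert--Schmidt norm of an operator from \<open>L\<^sup>2\<close> to \<open>L\<^sup>2\<close>; it is independent of the
  orthonormal basis \<open>e\<close>, and so is the property of being Hilbert--Schmidt from \<open>L\<^sup>2\<close> to \<open>H1\<close>.\<close>

definition hs_norm2 :: "(nat \<Rightarrow> 'h::real_inner) \<Rightarrow> ('h \<Rightarrow> 'h) \<Rightarrow> ennreal" where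
  "hs_norm2 e A = (\<Sum>j. ennreal ((norm (A (e j)))\<^sup>2))"

definition hilbert_schmidt_H1 :: "(nat \<Rightarrow> 'd::finite l2) \<Rightarrow> ('d l2 \<Rightarrow> 'd l2) \<Rightarrow> bool" where
  "hilbert_schmidt_H1 e A \<longleftrightarrow> linear A \<and> range A \<subseteq> H1 \<and>
     (\<exists>C. \<forall>u. H1_norm (A u) \<le> C * norm u) \<and> summable (\<lambda>j. (H1_norm (A (e j)))\<^sup>2)"

definition hs_cinner ::
    "(nat \<Rightarrow> 'd::finite l2) \<Rightarrow> ('d l2 \<Rightarrow> 'd l2) \<Rightarrow> ('d l2 \<Rightarrow> 'd l2) \<Rightarrow> complex" where
  "hs_cinner e A B = (\<Sum>j. cinner (A (e j)) (B (e j)))"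

text \<open>The strongly continuous unitary group with infinitesimal generator \<open>- \<i> \<Delta>\<close>, the domain of
  \<open>\<Delta>\<close> being the set of all \<open>u \<in> L\<^sup>2\<close> with distributional Laplacian in \<open>L\<^sup>2\<close> (which is \<open>H\<^sup>2\<close>).\<close>

definition schroedinger_group :: "(real \<Rightarrow> 'd::finite l2 \<Rightarrow> 'd l2) \<Rightarrow> bool" where
  "schroedinger_group S \<longleftrightarrow>
     (\<forall>t u v. S t (u + v) = S t u + S t v) \<and>
     (\<forall>t c u. S t (cscale c u) = cscale c (S t u)) \<and>
     (\<forall>t u v. cinner (S t u) (S t v) = cinner u v) \<and> (\<forall>t. surj (S t)) \<and>
     S 0 = id \<and> (\<forall>s t. S (s + t) = S s \<circ> S t) \<and>
     (\<forall>u. continuous_on UNIV (\<lambda>t. S t u)) \<and>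
     (\<forall>u v. ((\<lambda>h. (S h u - u) /\<^sub>R h) \<longlongrightarrow> v) (at 0) \<longleftrightarrow>
            (\<exists>w. has_weak_laplacian u w \<and> v = cscale (- \<i>) w))"

section \<open>Wiener process, stochastic integral and mild solution\<close>

locale normal_filtration = prob_space M for M :: "'w measure" +
  fixes F :: "real \<Rightarrow> 'w measure"
  assumes subalgebra_M: "0 \<le> t \<Longrightarrow> subalgebra M (F t)"
    and increasing: "0 \<le> s \<Longrightarrow> s \<le> t \<Longrightarrow> sets (F s) \<subseteq> sets (F t)"
    and right_continuous: "0 \<le> t \<Longrightarrow> sets (F t) = (\<Inter>s\<in>{t<..}. sets (F s))"
    and contains_null_sets: "null_sets M \<subseteq> sets (F 0)"

text \<open>Normal distribution with mean \<open>0\<close> and variance \<open>v\<close>; degenerate if \<open>v = 0\<close>.\<close>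

definition centred_normal :: "'w measure \<Rightarrow> ('w \<Rightarrow> real) \<Rightarrow> real \<Rightarrow> bool" where
  "centred_normal M X v \<longleftrightarrow>
     (if v = 0 then X \<in> borel_measurable M \<and> (AE \<omega> in M. X \<omega> = 0)
      else distributed M lborel X (normal_density 0 (sqrt v)))"

definition Q_wiener_process ::
    "'w measure \<Rightarrow> (real \<Rightarrow> 'w measure) \<Rightarrow> ('h::real_inner \<Rightarrow> 'h) \<Rightarrow> (real \<Rightarrow> 'w \<Rightarrow> 'h) \<Rightarrow> bool" where
  "Q_wiener_process M F Q W \<longleftrightarrow>
     (AE \<omega> in M. W 0 \<omega> = 0) \<and>
     (AE \<omega> in M. continuous_on {0..} (\<lambda>t. W t \<omega>)) \<and>
     (\<forall>t\<ge>0. W t \<in> borel_measurable (F t)) \<and>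
     (\<forall>t\<ge>0. integrable M (\<lambda>\<omega>. (norm (W t \<omega>))\<^sup>2)) \<and>
     (\<forall>s t. 0 \<le> s \<and> s \<le> t \<longrightarrow>
        prob_space.indep_set M (sets (F s))
          (sets (vimage_algebra (space M) (\<lambda>\<omega>. W t \<omega> - W s \<omega>) borel))) \<and>
     (\<forall>s t h. 0 \<le> s \<and> s \<le> t \<longrightarrow>
        centred_normal M (\<lambda>\<omega>. inner (W t \<omega> - W s \<omega>) h) ((t - s) * inner (Q h) h))"

text \<open>Elementary operator-valued integrands on \<open>[0, t]\<close> are \<open>L k\<close> on \<open>(\<tau> k, \<tau> (Suc k)]\<close> for \<open>k < N\<close>.
  They are deterministic: a deterministic integrand such as \<open>r \<mapsto> S (t - r)\<close> is a limit of
  deterministic elementary ones, so that this yields its Ito integral.\<close>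

definition elementary_integrand ::
    "real \<Rightarrow> nat \<Rightarrow> (nat \<Rightarrow> real) \<Rightarrow> (nat \<Rightarrow> 'h::real_inner \<Rightarrow> 'h) \<Rightarrow> bool" where
  "elementary_integrand t N \<tau> L \<longleftrightarrow> \<tau> 0 = 0 \<and> \<tau> N = t \<and>
     (\<forall>k<N. \<tau> k \<le> \<tau> (Suc k)) \<and> (\<forall>k<N. bounded_linear (L k))"

definition elementary_value ::
    "nat \<Rightarrow> (nat \<Rightarrow> real) \<Rightarrow> (nat \<Rightarrow> 'h::real_inner \<Rightarrow> 'h) \<Rightarrow> real \<Rightarrow> 'h \<Rightarrow> 'h" where
  "elementary_value N \<tau> L r h = (\<Sum>k<N. indicator {\<tau> k<..\<tau> (Suc k)} r *\<^sub>R L k h)"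

definition elementary_integral ::
    "nat \<Rightarrow> (nat \<Rightarrow> real) \<Rightarrow> (nat \<Rightarrow> 'h::real_inner \<Rightarrow> 'h) \<Rightarrow> (real \<Rightarrow> 'w \<Rightarrow> 'h) \<Rightarrow> 'w \<Rightarrow> 'h" where
  "elementary_integral N \<tau> L W \<omega> = (\<Sum>k<N. L k (W (\<tau> (Suc k)) \<omega> - W (\<tau> k) \<omega>))"

text \<open>\<open>X = \<integral>\<^sub>0\<^sup>t \<Phi>(r) dW(r)\<close>, where \<open>R\<close> is the square root of the covariance operator of \<open>W\<close>: the
  integral is the mean square limit of the integrals of elementary integrands approximating \<open>\<Phi>\<close> in
  the norm \<open>(\<integral>\<^sub>0\<^sup>t \<parallel>\<Phi>(r) \<circ> R\<parallel>\<^sup>2 dr)\<^bsup>1/2\<^esup>\<close>, with the Hilbert--Schmidt norm inside; by the Ito isometry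
  it is almost surely unique and does not depend on the approximating sequence.\<close>

definition has_stochastic_integral ::
    "'w measure \<Rightarrow> (nat \<Rightarrow> 'h::real_inner) \<Rightarrow> ('h \<Rightarrow> 'h) \<Rightarrow> (real \<Rightarrow> 'w \<Rightarrow> 'h) \<Rightarrow>
       (real \<Rightarrow> 'h \<Rightarrow> 'h) \<Rightarrow> real \<Rightarrow> ('w \<Rightarrow> 'h) \<Rightarrow> bool" where
  "has_stochastic_integral M e R W \<Phi> t X \<longleftrightarrow> X \<in> borel_measurable M \<and>
     (\<exists>N \<tau> L. (\<forall>n. elementary_integrand t (N n) (\<tau> n) (L n)) \<and>
        (\<lambda>n. \<integral>\<^sup>+r\<in>{0..t}. hs_norm2 e (\<lambda>h. elementary_value (N n) (\<tau> n) (L n) r (R h) - \<Phi> r (R h)) \<partial>lborel)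
          \<longlonglongrightarrow> 0 \<and>
        (\<lambda>n. \<integral>\<^sup>+\<omega>. ennreal ((norm (elementary_integral (N n) (\<tau> n) (L n) W \<omega> - X \<omega>))\<^sup>2) \<partial>M) \<longlonglongrightarrow> 0)"

text \<open>\<open>u(t) = S(t) u0 - \<i> \<integral>\<^sub>0\<^sup>t S(t - r) dW(r)\<close>\<close>

definition mild_solution ::
    "'w measure \<Rightarrow> (real \<Rightarrow> 'w measure) \<Rightarrow> (nat \<Rightarrow> 'd::finite l2) \<Rightarrow> ('d l2 \<Rightarrow> 'd l2) \<Rightarrow>
       (real \<Rightarrow> 'w \<Rightarrow> 'd l2) \<Rightarrow> (real \<Rightarrow> 'd l2 \<Rightarrow> 'd l2) \<Rightarrow> ('w \<Rightarrow> 'd l2) \<Rightarrow> (real \<Rightarrow> 'w \<Rightarrow> 'd l2) \<Rightarrow> bool" where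
  "mild_solution M F e R W S u0 u \<longleftrightarrow>
     (\<forall>t\<ge>0. u t \<in> borel_measurable (F t) \<and>
        (\<exists>X. has_stochastic_integral M e R W (\<lambda>r. S (t - r)) t X \<and>
             (AE \<omega> in M. u t \<omega> = S t (u0 \<omega>) - cscale \<i> (X \<omega>))))"

end

theory Submission
  imports Defs
begin

text \<open>The momentum is the quadratic form \<open>p(u) = -2 (u, \<i> \<nabla>u)\<close>.  Conjugating \<open>S\<close> with a translation
  gives an isometric group with the same generator, so \<open>S\<close> commutes with translations, hence with
  difference quotients and their limits, the weak derivatives, and leaves \<open>p\<close> invariant.  With
  \<open>X = \<integral>\<^sub>0\<^sup>t S(t - r) dW(r)\<close>, expanding \<open>p(S(t) u\<^sub>0 - \<i> X)\<close> yields \<open>p(u\<^sub>0) + p(X)\<close> and the cross term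
  \<open>4 (S(t) \<nabla>u\<^sub>0, X)\<close>, whose mean is \<open>0\<close> because \<open>X\<close> is orthogonal to the bounded \<open>F\<^sub>0\<close>-measurable
  truncations of \<open>S(t) \<nabla>u\<^sub>0\<close>.  For a bounded bilinear form \<open>B\<close> that is invariant under \<open>S\<close>, the Ito
  isometry reads \<open>E B(X, X) = t \<Sum>\<^sub>j B(Q\<^bsup>1/2\<^esup> e\<^sub>j, Q\<^bsup>1/2\<^esup> e\<^sub>j)\<close>.  Applied to forms made of difference quotients
  it shows, in the limit, that \<open>X\<close> is almost surely in \<open>H\<^sup>1\<close> and that \<open>E p(X) = t \<Sum>\<^sub>j p(Q\<^bsup>1/2\<^esup> e\<^sub>j)\<close>.\<close>


section \<open>The Hilbert space structure\<close>


text \<open>Integrability of p(u0) controls neither u0 nor its gradient: a real-valued u0 has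
  momentum zero however large its gradient is. Whether the cross term has a mean at all is therefore
  the main obstacle, and it explains the weight \<phi> in the isometry. Integration by parts moves
  the derivative to X, and with \<phi> a truncation of the norm of u0 the weighted isometry bounds
  the mean of |u0| |grad X|^2 by the first moment of u0 times a constant. When p(u(t)) is known to
  be integrable, the cross term is integrable as a combination of three integrable momenta. The
  gradient is unbounded, so identities for X are proved for difference quotients before the limit is
  taken; the bound of a quotient by the weak derivative (\<open>norm_dquot_le\<close>) supplies the
  dominating functions. Mean square limits are handled by 2ab \<le> a^2/\<epsilon> + \<epsilon> b^2
  with free \<epsilon>, so that only integrals of squares have to be estimated.\<close>

lemma rep_abs_l2: "square_integrable f \<Longrightarrow> AE x in lborel. rep_l2 (abs_l2 f) x = f x"
  using Quotient3_rep_abs[OF Quotient3_l2, of f] by (simp add: l2_rel_def)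

lemma borel_measurable_rep_l2 [measurable]: "rep_l2 u \<in> borel_measurable lborel"
  using square_integrable_rep[of u] by (simp add: square_integrable_def)

lemma l2_eqI: "AE x in lborel. rep_l2 u x = rep_l2 v x \<Longrightarrow> u = v"
  using Quotient3_rel_rep[OF Quotient3_l2, of u v]
  by (simp add: l2_rel_def square_integrable_rep)

lemma rep_l2_minus: "AE x in lborel. rep_l2 (u - v) x = rep_l2 u x - rep_l2 v x"
  using rep_abs_l2[OF square_integrable_minus[OF square_integrable_rep[of u] square_integrable_rep[of v]]]
  by (simp add: minus_l2_def)

lemma rep_l2_add: "AE x in lborel. rep_l2 (u + v) x = rep_l2 u x + rep_l2 v x"
  using rep_abs_l2[OF square_integrable_add[OF square_integrable_rep[of u] square_integrable_rep[of v]]]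
  by (simp add: plus_l2_def)

lemma rep_l2_cscale: "AE x in lborel. rep_l2 (cscale c u) x = c * rep_l2 u x"
  using rep_abs_l2[OF square_integrable_mult[OF square_integrable_rep[of u]]]
  by (simp add: cscale_def)

lemma rep_l2_scaleR: "AE x in lborel. rep_l2 (c *\<^sub>R u) x = c *\<^sub>R rep_l2 u x"
  using rep_l2_cscale[of "of_real c" u] by (simp add: scaleR_l2_def scaleR_conv_of_real)

lemma rep_l2_zero: "AE x in lborel. rep_l2 0 x = 0"
  using rep_abs_l2[OF square_integrable_zero] by (simp add: zero_l2_def)

lemma power2_norm_l2: "(norm u)\<^sup>2 = (\<integral>x. (norm (rep_l2 u x))\<^sup>2 \<partial>lborel)"
  by (simp add: power2_norm_eq_inner inner_l2_def cinner_self)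

lemma nn_integral_norm_l2: "(\<integral>\<^sup>+x. ennreal ((norm (rep_l2 u x))\<^sup>2) \<partial>lborel) = ennreal ((norm u)\<^sup>2)"
  unfolding power2_norm_l2
  by (rule nn_integral_eq_integral) (use square_integrable_rep[of u] in \<open>auto simp: square_integrable_def\<close>)

lemma square_integrable_norm: "square_integrable f \<Longrightarrow> square_integrable (\<lambda>x. complex_of_real (norm (f x)))"
  by (auto simp: square_integrable_def)

lemma norm_abs_l2:
  assumes "square_integrable f"
  shows "(norm (abs_l2 f))\<^sup>2 = (\<integral>x. (norm (f x))\<^sup>2 \<partial>lborel)"
  unfolding power2_norm_l2
proof (rule integral_cong_AE)
  have [measurable]: "f \<in> borel_measurable lborel"
    using assms by (simp add: square_integrable_def)
  show "(\<lambda>x. (norm (f x))\<^sup>2) \<in> borel_measurable lborel" by simp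
  show "AE x in lborel. (norm (rep_l2 (abs_l2 f) x))\<^sup>2 = (norm (f x))\<^sup>2"
    using rep_abs_l2[OF assms] by eventually_elim simp
qed simp

lemma square_integrable_nnI:
  assumes "f \<in> borel_measurable lborel" "(\<integral>\<^sup>+x. ennreal ((norm (f x))\<^sup>2) \<partial>lborel) < \<infinity>"
  shows "square_integrable f"
  unfolding square_integrable_def using assms by (auto simp: integrable_iff_bounded)

text \<open>The absolute value is kept inside the space so that a sum of absolute values of
  representatives is again an element, whose norm the triangle inequality bounds. This is the
  Minkowski step of the completeness proof.\<close>

definition modulus_l2 :: "'d::finite l2 \<Rightarrow> 'd l2" where
  "modulus_l2 u = abs_l2 (\<lambda>x. complex_of_real (norm (rep_l2 u x)))"

lemma rep_modulus_l2: "AE x in lborel. rep_l2 (modulus_l2 u) x = complex_of_real (norm (rep_l2 u x))"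
  unfolding modulus_l2_def by (rule rep_abs_l2 square_integrable_norm square_integrable_rep)+

lemma norm_modulus_l2: "norm (modulus_l2 u) = norm u"
proof -
  have "(norm (modulus_l2 u))\<^sup>2 = (norm u)\<^sup>2"
    unfolding modulus_l2_def norm_abs_l2[OF square_integrable_norm[OF square_integrable_rep]]
    by (simp add: power2_norm_l2)
  then show ?thesis by simp
qed

lemma rep_sum_modulus_l2:
  "AE x in lborel. rep_l2 (\<Sum>k<(n::nat). modulus_l2 (d k)) x = complex_of_real (\<Sum>k<n. norm (rep_l2 (d k) x))"
proof (induction n)
  case 0
  then show ?case using rep_l2_zero by simp
next
  case (Suc n)
  then show ?case
    using rep_l2_add[of "\<Sum>k<n. modulus_l2 (d k)" "modulus_l2 (d n)"] rep_modulus_l2[of "d n"]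
    by eventually_elim simp
qed

text \<open>The argument of Riesz and Fischer: a sequence with summable increments converges almost
  everywhere, and by Fatou's lemma also in \<open>L\<^sup>2\<close>.\<close>

lemma l2_summable_increments_AE:
  fixes u :: "nat \<Rightarrow> 'd::finite l2"
  assumes "summable (\<lambda>n. norm (u (Suc n) - u n))"
  shows "AE x in lborel. convergent (\<lambda>n. rep_l2 (u n) x)"
proof -
  define d where "d n = u (Suc n) - u n" for n
  define g where "g n x = (\<Sum>k<n. norm (rep_l2 (d k) x))" for n x
  define C where "C = (\<Sum>n. norm (d n))"
  have summ: "summable (\<lambda>n. norm (d n))" using assms by (simp add: d_def)
  have g_meas [measurable]: "g n \<in> borel_measurable lborel" for n
    unfolding g_def by measurable
  \<comment> \<open>By the triangle inequality for the moduli, the squared partial sums have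
    integrals bounded uniformly in \<open>n\<close>. Monotone convergence then makes their supremum
    integrable, hence finite almost everywhere.\<close>
  have bound: "(\<integral>\<^sup>+x. ennreal ((g n x)\<^sup>2) \<partial>lborel) \<le> ennreal (C\<^sup>2)" for n
  proof -
    have "(\<integral>\<^sup>+x. ennreal ((g n x)\<^sup>2) \<partial>lborel)
        = (\<integral>\<^sup>+x. ennreal ((norm (rep_l2 (\<Sum>k<n. modulus_l2 (d k)) x))\<^sup>2) \<partial>lborel)"
      using rep_sum_modulus_l2[where d=d and n=n] unfolding g_def
      by (intro nn_integral_cong_AE) (auto elim!: eventually_mono simp del: of_real_sum simp: norm_of_real)
    also have "\<dots> = ennreal ((norm (\<Sum>k<n. modulus_l2 (d k)))\<^sup>2)"
      by (rule nn_integral_norm_l2)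
    also have "\<dots> \<le> ennreal (C\<^sup>2)"
    proof (intro ennreal_leI power_mono)
      have "norm (\<Sum>k<n. modulus_l2 (d k)) \<le> (\<Sum>k<n. norm (d k))"
        by (rule order_trans[OF norm_sum]) (simp add: norm_modulus_l2)
      also have "\<dots> \<le> C"
        unfolding C_def by (rule sum_le_suminf[OF summ]) auto
      finally show "norm (\<Sum>k<n. modulus_l2 (d k)) \<le> C" .
    qed simp
    finally show ?thesis .
  qed
  have "(\<integral>\<^sup>+x. (SUP n. ennreal ((g n x)\<^sup>2)) \<partial>lborel) = (SUP n. \<integral>\<^sup>+x. ennreal ((g n x)\<^sup>2) \<partial>lborel)"
  proof (rule nn_integral_monotone_convergence_SUP)
    show "incseq (\<lambda>n x. ennreal ((g n x)\<^sup>2))"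
      unfolding incseq_Suc_iff le_fun_def g_def
      by (auto intro!: ennreal_leI power_mono sum_nonneg)
  qed simp
  also have "\<dots> \<le> ennreal (C\<^sup>2)" by (rule SUP_least) (rule bound)
  finally have "(\<integral>\<^sup>+x. (SUP n. ennreal ((g n x)\<^sup>2)) \<partial>lborel) \<noteq> \<infinity>"
    by (auto simp: top_unique)
  then have "AE x in lborel. (SUP n. ennreal ((g n x)\<^sup>2)) \<noteq> \<infinity>"
    by (intro nn_integral_PInf_AE) auto
  moreover have "AE x in lborel. \<forall>n. rep_l2 (d n) x = rep_l2 (u (Suc n)) x - rep_l2 (u n) x"
    unfolding AE_all_countable d_def by (rule allI, rule rep_l2_minus)
  ultimately show ?thesis
  proof eventually_elim
    case (elim x)
    then obtain c where c: "(SUP n. ennreal ((g n x)\<^sup>2)) = ennreal c" "0 \<le> c"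
      by (cases "(SUP n. ennreal ((g n x)\<^sup>2))") auto
    have "g n x \<le> sqrt c" for n
    proof -
      have "ennreal ((g n x)\<^sup>2) \<le> ennreal c" unfolding c(1)[symmetric] by (rule SUP_upper) simp
      then have "(g n x)\<^sup>2 \<le> c" using c(2) by (simp add: ennreal_le_iff)
      then show ?thesis by (rule real_le_rsqrt)
    qed
    then have "(\<Sum>k\<le>n. norm (rep_l2 (d k) x)) \<le> sqrt c" for n
      unfolding g_def lessThan_Suc_atMost[symmetric] by blast
    then have "summable (\<lambda>k. norm (rep_l2 (d k) x))"
      by (intro bounded_imp_summable[where B="sqrt c"]) auto
    then have "summable (\<lambda>k. rep_l2 (d k) x)" by (rule summable_norm_cancel)
    then have "convergent (\<lambda>n. \<Sum>k<n. rep_l2 (d k) x)" by (simp add: summable_iff_convergent)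
    moreover have "(\<Sum>k<n. rep_l2 (d k) x) = rep_l2 (u n) x - rep_l2 (u 0) x" for n
      by (induction n) (auto simp: elim(2))
    ultimately have "convergent (\<lambda>n. rep_l2 (u n) x - rep_l2 (u 0) x)" by simp
    then show ?case using convergent_add[OF _ convergent_const[of "rep_l2 (u 0) x"]] by fastforce
  qed
qed

lemma l2_summable_increments_convergent:
  fixes u :: "nat \<Rightarrow> 'd::finite l2"
  assumes summ: "summable (\<lambda>n. norm (u (Suc n) - u n))"
  shows "convergent u"
proof -
  define f where "f x = lim (\<lambda>n. rep_l2 (u n) x)" for x
  have lim: "AE x in lborel. (\<lambda>n. rep_l2 (u n) x) \<longlonglongrightarrow> f x"
    using l2_summable_increments_AE[OF summ] unfolding f_def
    by eventually_elim (simp add: convergent_LIMSEQ_iff)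
  have f_meas [measurable]: "f \<in> borel_measurable lborel"
    unfolding f_def by measurable
  \<comment> \<open>The tail of the series of increments bounds the distance from \<open>u n\<close>
    to every later member of the sequence.\<close>
  define T where "T n = (\<Sum>k. norm (u (Suc (k + n)) - u (k + n)))" for n
  have dist_le: "norm (u m - u n) \<le> T n" if "n \<le> m" for m n
  proof -
    have "norm (u m - u n) \<le> (\<Sum>k<m-n. norm (u (Suc (k + n)) - u (k + n)))"
    proof -
      have "u m - u n = (\<Sum>k<m-n. u (Suc k + n) - u (k + n))"
        using that by (subst sum_lessThan_telescope[of "\<lambda>k. u (k + n)"]) simp
      then show ?thesis by (simp add: norm_sum)
    qed
    also have "\<dots> \<le> T n" unfolding T_def
      by (rule sum_le_suminf) (use summ summable_ignore_initial_segment[OF summ, of n] in auto)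
    finally show ?thesis .
  qed
  have T_nonneg: "0 \<le> T n" for n using dist_le[of n n] by simp
  have T_lim: "T \<longlonglongrightarrow> 0"
    unfolding T_def using suminf_exist_split2[OF summ] by simp
  \<comment> \<open>Fatou's lemma in \<open>m\<close> with \<open>n\<close> fixed passes the tail
    bound on to the pointwise limit \<open>f\<close>. It also yields that \<open>f\<close> is square
    integrable, which is not known before.\<close>
  have close: "(\<integral>\<^sup>+x. ennreal ((norm (f x - rep_l2 (u n) x))\<^sup>2) \<partial>lborel) \<le> ennreal ((T n)\<^sup>2)" for n
  proof -
    have "(\<integral>\<^sup>+x. ennreal ((norm (f x - rep_l2 (u n) x))\<^sup>2) \<partial>lborel)
       = (\<integral>\<^sup>+x. liminf (\<lambda>m. ennreal ((norm (rep_l2 (u m) x - rep_l2 (u n) x))\<^sup>2)) \<partial>lborel)"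
    proof (rule nn_integral_cong_AE)
      show "AE x in lborel. ennreal ((norm (f x - rep_l2 (u n) x))\<^sup>2) =
        liminf (\<lambda>m. ennreal ((norm (rep_l2 (u m) x - rep_l2 (u n) x))\<^sup>2))"
        using lim
      proof eventually_elim
        case (elim x)
        have "(\<lambda>m. ennreal ((norm (rep_l2 (u m) x - rep_l2 (u n) x))\<^sup>2))
          \<longlonglongrightarrow> ennreal ((norm (f x - rep_l2 (u n) x))\<^sup>2)"
          by (intro tendsto_intros elim)
        then show ?case by (intro lim_imp_Liminf[symmetric]) auto
      qed
    qed
    also have "\<dots> \<le> liminf (\<lambda>m. \<integral>\<^sup>+x. ennreal ((norm (rep_l2 (u m) x - rep_l2 (u n) x))\<^sup>2) \<partial>lborel)"
      by (rule nn_integral_liminf) measurable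
    also have "\<dots> = liminf (\<lambda>m. ennreal ((norm (u m - u n))\<^sup>2))"
    proof (intro arg_cong[where f=liminf] ext)
      fix m
      show "(\<integral>\<^sup>+x. ennreal ((norm (rep_l2 (u m) x - rep_l2 (u n) x))\<^sup>2) \<partial>lborel)
        = ennreal ((norm (u m - u n))\<^sup>2)"
        unfolding nn_integral_norm_l2[symmetric]
        by (intro nn_integral_cong_AE) (use rep_l2_minus[of "u m" "u n"] in \<open>auto elim: eventually_mono\<close>)
    qed
    also have "\<dots> \<le> liminf (\<lambda>m. ennreal ((T n)\<^sup>2))"
      by (intro Liminf_mono eventually_sequentiallyI[of n] ennreal_leI power_mono dist_le) auto
    also have "\<dots> = ennreal ((T n)\<^sup>2)" by (simp add: Liminf_const)
    finally show ?thesis .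
  qed
  have diff_sq: "square_integrable (\<lambda>x. f x - rep_l2 (u n) x)" for n
    by (rule square_integrable_nnI) (measurable, rule le_less_trans[OF close], simp)
  have f_sq: "square_integrable f"
    using square_integrable_add[OF diff_sq[of 0] square_integrable_rep[of "u 0"]] by simp
  have "norm (u n - abs_l2 f) \<le> T n" for n
  proof -
    have "ennreal ((norm (abs_l2 f - u n))\<^sup>2) \<le> ennreal ((T n)\<^sup>2)"
    proof -
      have "AE x in lborel. rep_l2 (abs_l2 f - u n) x = f x - rep_l2 (u n) x"
        using rep_l2_minus[of "abs_l2 f" "u n"] rep_abs_l2[OF f_sq] by eventually_elim simp
      then have "ennreal ((norm (abs_l2 f - u n))\<^sup>2) = (\<integral>\<^sup>+x. ennreal ((norm (f x - rep_l2 (u n) x))\<^sup>2) \<partial>lborel)"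
        unfolding nn_integral_norm_l2[symmetric] by (intro nn_integral_cong_AE) (auto elim: eventually_mono)
      then show ?thesis using close by simp
    qed
    then show ?thesis using T_nonneg[of n] by (simp add: norm_minus_commute abs_le_square_iff[symmetric])
  qed
  then have "(\<lambda>n. u n - abs_l2 f) \<longlonglongrightarrow> 0"
    by (intro Lim_null_comparison[OF _ T_lim]) simp
  then have "u \<longlonglongrightarrow> abs_l2 f" by (simp add: LIM_zero_iff)
  then show ?thesis by (rule convergentI)
qed

lemma Cauchy_fast_subsequence:
  fixes X :: "nat \<Rightarrow> 'a::metric_space"
  assumes "Cauchy X"
  obtains r :: "nat \<Rightarrow> nat" where "strict_mono r" "\<And>n. dist (X (r (Suc n))) (X (r n)) < (1/2)^n"
proof -
  have "\<forall>k. \<exists>N. \<forall>m\<ge>N. \<forall>n\<ge>N. dist (X m) (X n) < (1/2)^k"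
    using assms unfolding Cauchy_def by simp
  then obtain N where N: "\<And>k m n. m \<ge> N k \<Longrightarrow> n \<ge> N k \<Longrightarrow> dist (X m) (X n) < (1/2)^k"
    by metis
  \<comment> \<open>The summand \<open>k\<close> makes \<open>r\<close> strictly increasing, and
    summing all thresholds up to \<open>k\<close> keeps \<open>r k\<close> above
    \<open>N k\<close>.\<close>
  define r where "r k = k + (\<Sum>i\<le>k. N i)" for k
  have "strict_mono r" by (auto simp: strict_mono_Suc_iff r_def)
  moreover have "r k \<ge> N k" for k
    unfolding r_def by (rule trans_le_add2) (rule member_le_sum, auto)
  moreover have "r (Suc k) \<ge> r k" for k by (simp add: r_def)
  ultimately show ?thesis using that N by (metis order_trans)
qed

instance l2 :: (finite) complete_space
proof
  fix X :: "nat \<Rightarrow> 'a l2"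
  assume "Cauchy X"
  obtain r where r: "strict_mono r" "\<And>n. dist (X (r (Suc n))) (X (r n)) < (1/2)^n"
    using Cauchy_fast_subsequence[OF \<open>Cauchy X\<close>] by blast
  have "convergent (X \<circ> r)"
  proof (rule l2_summable_increments_convergent)
    have "summable (\<lambda>n. (1/2::real)^n)" by simp
    then show "summable (\<lambda>n. norm ((X \<circ> r) (Suc n) - (X \<circ> r) n))"
      by (rule summable_comparison_test[rotated]) (use r(2) in \<open>auto simp: dist_norm intro: less_imp_le\<close>)
  qed
  then obtain l where "(X \<circ> r) \<longlonglongrightarrow> l" by (auto simp: convergent_def)
  then show "convergent X"
    using Cauchy_converges_subseq[OF \<open>Cauchy X\<close> r(1)] by (auto simp: convergent_def)
qed

instance l2 :: (finite) banach ..

section \<open>Complex scalars and the real inner product\<close>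

lemma cscale_cscale: "cscale a (cscale b u) = cscale (a * b) u"
  by transfer (auto simp: l2_rel_def mult.assoc intro!: square_integrable_mult)

lemma cscale_one [simp]: "cscale 1 u = u"
  by transfer (simp add: l2_rel_def)

lemma cscale_of_real: "cscale (complex_of_real r) u = r *\<^sub>R u"
  by (simp add: scaleR_l2_def)

lemma cscale_add_right: "cscale c (u + v) = cscale c u + cscale c v"
  by transfer (auto simp: l2_rel_def algebra_simps intro!: square_integrable_mult square_integrable_add)

lemma cscale_scaleR: "cscale c (r *\<^sub>R u) = r *\<^sub>R cscale c u"
  by (simp add: scaleR_l2_def cscale_cscale mult.commute)

lemma cinner_cscale_right: "cinner u (cscale c v) = cnj c * cinner u v"
  by (subst (1 2) cinner_commute) (simp add: cinner_cscale_left)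

lemma norm_cscale: "norm (cscale c u) = norm c * norm u"
proof -
  have "(norm (cscale c u))\<^sup>2 = (norm c * norm u)\<^sup>2"
  proof -
    have "cinner (cscale c u) (cscale c u) = (c * cnj c) * cinner u u"
      by (simp add: cinner_cscale_left cinner_cscale_right)
    also have "\<dots> = complex_of_real ((norm c)\<^sup>2 * Re (cinner u u))"
      unfolding of_real_mult complex_norm_square by (simp add: cinner_self)
    finally show ?thesis
      unfolding power_mult_distrib power2_norm_eq_inner[of u] power2_norm_eq_inner[of "cscale c u"]
        inner_l2_def by simp
  qed
  then show ?thesis by simp
qed

lemma bounded_linear_cscale: "bounded_linear (cscale c)"
  by (rule bounded_linear_intro[of _ "norm c"]) (simp_all add: cscale_add_right cscale_scaleR norm_cscale mult.commute)

lemma inner_ii_left: "inner (cscale \<i> u) v = - inner u (cscale \<i> v)"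
  by (simp add: inner_l2_def cinner_cscale_left cinner_cscale_right)

lemma inner_ii_ii: "inner (cscale \<i> u) (cscale \<i> v) = inner u v"
  by (simp add: inner_ii_left cscale_cscale) (simp add: inner_l2_def cinner_cscale_right)

text \<open>Since \<open>cinner\<close> is conjugate linear on the right, multiplication by \<i>
  there exchanges real and imaginary part. Imaginary parts thus become values of the real inner
  product, in which the whole argument is carried out.\<close>

lemma Im_cinner: "Im (cinner u v) = inner u (cscale \<i> v)"
  by (simp add: inner_l2_def cinner_cscale_right)

text \<open>The factor 2 arises from estimating real and imaginary part separately. Boundedness and
  summability are all that is drawn from it.\<close>

lemma cmod_cinner_le: "cmod (cinner u v) \<le> 2 * (norm u * norm v)"
proof -
  have "\<bar>Re (cinner u v)\<bar> \<le> norm u * norm v"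
    using Cauchy_Schwarz_ineq2[of u v] by (simp add: inner_l2_def)
  moreover have "\<bar>Im (cinner u v)\<bar> \<le> norm u * norm v"
    using Cauchy_Schwarz_ineq2[of u "cscale \<i> v"] by (simp add: Im_cinner norm_cscale)
  ultimately show ?thesis using cmod_le[of "cinner u v"] by linarith
qed

section \<open>Smooth bump functions\<close>

text \<open>The derivative is an existential witness rather than the value of an operator, so that
  the closure rules under sums, products and affine substitution exhibit it by formula.\<close>

primrec smooth1 :: "nat \<Rightarrow> (real \<Rightarrow> real) \<Rightarrow> bool" where
  "smooth1 0 f \<longleftrightarrow> continuous_on UNIV f"
| "smooth1 (Suc k) f \<longleftrightarrow> (\<exists>f'. (\<forall>x. (f has_real_derivative f' x) (at x)) \<and> smooth1 k f')"

lemma smooth1_SucD: "smooth1 (Suc k) f \<Longrightarrow> smooth1 k f"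
proof (induction k arbitrary: f)
  case 0
  then obtain f' where "\<forall>x. (f has_real_derivative f' x) (at x)" by auto
  then have "\<forall>x\<in>UNIV. isCont f x" using DERIV_isCont by metis
  then show ?case by (simp add: continuous_at_imp_continuous_on)
next
  case (Suc k)
  from Suc.prems obtain f' where "\<forall>x. (f has_real_derivative f' x) (at x)" "smooth1 (Suc k) f'"
    by (subst (asm) smooth1.simps) (elim exE conjE)
  with Suc.IH[of f'] show ?case by (subst smooth1.simps) (intro exI conjI)
qed

lemma smooth1_add: "smooth1 k f \<Longrightarrow> smooth1 k g \<Longrightarrow> smooth1 k (\<lambda>x. f x + g x)"
proof (induction k arbitrary: f g)
  case 0
  then show ?case by (simp add: continuous_on_add)
next
  case (Suc k)
  from Suc.prems obtain f' g' where *: "\<forall>x. (f has_real_derivative f' x) (at x)" "smooth1 k f'"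
    "\<forall>x. (g has_real_derivative g' x) (at x)" "smooth1 k g'"
    by auto
  have "smooth1 k (\<lambda>x. f' x + g' x)" using *(2,4) by (rule Suc.IH)
  moreover have "((\<lambda>x. f x + g x) has_real_derivative (f' x + g' x)) (at x)" for x
    by (rule DERIV_add[OF spec[OF *(1)] spec[OF *(3)]])
  ultimately show ?case unfolding smooth1.simps by (intro exI[of _ "\<lambda>x. f' x + g' x"]) simp
qed

lemma smooth1_mult: "smooth1 k f \<Longrightarrow> smooth1 k g \<Longrightarrow> smooth1 k (\<lambda>x. f x * g x)"
proof (induction k arbitrary: f g)
  case 0
  then show ?case by (simp add: continuous_on_mult)
next
  case (Suc k)
  from Suc.prems obtain f' g' where *: "\<forall>x. (f has_real_derivative f' x) (at x)" "smooth1 k f'"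
    "\<forall>x. (g has_real_derivative g' x) (at x)" "smooth1 k g'"
    by auto
  have "smooth1 k (\<lambda>x. f' x * g x + f x * g' x)"
    by (intro smooth1_add Suc.IH *(2,4) smooth1_SucD[OF Suc.prems(1)] smooth1_SucD[OF Suc.prems(2)])
  moreover have "((\<lambda>x. f x * g x) has_real_derivative (f' x * g x + f x * g' x)) (at x)" for x
    using DERIV_mult'[OF spec[OF *(1)] spec[OF *(3)], of x] by (simp add: add.commute)
  ultimately show ?case unfolding smooth1.simps by (intro exI[of _ "\<lambda>x. f' x * g x + f x * g' x"]) simp
qed

lemma smooth1_affine: "smooth1 k f \<Longrightarrow> smooth1 k (\<lambda>x. f (c * x + d))"
proof (induction k arbitrary: f)
  case 0
  then show ?case by (simp add: continuous_on_compose2[of UNIV f] continuous_intros)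
next
  case (Suc k)
  from Suc.prems obtain f' where *: "\<forall>x. (f has_real_derivative f' x) (at x)" "smooth1 k f'" by auto
  have "smooth1 k (\<lambda>x. c)" for c :: real
  proof (induction k arbitrary: c)
    case (Suc k) then show ?case by (auto intro!: exI[of _ "\<lambda>_. 0"])
  qed auto
  with Suc.IH[OF *(2)] have "smooth1 k (\<lambda>x. f' (c * x + d) * c)" by (rule smooth1_mult)
  moreover have "((\<lambda>x. f (c * x + d)) has_real_derivative (f' (c * x + d) * c)) (at x)" for x
    by (rule DERIV_chain2[of f, OF spec[OF *(1)]]) (auto intro!: derivative_eq_intros)
  ultimately show ?case unfolding smooth1.simps by (intro exI[of _ "\<lambda>x. f' (c * x + d) * c"]) simp
qed

text \<open>The functions \<open>P(1/x) exp(-1/x)\<close>, extended by \<open>0\<close>, with \<open>P\<close> a polynomial form a class that is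
  closed under differentiation.\<close>

definition flat_exp :: "real poly \<Rightarrow> real \<Rightarrow> real" where
  "flat_exp p x = (if x > 0 then poly p (1 / x) * exp (- (1 / x)) else 0)"

lemma poly_exp_tendsto_0: "((\<lambda>y. poly p y * exp (- y)) \<longlongrightarrow> (0::real)) at_top"
proof -
  have "((\<lambda>y. \<Sum>i\<le>degree p. coeff p i * (y ^ i / exp y)) \<longlongrightarrow> (\<Sum>i\<le>degree p. coeff p i * 0)) at_top"
    by (intro tendsto_intros tendsto_power_div_exp_0)
  then show ?thesis
    by (simp add: poly_altdef exp_minus divide_inverse sum_distrib_right mult.assoc)
qed

text \<open>With y = 1/x the derivative of P(y) exp(-y) is y^2 (P(y) - P'(y)) exp(-y); the
  polynomial \<open>[:0, 0, 1:]\<close> is y^2, the inner derivative up to sign. At the origin the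
  two one-sided difference quotients are treated separately.\<close>

lemma flat_exp_DERIV:
  "(flat_exp p has_real_derivative flat_exp ([:0, 0, 1:] * (p - pderiv p)) x) (at x)"
proof -
  consider "x > 0" | "x < 0" | "x = 0" by linarith
  then show ?thesis
  proof cases
    case 1
    have "((\<lambda>x. poly p (1 / x) * exp (- (1 / x))) has_real_derivative
       flat_exp ([:0, 0, 1:] * (p - pderiv p)) x) (at x)"
      using 1 by (auto intro!: derivative_eq_intros DERIV_chain2[of "poly p"] poly_DERIV
          simp: flat_exp_def field_simps power2_eq_square)
    then show ?thesis
      by (rule has_field_derivative_transform_within_open[of _ _ _ "{0<..}"]) (use 1 in \<open>auto simp: flat_exp_def\<close>)
  next
    case 2
    have "((\<lambda>x. 0) has_real_derivative flat_exp ([:0, 0, 1:] * (p - pderiv p)) x) (at x)"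
      using 2 by (auto simp: flat_exp_def)
    then show ?thesis
      by (rule has_field_derivative_transform_within_open[of _ _ _ "{..<0}"]) (use 2 in \<open>auto simp: flat_exp_def\<close>)
  next
    case 3
    have "((\<lambda>h. flat_exp p h / h) \<longlongrightarrow> 0) (at_left 0)"
      by (rule tendsto_eventually) (auto simp: flat_exp_def eventually_at_filter)
    moreover have "((\<lambda>h. flat_exp p h / h) \<longlongrightarrow> 0) (at_right 0)"
    proof -
      \<comment> \<open>Dividing by \<open>h\<close> multiplies by y = 1/h, which the extra factor
        \<open>[:0, 1:]\<close> absorbs: the quotient is again a polynomial in y times
        exp(-y).\<close>
      have "((\<lambda>h. poly ([:0, 1:] * p) (inverse h) * exp (- inverse h)) \<longlongrightarrow> 0) (at_right 0)"
        by (rule filterlim_compose[OF poly_exp_tendsto_0 filterlim_inverse_at_top_right])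
      then show ?thesis
        by (rule Lim_transform_eventually)
          (auto simp: flat_exp_def eventually_at_filter field_simps)
    qed
    ultimately have "((\<lambda>h. flat_exp p h / h) \<longlongrightarrow> 0) (at 0)"
      by (simp add: filterlim_at_split)
    then show ?thesis
      using 3 by (simp add: has_field_derivative_iff flat_exp_def)
  qed
qed

lemma smooth1_flat_exp: "smooth1 k (flat_exp p)"
proof (induction k arbitrary: p)
  case 0
  show ?case using flat_exp_DERIV by (auto intro!: continuous_at_imp_continuous_on DERIV_isCont)
next
  case (Suc k)
  then show ?case using flat_exp_DERIV by auto
qed

lemma flat_exp_one:
  "0 \<le> flat_exp 1 x" "flat_exp 1 x \<le> 1" "flat_exp 1 x \<noteq> 0 \<longleftrightarrow> 0 < x"
  by (auto simp: flat_exp_def)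

lemma flat_exp_one_tendsto: "(flat_exp 1 \<longlongrightarrow> 1) at_top"
proof -
  have "((\<lambda>x::real. exp (- (1 / x))) \<longlongrightarrow> exp (- 0)) at_top"
    by (intro tendsto_intros tendsto_divide_0[OF tendsto_const] filterlim_at_top_imp_at_infinity filterlim_ident)
  then show ?thesis
    unfolding minus_zero exp_zero by (rule Lim_transform_eventually)
      (auto simp: flat_exp_def intro: eventually_mono[OF eventually_gt_at_top[of 0]])
qed

text \<open>The support stays inside the interval for every \<open>n\<close>, while at interior
  points both arguments grow linearly in \<open>n\<close>, so that the values tend to 1. Steepness
  and support are independent parameters.\<close>

definition bump1 :: "nat \<Rightarrow> real \<Rightarrow> real \<Rightarrow> real \<Rightarrow> real" where
  "bump1 n a b x = flat_exp 1 (real n * (x - a)) * flat_exp 1 (real n * (b - x))"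

lemma smooth1_bump1: "smooth1 k (bump1 n a b)"
proof -
  have "bump1 n a b = (\<lambda>x. flat_exp 1 (real n * x + - (real n * a)) * flat_exp 1 ((- real n) * x + real n * b))"
    by (auto simp: bump1_def algebra_simps)
  then show ?thesis by (simp only: smooth1_mult smooth1_affine smooth1_flat_exp)
qed

lemma bump1_bounds: "0 \<le> bump1 n a b x" "bump1 n a b x \<le> 1"
  using flat_exp_one by (auto simp: bump1_def mult_le_one)

lemma bump1_nonzero: "bump1 n a b x \<noteq> 0 \<Longrightarrow> a < x \<and> x < b"
  by (auto simp: bump1_def flat_exp_one zero_less_mult_iff)

section \<open>Test functions\<close>

lemma partial_deriv_has_derivative:
  "(f has_derivative f') (at x) \<Longrightarrow> partial_deriv i f x = f' (axis i 1)"
  unfolding partial_deriv_def by (simp add: frechet_derivative_at[symmetric])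

lemma has_derivative_prod_components:
  fixes f f' :: "'d::finite \<Rightarrow> real \<Rightarrow> real"
  assumes "\<And>i y. (f i has_real_derivative f' i y) (at y)"
  shows "((\<lambda>x::real^'d. \<Prod>i\<in>UNIV. f i (x $ i)) has_derivative
    (\<lambda>y. \<Sum>i\<in>UNIV. (f' i (x $ i) * y $ i) * (\<Prod>j\<in>UNIV - {i}. f j (x $ j)))) (at x)"
proof (rule has_derivative_prod)
  fix i :: 'd
  have "((\<lambda>x::real^'d. x $ i) has_derivative (\<lambda>y. y $ i)) (at x)"
    by (rule bounded_linear.has_derivative[OF bounded_linear_vec_nth has_derivative_ident])
  moreover have "(f i has_derivative (\<lambda>h. f' i (x $ i) * h)) (at (x $ i))"
    using assms[of i "x $ i"] unfolding has_field_derivative_def .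
  ultimately show "((\<lambda>x::real^'d. f i (x $ i)) has_derivative (\<lambda>y. f' i (x $ i) * y $ i)) (at x)"
    by (rule has_derivative_compose)
qed

text \<open>A partial derivative of a tensor product replaces one factor by its derivative and
  leaves a tensor product. The induction therefore runs over arbitrary families of factors.\<close>

lemma C_k_prod:
  fixes f :: "'d::finite \<Rightarrow> real \<Rightarrow> real"
  assumes "\<And>i. smooth1 k (f i)"
  shows "C_k k (\<lambda>x::real^'d. \<Prod>i\<in>UNIV. f i (x $ i))"
  using assms
proof (induction k arbitrary: f)
  case 0
  then have "continuous_on UNIV (\<lambda>x::real^'d. f i (x $ i))" for i
    using continuous_on_compose2[of UNIV "f i" UNIV "\<lambda>x::real^'d. x $ i"] by (simp add: continuous_on_component)
  then show ?case by (auto intro!: continuous_on_prod)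
next
  case (Suc k)
  from Suc.prems have "\<forall>i. \<exists>f'. (\<forall>y. (f i has_real_derivative f' y) (at y)) \<and> smooth1 k f'" by simp
  then obtain f' where f': "\<And>i y. (f i has_real_derivative f' i y) (at y)" "\<And>i. smooth1 k (f' i)" by metis
  have deriv: "partial_deriv j (\<lambda>x::real^'d. \<Prod>i\<in>UNIV. f i (x $ i))
     = (\<lambda>x. \<Prod>i\<in>UNIV. (f(j := f' j)) i (x $ i))" for j
  proof
    fix x :: "real^'d"
    have "partial_deriv j (\<lambda>x::real^'d. \<Prod>i\<in>UNIV. f i (x $ i)) x
      = (\<Sum>i\<in>UNIV. (f' i (x $ i) * axis j 1 $ i) * (\<Prod>l\<in>UNIV - {i}. f l (x $ l)))"
      by (rule partial_deriv_has_derivative[OF has_derivative_prod_components[OF f'(1)]])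
    also have "\<dots> = f' j (x $ j) * (\<Prod>l\<in>UNIV - {j}. f l (x $ l))"
      by (subst sum.remove[of _ j]) (auto simp: axis_def)
    also have "\<dots> = (\<Prod>i\<in>UNIV. (f(j := f' j)) i (x $ i))"
      by (subst prod.remove[of _ j]) (auto intro!: prod.cong)
    finally show "partial_deriv j (\<lambda>x::real^'d. \<Prod>i\<in>UNIV. f i (x $ i)) x
      = (\<Prod>i\<in>UNIV. (f(j := f' j)) i (x $ i))" .
  qed
  have "C_k k (partial_deriv j (\<lambda>x::real^'d. \<Prod>i\<in>UNIV. f i (x $ i)))" for j
    unfolding deriv by (rule Suc.IH) (use f'(2) smooth1_SucD[OF Suc.prems] in auto)
  moreover have "(\<lambda>x::real^'d. \<Prod>i\<in>UNIV. f i (x $ i)) differentiable (at x)" for x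
    unfolding differentiable_def by (rule exI) (rule has_derivative_prod_components[of f f', OF f'(1)])
  ultimately show ?case by simp
qed

definition bump :: "nat \<Rightarrow> real^'d::finite \<Rightarrow> real^'d \<Rightarrow> real^'d \<Rightarrow> real" where
  "bump n a b x = (\<Prod>i\<in>UNIV. bump1 n (a $ i) (b $ i) (x $ i))"

lemma bump_bounds: "0 \<le> bump n a b x" "bump n a b x \<le> 1"
  by (simp_all add: bump_def prod_nonneg prod_le_1 bump1_bounds)

lemma bump_nonzero: "bump n a b x \<noteq> 0 \<Longrightarrow> x \<in> box a b"
  by (auto simp: bump_def mem_box_cart dest: bump1_nonzero)

lemma test_function_bump: "test_function (bump n a b)"
proof -
  have "C_k k (bump n a b)" for k
    using C_k_prod[of k "\<lambda>i. bump1 n (a $ i) (b $ i)"] smooth1_bump1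
    unfolding bump_def by blast
  moreover have "bounded {x. bump n a b x \<noteq> 0}"
    by (rule bounded_subset[OF bounded_box[of a b]]) (auto dest: bump_nonzero)
  ultimately show ?thesis by (auto simp: test_function_def compact_closure)
qed

lemma test_function_continuous: "test_function \<phi> \<Longrightarrow> continuous_on UNIV \<phi>"
  using C_k.simps(1)[of \<phi>] unfolding test_function_def by blast

lemma test_function_differentiable: "test_function \<phi> \<Longrightarrow> \<phi> differentiable (at x)"
  using C_k.simps(2)[of 0 \<phi>] unfolding test_function_def by blast

lemma test_function_bounded_support: "test_function \<phi> \<Longrightarrow> bounded {x. \<phi> x \<noteq> 0}"
  unfolding test_function_def by (simp add: compact_closure)

lemma partial_deriv_nonzero:
  assumes "partial_deriv i \<phi> x \<noteq> 0"
  shows "x \<in> closure {x. \<phi> x \<noteq> 0}"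
proof (rule ccontr)
  assume "x \<notin> closure {x. \<phi> x \<noteq> 0}"
  then have x: "x \<in> - closure {x. \<phi> x \<noteq> 0}" by simp
  have "((\<lambda>_. 0) has_derivative (\<lambda>_. 0)) (at x)" by simp
  then have "(\<phi> has_derivative (\<lambda>_. 0)) (at x)"
    by (rule has_derivative_transform_within_open[of _ _ _ _ "- closure {x. \<phi> x \<noteq> 0}"])
      (use x closure_subset[of "{x. \<phi> x \<noteq> 0}"] in auto)
  from partial_deriv_has_derivative[OF this] assms show False by simp
qed

lemma test_function_partial_deriv:
  assumes "test_function \<phi>"
  shows "test_function (partial_deriv i \<phi>)"
proof -
  have "C_k k (partial_deriv i \<phi>)" for k
    using assms C_k.simps(2)[of k \<phi>] unfolding test_function_def by blast
  moreover have "bounded {x. partial_deriv i \<phi> x \<noteq> 0}"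
    by (rule bounded_subset[of "closure {x. \<phi> x \<noteq> 0}"])
      (use assms partial_deriv_nonzero in \<open>auto simp: test_function_def compact_imp_bounded\<close>)
  ultimately show ?thesis by (auto simp: test_function_def compact_closure)
qed

lemma test_function_bdd:
  assumes "test_function \<phi>"
  obtains C where "\<And>x. \<bar>\<phi> x\<bar> \<le> C" "0 \<le> C"
proof -
  have "compact (\<phi> ` closure {x. \<phi> x \<noteq> 0})"
    by (rule compact_continuous_image)
      (use assms test_function_continuous[OF assms] in \<open>auto simp: test_function_def intro: continuous_on_subset\<close>)
  then obtain C where C: "\<And>x. x \<in> closure {x. \<phi> x \<noteq> 0} \<Longrightarrow> \<bar>\<phi> x\<bar> \<le> C"
    by (force dest!: compact_imp_bounded simp: bounded_iff)
  have "\<bar>\<phi> x\<bar> \<le> max C 0" for x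
    using C[of x] closure_subset[of "{x. \<phi> x \<noteq> 0}"] by (cases "\<phi> x = 0") (auto simp: subset_iff)
  then show ?thesis using that[of "max C 0"] by auto
qed

lemma square_integrable_test_function:
  assumes "test_function \<phi>"
  shows "square_integrable (\<lambda>x. complex_of_real (\<phi> x))"
proof -
  let ?K = "closure {x. \<phi> x \<noteq> 0}"
  have cont: "continuous_on UNIV \<phi>" by (rule test_function_continuous[OF assms])
  have "integrable lborel (\<lambda>x. indicator ?K x *\<^sub>R (\<phi> x)\<^sup>2)"
    by (rule borel_integrable_compact)
      (use assms cont in \<open>auto simp: test_function_def intro!: continuous_on_power intro: continuous_on_subset\<close>)
  moreover have "indicator ?K x *\<^sub>R (\<phi> x)\<^sup>2 = (\<phi> x)\<^sup>2" for x
    using closure_subset[of "{x. \<phi> x \<noteq> 0}"] by (auto simp: indicator_def)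
  ultimately have "integrable lborel (\<lambda>x. (\<phi> x)\<^sup>2)" by (simp only:)
  moreover have [measurable]: "\<phi> \<in> borel_measurable borel"
    by (rule borel_measurable_continuous_onI[OF cont])
  ultimately show ?thesis by (simp add: square_integrable_def)
qed

definition l2_of :: "(real^'d::finite \<Rightarrow> real) \<Rightarrow> 'd l2" where
  "l2_of \<phi> = abs_l2 (\<lambda>x. complex_of_real (\<phi> x))"

lemma rep_l2_of: "test_function \<phi> \<Longrightarrow> AE x in lborel. rep_l2 (l2_of \<phi>) x = complex_of_real (\<phi> x)"
  unfolding l2_of_def by (rule rep_abs_l2[OF square_integrable_test_function])

text \<open>This turns integrals against test functions into inner products, so that weak
  derivatives and weak Laplacians become statements inside the Hilbert space.\<close>

lemma cinner_l2_of:
  assumes "test_function \<phi>"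
  shows "cinner u (l2_of \<phi>) = (\<integral>x. \<phi> x *\<^sub>R rep_l2 u x \<partial>lborel)"
proof -
  have [measurable]: "\<phi> \<in> borel_measurable borel"
    by (rule borel_measurable_continuous_onI[OF test_function_continuous[OF assms]])
  show ?thesis unfolding cinner.rep_eq
  proof (rule integral_cong_AE)
    show "AE x in lborel. rep_l2 u x * cnj (rep_l2 (l2_of \<phi>) x) = \<phi> x *\<^sub>R rep_l2 u x"
      using rep_l2_of[OF assms] by eventually_elim (simp add: scaleR_conv_of_real)
    show "(\<lambda>x. rep_l2 u x * cnj (rep_l2 (l2_of \<phi>) x)) \<in> borel_measurable lborel"
      using square_integrable_prod[OF square_integrable_rep square_integrable_rep]
      by (rule borel_measurable_integrable)
  qed measurable
qed

lemma integrable_test_function_mult: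
  assumes "test_function \<phi>"
  shows "integrable lborel (\<lambda>x. \<phi> x *\<^sub>R rep_l2 u x)"
  using square_integrable_prod[OF square_integrable_rep[of u] square_integrable_test_function[OF assms]]
  by (simp add: scaleR_conv_of_real mult.commute)

section \<open>Density of the bump functions\<close>

text \<open>The bumps below converge to the indicator function of the box, so an element of \<open>L\<^sup>2\<close> orthogonal
  to all of them integrates to \<open>0\<close> over every box.  Rational corners suffice.\<close>

definition rat_vec :: "('d \<Rightarrow> rat) \<Rightarrow> real^'d::finite" where
  "rat_vec q = (\<chi> i. of_rat (q i))"

text \<open>The rational corners approach those of the box from inside at speed 1/(k+1) while the
  steepness is \<open>k\<close>. Approaching from inside keeps all supports in the box, and the
  steepness outruns the motion of the corners.\<close>

lemma bump_limit:
  fixes a b :: "real^'d::finite"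
  obtains q r :: "nat \<Rightarrow> 'd \<Rightarrow> rat" where
    "\<And>k x. bump k (rat_vec (q k)) (rat_vec (r k)) x \<noteq> 0 \<Longrightarrow> x \<in> box a b"
    "\<And>x. (\<lambda>k. bump k (rat_vec (q k)) (rat_vec (r k)) x) \<longlonglongrightarrow> indicator (box a b) x"
proof -
  have "\<forall>k i. \<exists>s. a $ i < of_rat s \<and> of_rat s < a $ i + 1 / real (Suc (k::nat))"
    by (intro allI of_rat_dense) simp
  then obtain q where q: "\<And>k i. a $ i < of_rat (q k i)" "\<And>k i. of_rat (q k i) < a $ i + 1 / real (Suc k)"
    by metis
  have "\<forall>(k::nat) i. \<exists>s. b $ i - 1 / real (Suc k) < of_rat s \<and> of_rat s < b $ i"
    by (intro allI of_rat_dense) simp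
  then obtain r where r: "\<And>k i. of_rat (r k i) < b $ i" "\<And>k i. b $ i - 1 / real (Suc k) < of_rat (r k i)"
    by metis
  have supp: "x \<in> box a b" if nz: "bump k (rat_vec (q k)) (rat_vec (r k)) x \<noteq> 0" for k :: nat and x
    using bump_nonzero[OF nz] q(1)[where k=k] r(1)[where k=k]
    by (auto simp: mem_box_cart rat_vec_def intro: less_trans)
  \<comment> \<open>The displaced corner costs at most k/(k+1), less than 1, after multiplication by
    the steepness. This gives the lower bound e k - 1.\<close>
  have large: "filterlim (\<lambda>k. real k * (d k)) at_top sequentially" if "e > 0" "\<And>k. d k \<ge> e - 1 / real (Suc k)" for d e
  proof (rule filterlim_at_top_mono)
    show "filterlim (\<lambda>k. e * real k - 1) at_top sequentially"
      using filterlim_tendsto_add_at_top[OF tendsto_const[of "-1"] filterlim_tendsto_pos_mult_at_top[OF tendsto_const that(1) filterlim_real_sequentially]]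
      by simp
    show "\<forall>\<^sub>F k in sequentially. e * real k - 1 \<le> real k * d k"
    proof (rule always_eventually, rule allI)
      fix k
      have "real k * (e - 1 / real (Suc k)) \<le> real k * d k"
        using that(2)[of k] by (intro mult_left_mono) auto
      moreover have "real k * (e - 1 / real (Suc k)) \<ge> e * real k - 1"
        by (simp add: field_simps)
      ultimately show "e * real k - 1 \<le> real k * d k" by linarith
    qed
  qed
  have "(\<lambda>k. bump k (rat_vec (q k)) (rat_vec (r k)) x) \<longlonglongrightarrow> indicator (box a b) x" for x
  proof (cases "x \<in> box a b")
    case False
    then have "(\<lambda>k. bump k (rat_vec (q k)) (rat_vec (r k)) x) = (\<lambda>k. 0)" using supp by blast
    then show ?thesis using False by simp
  next
    case True
    have "(\<lambda>k. bump1 k (of_rat (q k i)) (of_rat (r k i)) (x $ i)) \<longlonglongrightarrow> 1 * 1" for i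
      unfolding bump1_def
    proof (intro tendsto_mult filterlim_compose[OF flat_exp_one_tendsto])
      show "filterlim (\<lambda>k. real k * (x $ i - of_rat (q k i))) at_top sequentially"
        by (rule large[of "x $ i - a $ i"]) (use True q(2)[where i=i] in \<open>auto simp: mem_box_cart algebra_simps intro: less_imp_le\<close>)
      show "filterlim (\<lambda>k. real k * (of_rat (r k i) - x $ i)) at_top sequentially"
        by (rule large[of "b $ i - x $ i"]) (use True r(2)[where i=i] in \<open>auto simp: mem_box_cart algebra_simps intro: less_imp_le\<close>)
    qed
    then have "(\<lambda>k. bump k (rat_vec (q k)) (rat_vec (r k)) x) \<longlonglongrightarrow> (\<Prod>i\<in>(UNIV::'d set). 1 * 1)"
      unfolding bump_def rat_vec_def by (intro tendsto_prod) simp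
    then show ?thesis using True by simp
  qed
  with supp show ?thesis using that by blast
qed

lemma set_integrable_box:
  fixes g :: "'d::finite l2"
  shows "integrable lborel (\<lambda>x. indicator (box a b) x *\<^sub>R rep_l2 g x)"
proof -
  have "emeasure lborel (box a b) < \<infinity>" by (rule emeasure_bounded_finite) simp
  then have "integrable lborel (indicat_real (box a b))" by (intro integrable_real_indicator) auto
  moreover have "(norm (indicator (box a b) x :: complex))\<^sup>2 = indicat_real (box a b) x" for x
    by (simp add: indicator_def)
  ultimately have "square_integrable (indicator (box a b))"
    unfolding square_integrable_def by simp
  from square_integrable_prod[OF square_integrable_rep[of g] this]
  moreover have "rep_l2 g x * cnj (indicator (box a b) x) = indicator (box a b) x *\<^sub>R rep_l2 g x" for x
    by (simp add: indicator_def)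
  ultimately show ?thesis by simp
qed

lemma integral_box_eq_0:
  fixes g :: "'d::finite l2"
  assumes "\<And>n q r. cinner g (l2_of (bump n (rat_vec q) (rat_vec r))) = 0"
  shows "(\<integral>x. indicator (box a b) x *\<^sub>R rep_l2 g x \<partial>lborel) = 0"
proof -
  obtain q r where qr:
    "\<And>k x. bump k (rat_vec (q k)) (rat_vec (r k)) x \<noteq> 0 \<Longrightarrow> x \<in> box a b"
    "\<And>x. (\<lambda>k. bump k (rat_vec (q k)) (rat_vec (r k)) x) \<longlonglongrightarrow> indicator (box a b) x"
    using bump_limit[of a b] by blast
  let ?\<phi> = "\<lambda>k. bump k (rat_vec (q k)) (rat_vec (r k))"
  have "(\<lambda>k. \<integral>x. ?\<phi> k x *\<^sub>R rep_l2 g x \<partial>lborel) \<longlonglongrightarrow> (\<integral>x. indicator (box a b) x *\<^sub>R rep_l2 g x \<partial>lborel)"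
  proof (rule integral_dominated_convergence[where w="\<lambda>x. norm (indicator (box a b) x *\<^sub>R rep_l2 g x)"])
    show "AE x in lborel. (\<lambda>k. ?\<phi> k x *\<^sub>R rep_l2 g x) \<longlonglongrightarrow> indicator (box a b) x *\<^sub>R rep_l2 g x"
      by (intro AE_I2 tendsto_intros qr(2))
    have "norm (?\<phi> k x *\<^sub>R rep_l2 g x) \<le> norm (indicator (box a b) x *\<^sub>R rep_l2 g x)" for k x
      using qr(1)[of k x] bump_bounds[of k "rat_vec (q k)" "rat_vec (r k)" x]
      by (cases "?\<phi> k x = 0") (auto intro: mult_left_le_one_le)
    then show "AE x in lborel. norm (?\<phi> k x *\<^sub>R rep_l2 g x) \<le> norm (indicator (box a b) x *\<^sub>R rep_l2 g x)" for k
      by blast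
    show "(\<lambda>x. ?\<phi> k x *\<^sub>R rep_l2 g x) \<in> borel_measurable lborel" for k
      using integrable_test_function_mult[OF test_function_bump] by (rule borel_measurable_integrable)
    show "integrable lborel (\<lambda>x. norm (indicator (box a b) x *\<^sub>R rep_l2 g x))"
      by (rule integrable_norm[OF set_integrable_box])
  qed (rule borel_measurable_integrable[OF set_integrable_box])
  moreover have "(\<integral>x. ?\<phi> k x *\<^sub>R rep_l2 g x \<partial>lborel) = 0" for k
    using assms by (simp add: cinner_l2_of[OF test_function_bump, symmetric])
  ultimately show ?thesis by (simp add: LIMSEQ_const_iff)
qed

lemma box_Int_box_vec:
  fixes a b c d :: "real^'d::finite"
  shows "box a b \<inter> box c d = box (\<chi> i. max (a $ i) (c $ i)) (\<chi> i. min (b $ i) (d $ i))"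
  by (auto simp: mem_box_cart)

lemma Int_stable_boxes_vec: "Int_stable (range (\<lambda>(a, b). box a b :: (real^'d::finite) set))"
proof (rule Int_stableI)
  fix A B :: "(real^'d) set"
  assume "A \<in> range (\<lambda>(a, b). box a b)" "B \<in> range (\<lambda>(a, b). box a b)"
  then obtain a b c d where "A = box a b" "B = box c d" by auto
  then have "A \<inter> B = (\<lambda>(a, b). box a b) (\<chi> i. max (a $ i) (c $ i), \<chi> i. min (b $ i) (d $ i))"
    by (simp only: box_Int_box_vec case_prod_conv)
  then show "A \<inter> B \<in> range (\<lambda>(a, b). box a b)" by (rule range_eqI)
qed

text \<open>Vanishing integrals extend from boxes to all Borel sets by Dynkin's argument, boxes
  being closed under intersection, and an integrable function whose integral over every Borel set is
  zero vanishes almost everywhere.\<close>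

lemma orthogonal_bumps_eq_0:
  fixes g :: "'d::finite l2"
  assumes "\<And>n q r. cinner g (l2_of (bump n (rat_vec q) (rat_vec r))) = 0"
  shows "g = 0"
proof -
  let ?G = "range (\<lambda>(a, b). box a b :: (real^'d) set)"
  have subset_Pow: "?G \<subseteq> Pow UNIV" by simp
  \<comment> \<open>An element of the space need not be integrable over the whole of it. Cutting off
    with a fixed box makes it so; boxes exhausting the space remove the cutoff at the end.\<close>
  have AE_box: "AE x in lborel. indicator (box c d) x *\<^sub>R rep_l2 g x = 0" for c d :: "real^'d"
  proof (rule sigma_finite_measure.density_zero[OF sigma_finite_lborel])
    fix A :: "(real^'d) set" assume "A \<in> sets lborel"
    then have "A \<in> sigma_sets UNIV ?G" by (simp add: borel_eq_box)
    then show "set_lebesgue_integral lborel A (\<lambda>x. indicator (box c d) x *\<^sub>R rep_l2 g x) = 0"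
    proof (induction rule: sigma_sets_induct_disjoint[OF Int_stable_boxes_vec subset_Pow, consumes 1, case_names basic empty compl union])
      case (basic A)
      then obtain a b where "A = box a b" by auto
      moreover obtain a' b' where "box a b \<inter> box c d = box a' b'"
        by (rule that[OF box_Int_box_vec])
      ultimately show ?case
        using integral_box_eq_0[OF assms, of a' b']
        by (simp add: set_lebesgue_integral_def indicator_inter_arith[symmetric])
    next
      case empty
      then show ?case by (simp add: set_lebesgue_integral_def)
    next
      case (compl A)
      then have [measurable]: "A \<in> sets lborel" by (simp add: borel_eq_box)
      have "set_lebesgue_integral lborel (UNIV - A) (\<lambda>x. indicator (box c d) x *\<^sub>R rep_l2 g x)
        = (\<integral>x. indicator (box c d) x *\<^sub>R rep_l2 g x - indicator A x *\<^sub>R (indicator (box c d) x *\<^sub>R rep_l2 g x) \<partial>lborel)"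
        unfolding set_lebesgue_integral_def by (intro Bochner_Integration.integral_cong) (auto simp: indicator_def)
      also have "\<dots> = 0"
      proof (subst Bochner_Integration.integral_diff)
        show "integrable lborel (\<lambda>x. indicator A x *\<^sub>R (indicator (box c d) x *\<^sub>R rep_l2 g x))"
          by (rule integrable_mult_indicator[OF _ set_integrable_box]) measurable
        show "(\<integral>x. indicator (box c d) x *\<^sub>R rep_l2 g x \<partial>lborel)
          - (\<integral>x. indicator A x *\<^sub>R (indicator (box c d) x *\<^sub>R rep_l2 g x) \<partial>lborel) = 0"
          using compl(2) integral_box_eq_0[OF assms, of c d] unfolding set_lebesgue_integral_def by simp
      qed (rule set_integrable_box)
      finally show ?case .
    next
      case (union A)
      then have [measurable]: "A i \<in> sets lborel" for i by (auto simp: borel_eq_box)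
      have "set_lebesgue_integral lborel (\<Union>i. A i) (\<lambda>x. indicator (box c d) x *\<^sub>R rep_l2 g x)
         = (\<Sum>i. set_lebesgue_integral lborel (A i) (\<lambda>x. indicator (box c d) x *\<^sub>R rep_l2 g x))"
      proof (rule lebesgue_integral_countable_add)
        show "A i \<inter> A j = {}" if "i \<noteq> j" for i j
          using union(1) that by (auto simp: disjoint_family_on_def)
        show "set_integrable lborel (\<Union>i. A i) (\<lambda>x. indicator (box c d) x *\<^sub>R rep_l2 g x)"
          unfolding set_integrable_def
          by (rule integrable_mult_indicator[OF _ set_integrable_box]) measurable
      qed measurable
      then show ?case using union by simp
    qed
  qed (rule set_integrable_box)
  have "AE x in lborel. \<forall>n::nat. indicator (box (\<chi> i. - real n) (\<chi> i. real n)) x *\<^sub>R rep_l2 g x = 0"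
    unfolding AE_all_countable using AE_box by blast
  then have "AE x in lborel. rep_l2 g x = 0"
  proof eventually_elim
    case (elim x)
    obtain n :: nat where "norm x < real n" using reals_Archimedean2 by blast
    then have "- real n < x $ i \<and> x $ i < real n" for i
      using component_le_norm_cart[of x i] by linarith
    then have "x \<in> box (\<chi> i. - real n) (\<chi> i. real n)" by (simp add: mem_box_cart)
    then show ?case using elim[rule_format, of n] by simp
  qed
  then show ?thesis
    using rep_l2_zero by (intro l2_eqI) (auto elim: eventually_elim2)
qed

section \<open>Projections and separability\<close>

text \<open>The classical variational proof: a minimising sequence for the distance is Cauchy, and
  its limit is the foot of the perpendicular.\<close>

lemma closed_subspace_orthogonal_projection:
  fixes u :: "'a::{real_inner, complete_space}"
  assumes K: "subspace K" "closed K"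
  obtains k where "k \<in> K" "\<And>w. w \<in> K \<Longrightarrow> inner (u - k) w = 0"
proof -
  define D where "D = (\<lambda>k. (norm (u - k))\<^sup>2) ` K"
  define d where "d = Inf D"
  have bdd: "bdd_below D" unfolding D_def by (rule bdd_belowI[of _ 0]) auto
  have ne: "D \<noteq> {}" using subspace_0[OF K(1)] by (auto simp: D_def)
  have d_le: "d \<le> (norm (u - k))\<^sup>2" if "k \<in> K" for k
    unfolding d_def by (rule cInf_lower[OF _ bdd]) (use that in \<open>auto simp: D_def\<close>)
  have "\<exists>k\<in>K. (norm (u - k))\<^sup>2 < d + 1 / real (Suc n)" for n
  proof -
    have "\<exists>x\<in>D. x < d + 1 / real (Suc n)"
      unfolding d_def by (rule cInf_lessD[OF ne]) simp
    then show ?thesis by (auto simp: D_def)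
  qed
  then obtain k where kK: "\<And>n. k n \<in> K" and k: "\<And>n. (norm (u - k n))\<^sup>2 < d + 1 / real (Suc n)"
    by metis
  \<comment> \<open>The parallelogram law: the midpoint of two members lies in \<open>K\<close>, so
    its squared distance to \<open>u\<close> is at least \<open>d\<close>.\<close>
  have dist_k: "(norm (k m - k n))\<^sup>2 \<le> 2 / real (Suc m) + 2 / real (Suc n)" for m n
  proof -
    have mid: "(1/2) *\<^sub>R (k m + k n) \<in> K"
      by (intro subspace_scale[OF K(1)] subspace_add[OF K(1)] kK)
    have "(norm (k m - k n))\<^sup>2 + 4 * (norm (u - (1/2) *\<^sub>R (k m + k n)))\<^sup>2
      = 2 * (norm (u - k m))\<^sup>2 + 2 * (norm (u - k n))\<^sup>2"
      by (simp add: power2_norm_eq_inner algebra_simps inner_commute)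
    moreover have "2 / real (Suc m) = 2 * (1 / real (Suc m))" "2 / real (Suc n) = 2 * (1 / real (Suc n))"
      by simp_all
    ultimately show ?thesis using d_le[OF mid] k[of m] k[of n] by linarith
  qed
  have "Cauchy k"
  proof (rule metric_CauchyI)
    fix e :: real assume e: "e > 0"
    then obtain N where N: "4 / e\<^sup>2 < real N" using reals_Archimedean2 by blast
    show "\<exists>M. \<forall>m\<ge>M. \<forall>n\<ge>M. dist (k m) (k n) < e"
    proof (intro exI[of _ N] allI impI)
      fix m n assume mn: "N \<le> m" "N \<le> n"
      have "0 < 4 / e\<^sup>2" using e by simp
      with N have pos: "0 < real N" by linarith
      have "2 / real (Suc m) \<le> 2 / real N" "2 / real (Suc n) \<le> 2 / real N"
        using mn pos by (auto intro!: divide_left_mono)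
      then have "(norm (k m - k n))\<^sup>2 \<le> 4 / real N" using dist_k[of m n] by simp
      also have "\<dots> < e\<^sup>2" using N e pos by (simp add: field_simps)
      finally show "dist (k m) (k n) < e" using e by (simp add: dist_norm power2_less_imp_less)
    qed
  qed
  then obtain l where l: "k \<longlonglongrightarrow> l" by (auto simp: Cauchy_convergent_iff convergent_def)
  have lK: "l \<in> K" by (rule closed_sequentially[OF K(2) kK l])
  have "(norm (u - l))\<^sup>2 \<le> d"
  proof (rule LIMSEQ_le)
    show "(\<lambda>n. (norm (u - k n))\<^sup>2) \<longlonglongrightarrow> (norm (u - l))\<^sup>2" by (intro tendsto_intros l)
    show "(\<lambda>n. d + 1 / real (Suc n)) \<longlonglongrightarrow> d"
      using tendsto_add[OF tendsto_const LIMSEQ_inverse_real_of_nat, of d] by (simp add: inverse_eq_divide)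
    show "\<exists>N. \<forall>n\<ge>N. (norm (u - k n))\<^sup>2 \<le> d + 1 / real (Suc n)" using k less_imp_le by blast
  qed
  moreover have "inner (u - l) w = 0" if w: "w \<in> K" for w
  proof (rule ccontr)
    assume nz: "inner (u - l) w \<noteq> 0"
    then have w0: "inner w w > 0" by (metis inner_gt_zero_iff inner_zero_right)
    \<comment> \<open>The minimiser of the quadratic function of the real parameter \<open>t\<close>
      that moves \<open>l\<close> in direction \<open>w\<close>. A nonzero inner product would push
      the squared distance below \<open>d\<close>.\<close>
    define t where "t = inner (u - l) w / inner w w"
    have "d \<le> (norm (u - (l + t *\<^sub>R w)))\<^sup>2"
      by (intro d_le subspace_add[OF K(1)] subspace_scale[OF K(1)] lK w)
    also have "\<dots> = (norm (u - l))\<^sup>2 - 2 * t * inner (u - l) w + t\<^sup>2 * inner w w"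
      unfolding power2_norm_eq_inner by (simp add: algebra_simps inner_commute power2_eq_square)
    also have "\<dots> = (norm (u - l))\<^sup>2 - (inner (u - l) w)\<^sup>2 / inner w w"
      using w0 by (simp add: t_def field_simps power2_eq_square)
    also have "\<dots> < (norm (u - l))\<^sup>2" using nz w0 by simp
    finally show False using \<open>(norm (u - l))\<^sup>2 \<le> d\<close> by simp
  qed
  ultimately show ?thesis using that lK by blast
qed

section \<open>Density and countable dense subsets\<close>

lemma closure_seqE:
  fixes x :: "'a::metric_space"
  assumes "x \<in> closure S"
  obtains f where "\<And>n. f n \<in> S" "f \<longlonglongrightarrow> x"
  using assms unfolding closure_sequential by blast

lemma closure_seqI:
  fixes x :: "'a::metric_space"
  shows "(\<And>n. f n \<in> S) \<Longrightarrow> f \<longlonglongrightarrow> x \<Longrightarrow> x \<in> closure S"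
  unfolding closure_sequential by blast

lemma subspace_closure_normed:
  fixes K :: "'a::real_normed_vector set"
  assumes "subspace K"
  shows "subspace (closure K)"
proof (rule subspaceI)
  show "0 \<in> closure K" using subspace_0[OF assms] closure_subset by blast
  fix x y :: 'a and c :: real
  assume "x \<in> closure K"
  then obtain f where f: "\<And>n. f n \<in> K" "f \<longlonglongrightarrow> x" by (rule closure_seqE) (rule that)
  have "\<And>n. c *\<^sub>R f n \<in> K" "(\<lambda>n. c *\<^sub>R f n) \<longlonglongrightarrow> c *\<^sub>R x"
    using f assms by (auto intro: subspace_scale tendsto_scaleR)
  then show "c *\<^sub>R x \<in> closure K" by (rule closure_seqI)
  assume "y \<in> closure K"
  then obtain g where g: "\<And>n. g n \<in> K" "g \<longlonglongrightarrow> y" by (rule closure_seqE) (rule that)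
  have "\<And>n. f n + g n \<in> K" "(\<lambda>n. f n + g n) \<longlonglongrightarrow> x + y"
    using f g assms by (auto intro: subspace_add tendsto_add)
  then show "x + y \<in> closure K" by (rule closure_seqI)
qed

lemma closure_span_eq_UNIV_I:
  fixes B :: "'a::{real_inner, complete_space} set"
  assumes "\<And>v. (\<And>w. w \<in> B \<Longrightarrow> inner v w = 0) \<Longrightarrow> v = 0"
  shows "closure (span B) = UNIV"
proof -
  have "u \<in> closure (span B)" for u
  proof -
    obtain k where k: "k \<in> closure (span B)" "\<And>w. w \<in> closure (span B) \<Longrightarrow> inner (u - k) w = 0"
      using closed_subspace_orthogonal_projection[of "closure (span B)" u]
      using subspace_closure_normed[OF subspace_span[of B]] by blast
    then have "u - k = 0"
      by (intro assms) (meson closure_subset span_superset subset_iff)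
    then show ?thesis using k(1) by simp
  qed
  then show ?thesis by blast
qed

lemma countable_dense_of_span:
  fixes B :: "'a::real_normed_vector set"
  assumes "countable B" and dense: "closure (span B) = UNIV"
  obtains D :: "'a set" where "countable D" "closure D = UNIV"
proof -
  \<comment> \<open>Rational combinations are coded as finite lists of pairs, so that their
    countability is that of lists and addition is concatenation.\<close>
  define val :: "(rat \<times> 'a) list \<Rightarrow> 'a" where "val xs = (\<Sum>(q, b)\<leftarrow>xs. of_rat q *\<^sub>R b)" for xs
  define L where "L = lists ((UNIV :: rat set) \<times> B)"
  have val_append: "val (xs @ ys) = val xs + val ys" for xs ys by (simp add: val_def)
  have val_scale: "\<exists>ys\<in>L. val ys = of_rat r *\<^sub>R val xs" if "xs \<in> L" for r xs
  proof
    let ?ys = "map (\<lambda>(q, b). (r * q, b)) xs"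
    show "?ys \<in> L" using that by (auto simp: L_def)
    show "val ?ys = of_rat r *\<^sub>R val xs"
      unfolding val_def by (induction xs) (auto simp: algebra_simps of_rat_mult)
  qed
  define K where "K = closure (val ` L)"
  have sub: "val ` L \<subseteq> K" by (simp add: K_def closure_subset)
  have add: "x + y \<in> K" if xy: "x \<in> K" "y \<in> K" for x y
  proof -
    obtain f where "\<And>n. f n \<in> val ` L" "f \<longlonglongrightarrow> x"
      using xy(1) unfolding K_def by (rule closure_seqE) (rule that)
    moreover obtain g where "\<And>n. g n \<in> val ` L" "g \<longlonglongrightarrow> y"
      using xy(2) unfolding K_def by (rule closure_seqE) (rule that)
    moreover have "a + b \<in> val ` L" if ab: "a \<in> val ` L" "b \<in> val ` L" for a b
    proof -
      obtain xs ys where "a = val xs" "b = val ys" "xs \<in> L" "ys \<in> L" using ab by blast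
      then have "a + b = val (xs @ ys)" "xs @ ys \<in> L" by (auto simp: val_append L_def)
      then show ?thesis by blast
    qed
    ultimately show ?thesis
      unfolding K_def by (intro closure_seqI[of "\<lambda>n. f n + g n"]) (simp_all add: tendsto_add)
  qed
  have rat_scale: "of_rat r *\<^sub>R x \<in> K" if x: "x \<in> K" for x r
  proof -
    obtain f where f: "\<And>n. f n \<in> val ` L" "f \<longlonglongrightarrow> x"
      using x unfolding K_def by (rule closure_seqE) (rule that)
    have "of_rat r *\<^sub>R f n \<in> val ` L" for n
    proof -
      obtain xs where "f n = val xs" "xs \<in> L" using f(1) by blast
      then show ?thesis using val_scale[of xs r] by (metis imageI)
    qed
    then show ?thesis unfolding K_def
      using f(2) by (intro closure_seqI[of "\<lambda>n. of_rat r *\<^sub>R f n"]) (simp_all add: tendsto_scaleR)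
  qed
  \<comment> \<open>A real multiple is a limit of rational multiples, and \<open>K\<close> is
    closed. This makes \<open>K\<close> a real subspace although its generators carry only rational
    coefficients.\<close>
  have scale: "c *\<^sub>R x \<in> K" if "x \<in> K" for x c
  proof -
    have "\<forall>n. \<exists>r. c < of_rat r \<and> of_rat r < c + 1 / real (Suc n)" by (intro allI of_rat_dense) simp
    then obtain r where r: "\<And>n. c < of_rat (r n)" "\<And>n. of_rat (r n) < c + 1 / real (Suc n)" by metis
    have "(\<lambda>n. of_rat (r n)) \<longlonglongrightarrow> c"
    proof (rule real_tendsto_sandwich[OF _ _ tendsto_const])
      show "(\<lambda>n. c + 1 / real (Suc n)) \<longlonglongrightarrow> c"
        using tendsto_add[OF tendsto_const LIMSEQ_inverse_real_of_nat, of c] by (simp add: inverse_eq_divide)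
    qed (use less_imp_le[OF r(1)] less_imp_le[OF r(2)] in \<open>auto intro!: always_eventually\<close>)
    then have "(\<lambda>n. of_rat (r n) *\<^sub>R x) \<longlonglongrightarrow> c *\<^sub>R x" by (intro tendsto_scaleR tendsto_const)
    then show ?thesis
      by (rule closed_sequentially[of K, rotated 2]) (simp_all add: K_def rat_scale[OF that, unfolded K_def])
  qed
  have "val [] \<in> val ` L" by (simp add: L_def)
  then have "0 \<in> K" using sub by (auto simp: val_def)
  then have "subspace K" using add scale by (rule subspaceI)
  moreover have "B \<subseteq> K"
  proof
    fix b assume "b \<in> B"
    then have "val [(1, b)] \<in> val ` L" by (auto simp: L_def)
    then show "b \<in> K" using sub by (auto simp: val_def)
  qed
  ultimately have "span B \<subseteq> K" by (simp add: span_minimal)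
  then have "closure (span B) \<subseteq> K" unfolding K_def by (rule closure_minimal) simp
  then have 1: "closure (val ` L) = UNIV" using dense by (simp add: K_def top.extremum_unique)
  have 2: "countable (val ` L)" unfolding L_def using assms(1) by (intro countable_image countable_lists) auto
  show ?thesis by (rule that[OF 2 1])
qed

lemma countable_dense_imp_countable_subbasis:
  fixes D :: "'a::metric_space set"
  assumes "countable D" "closure D = UNIV"
  shows "\<exists>B::'a set set. countable B \<and> open = generate_topology B"
proof -
  define B where "B = (\<lambda>(x, n). ball x (1 / real (Suc n))) ` (D \<times> (UNIV :: nat set))"
  have "topological_basis B"
  proof (rule topological_basisI)
    show "open S" if "S \<in> B" for S using that by (auto simp: B_def)
    fix U and x :: 'a assume "open U" "x \<in> U"
    then obtain e where e: "e > 0" "ball x e \<subseteq> U" by (meson openE)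
    obtain n where n: "1 / real (Suc n) < e / 2" 
      using reals_Archimedean[of "e / 2"] e(1) by (auto simp: inverse_eq_divide)
    have "x \<in> closure D" using assms(2) by simp
    then obtain y where y: "y \<in> D" "dist y x < 1 / real (Suc n)"
      unfolding closure_approachable by (meson of_nat_0_less_iff zero_less_Suc zero_less_divide_1_iff)
    have "x \<in> ball y (1 / real (Suc n))" using y by simp
    moreover have "ball y (1 / real (Suc n)) \<subseteq> ball x e"
    proof
      fix z assume "z \<in> ball y (1 / real (Suc n))"
      then have "dist x z < e" using y(2) n dist_triangle[of x z y] by (simp add: dist_commute)
      then show "z \<in> ball x e" by simp
    qed
    ultimately show "\<exists>S\<in>B. x \<in> S \<and> S \<subseteq> U"
      using e(2) y(1) unfolding B_def by blast
  qed
  moreover have "countable B" unfolding B_def using assms(1) by (intro countable_image countable_SIGMA) auto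
  ultimately show ?thesis using topological_basis_imp_subbasis by blast
qed

text \<open>The factor \<i> is included because \<open>span\<close> is the real span, and the bumps
  alone would generate real-valued functions only. Rational corners keep the set countable.\<close>

definition bumps :: "'d::finite l2 set" where
  "bumps = (\<lambda>(c, n, q, r). cscale c (l2_of (bump n (rat_vec q) (rat_vec r)))) ` ({1, \<i>} \<times> UNIV)"

lemma bumpsE:
  fixes w :: "'d::finite l2"
  assumes "w \<in> bumps"
  obtains c and \<phi> :: "real^'d \<Rightarrow> real" where "test_function \<phi>" "w = cscale c (l2_of \<phi>)"
proof -
  obtain c n and q r :: "'d \<Rightarrow> rat" where "w = cscale c (l2_of (bump n (rat_vec q) (rat_vec r)))"
    using assms unfolding bumps_def by auto
  then show ?thesis by (rule that[OF test_function_bump])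
qed

lemma dense_bumps: "closure (span bumps) = (UNIV :: 'd::finite l2 set)"
proof (rule closure_span_eq_UNIV_I)
  fix v :: "'d l2"
  assume *: "\<And>w. w \<in> bumps \<Longrightarrow> inner v w = 0"
  show "v = 0"
  proof (rule orthogonal_bumps_eq_0)
    fix n and q r :: "'d \<Rightarrow> rat"
    let ?w = "l2_of (bump n (rat_vec q) (rat_vec r))"
    have "cscale 1 ?w \<in> bumps" "cscale \<i> ?w \<in> bumps"
      unfolding bumps_def image_iff by (rule bexI[of _ "(1, n, q, r)"] bexI[of _ "(\<i>, n, q, r)"]; simp)+
    then have "inner v ?w = 0" "inner v (cscale \<i> ?w) = 0" using * by auto
    then show "cinner v ?w = 0" by (simp add: complex_eq_iff Im_cinner inner_l2_def)
  qed
qed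

text \<open>Separability gives access to the Bochner integral and to the measurability of sums and
  inner products of random elements of the space.\<close>

instance l2 :: (finite) second_countable_topology
proof
  have "countable (bumps :: 'a l2 set)" unfolding bumps_def by simp
  then obtain D :: "'a l2 set" where "countable D" "closure D = UNIV"
    using countable_dense_of_span dense_bumps by blast
  then show "\<exists>B::'a l2 set set. countable B \<and> open = generate_topology B"
    by (rule countable_dense_imp_countable_subbasis)
qed

text \<open>Testing with elements that approximate \<open>v\<close> itself gives |v|^2 \<le> c |v|
  in the limit.\<close>

lemma norm_le_of_dense:
  fixes v :: "'a::real_inner"
  assumes "0 \<le> c" and dense: "closure S = UNIV" and le: "\<And>w. w \<in> S \<Longrightarrow> \<bar>inner v w\<bar> \<le> c * norm w"
  shows "norm v \<le> c"
proof -
  have "v \<in> closure S" using dense by simp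
  then obtain f where f: "\<And>n. f n \<in> S" "f \<longlonglongrightarrow> v" by (rule closure_seqE) (rule that)
  have "inner v v \<le> c * norm v"
  proof (rule LIMSEQ_le)
    show "(\<lambda>n. inner v (f n)) \<longlonglongrightarrow> inner v v" "(\<lambda>n. c * norm (f n)) \<longlonglongrightarrow> c * norm v"
      by (intro tendsto_intros f(2))+
    show "\<exists>N. \<forall>n\<ge>N. inner v (f n) \<le> c * norm (f n)" using le[OF f(1)] by (meson abs_le_D1)
  qed
  then show ?thesis
    using assms(1) by (cases "v = 0") (auto simp: dot_square_norm power2_eq_square)
qed

section \<open>Translations and difference quotients\<close>

lemma AE_lborel_translate:
  fixes a :: "'a::euclidean_space"
  assumes "AE x in lborel. P x"
  shows "AE x in lborel. P (x + a)"
proof -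
  have "AE x in distr lborel borel ((+) a). P x" unfolding lborel_distr_plus by (rule assms)
  from AE_distrD[OF _ this] show ?thesis by (simp add: add.commute)
qed

lemma integrable_lborel_translate:
  fixes f :: "'a::euclidean_space \<Rightarrow> 'b::{banach, second_countable_topology}"
  assumes "integrable lborel f"
  shows "integrable lborel (\<lambda>x. f (x + a))"
proof -
  have "integrable (distr lborel borel ((+) a)) f" unfolding lborel_distr_plus by (rule assms)
  from integrable_distr[OF _ this] show ?thesis by (simp add: add.commute)
qed

lemma integral_lborel_translate:
  fixes f :: "'a::euclidean_space \<Rightarrow> 'b::{banach, second_countable_topology}"
  assumes "f \<in> borel_measurable borel"
  shows "(\<integral>x. f (x + a) \<partial>lborel) = (\<integral>x. f x \<partial>lborel)"
proof -
  have "(\<integral>x. f x \<partial>lborel) = (\<integral>x. f x \<partial>distr lborel borel ((+) a))" unfolding lborel_distr_plus by (rule refl)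
  also have "\<dots> = (\<integral>x. f (a + x) \<partial>lborel)" by (rule integral_distr) (use assms in auto)
  finally show ?thesis by (simp add: add.commute)
qed

lemma square_integrable_translate:
  assumes "square_integrable f"
  shows "square_integrable (\<lambda>x. f (x + a))"
proof -
  have [measurable]: "f \<in> borel_measurable borel" using assms by (simp add: square_integrable_def)
  have "integrable lborel (\<lambda>x. (norm (f (x + a)))\<^sup>2)"
    by (rule integrable_lborel_translate[of "\<lambda>x. (norm (f x))\<^sup>2"]) (use assms in \<open>simp add: square_integrable_def\<close>)
  moreover have "(\<lambda>x. f (x + a)) \<in> borel_measurable lborel" by measurable
  ultimately show ?thesis by (simp only: square_integrable_def)
qed

lift_definition translate :: "real^'d \<Rightarrow> 'd::finite l2 \<Rightarrow> 'd l2" is "\<lambda>a f x. f (x + a)"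
  unfolding l2_rel_def by (intro conjI square_integrable_translate AE_lborel_translate) auto

lemma rep_translate: "AE x in lborel. rep_l2 (translate a u) x = rep_l2 u (x + a)"
  using rep_abs_l2[OF square_integrable_translate[OF square_integrable_rep[of u]]]
  by (simp add: translate_def)

lemma translate_abs_l2:
  assumes "square_integrable f"
  shows "translate a (abs_l2 f) = abs_l2 (\<lambda>x. f (x + a))"
proof (rule l2_eqI)
  show "AE x in lborel. rep_l2 (translate a (abs_l2 f)) x = rep_l2 (abs_l2 (\<lambda>x. f (x + a))) x"
    using rep_translate[of a "abs_l2 f"] AE_lborel_translate[OF rep_abs_l2[OF assms], of a]
      rep_abs_l2[OF square_integrable_translate[OF assms], of a]
    by eventually_elim simp
qed

lemma translate_add: "translate a (u + v) = translate a u + translate a v"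
proof (rule l2_eqI)
  show "AE x in lborel. rep_l2 (translate a (u + v)) x = rep_l2 (translate a u + translate a v) x"
    using rep_translate[of a "u + v"] AE_lborel_translate[OF rep_l2_add[of u v], of a]
      rep_l2_add[of "translate a u" "translate a v"] rep_translate[of a u] rep_translate[of a v]
    by eventually_elim simp
qed

lemma translate_cscale: "translate a (cscale c u) = cscale c (translate a u)"
proof (rule l2_eqI)
  show "AE x in lborel. rep_l2 (translate a (cscale c u)) x = rep_l2 (cscale c (translate a u)) x"
    using rep_translate[of a "cscale c u"] AE_lborel_translate[OF rep_l2_cscale[of c u], of a]
      rep_l2_cscale[of c "translate a u"] rep_translate[of a u]
    by eventually_elim simp
qed

lemma translate_scaleR: "translate a (r *\<^sub>R u) = r *\<^sub>R translate a u"
  by (simp add: scaleR_l2_def translate_cscale)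

lemma translate_translate: "translate a (translate b u) = translate (a + b) u"
proof (rule l2_eqI)
  show "AE x in lborel. rep_l2 (translate a (translate b u)) x = rep_l2 (translate (a + b) u) x"
    using rep_translate[of a "translate b u"] AE_lborel_translate[OF rep_translate[of b u], of a]
      rep_translate[of "a + b" u]
    by eventually_elim (simp add: add.assoc)
qed

lemma translate_0 [simp]: "translate 0 u = u"
  by transfer (auto simp: l2_rel_def)

lemma translate_minus_cancel [simp]:
  "translate (- a) (translate a u) = u" "translate a (translate (- a) u) = u"
  by (simp_all add: translate_translate)

lemma cinner_translate: "cinner (translate a u) (translate a v) = cinner u v"
proof transfer
  fix a :: "real^'a" and f g :: "real^'a \<Rightarrow> complex"
  assume "l2_rel f f" "l2_rel g g"
  then have [measurable]: "(\<lambda>x. f x * cnj (g x)) \<in> borel_measurable borel"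
    using square_integrable_prod[of f g] by (auto simp: l2_rel_def dest: borel_measurable_integrable)
  then show "(\<integral>x. f (x + a) * cnj (g (x + a)) \<partial>lborel) = (\<integral>x. f x * cnj (g x) \<partial>lborel)"
    by (rule integral_lborel_translate)
qed

lemma cinner_translate_left: "cinner (translate a u) v = cinner u (translate (- a) v)"
  by (subst cinner_translate[of "- a", symmetric]) simp

lemma inner_translate: "inner (translate a u) (translate a v) = inner u v"
  by (simp add: inner_l2_def cinner_translate)


lemma norm_translate: "norm (translate a u) = norm u"
  by (simp add: norm_eq_sqrt_inner inner_translate)

lemma bounded_linear_translate: "bounded_linear (translate a)"
  by (rule bounded_linear_intro[of _ 1]) (simp_all add: translate_add translate_scaleR norm_translate)

lemma bounded_bilinear_cinner: "bounded_bilinear (cinner :: 'd::finite l2 \<Rightarrow> 'd l2 \<Rightarrow> complex)"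
proof
  fix a a' b b' :: "'d l2" and r :: real
  show add_left: "cinner (a + a') b = cinner a b + cinner a' b" by (rule cinner_add_left)
  show "cinner a (b + b') = cinner a b + cinner a b'"
    by (subst (1 2 3) cinner_commute) (simp add: cinner_add_left)
  show "cinner (r *\<^sub>R a) b = r *\<^sub>R cinner a b"
    by (simp add: scaleR_l2_def cinner_cscale_left scaleR_conv_of_real)
  show "cinner a (r *\<^sub>R b) = r *\<^sub>R cinner a b"
    by (simp add: scaleR_l2_def cinner_cscale_right scaleR_conv_of_real)
  show "\<exists>K. \<forall>a b. norm (cinner a b :: complex) \<le> norm (a :: 'd l2) * norm b * K"
    using cmod_cinner_le by (intro exI[of _ 2]) (auto simp: mult_ac)
qed

lemmas tendsto_cinner = bounded_bilinear.tendsto[OF bounded_bilinear_cinner]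

lemma translate_l2_of:
  "test_function \<phi> \<Longrightarrow> translate a (l2_of \<phi>) = l2_of (\<lambda>x. \<phi> (x + a))"
  unfolding l2_of_def by (rule translate_abs_l2[OF square_integrable_test_function])

lemma partial_deriv_translate:
  assumes "\<phi> differentiable (at (x + a))"
  shows "partial_deriv i (\<lambda>x. \<phi> (x + a)) x = partial_deriv i \<phi> (x + a)"
proof -
  let ?D = "frechet_derivative \<phi> (at (x + a))"
  have "(\<phi> has_derivative ?D) (at (x + a))" using assms by (simp add: frechet_derivative_works)
  moreover have "((\<lambda>x. x + a) has_derivative (\<lambda>h. h)) (at x)" by (auto intro!: derivative_eq_intros)
  ultimately have "((\<lambda>x. \<phi> (x + a)) has_derivative ?D) (at x)"
    by (rule has_derivative_compose[rotated])
  then show ?thesis unfolding partial_deriv_def[of i \<phi>] by (rule partial_deriv_has_derivative)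
qed

lemma C_k_translate: "C_k k \<phi> \<Longrightarrow> C_k k (\<lambda>x. \<phi> (x + a))"
proof (induction k arbitrary: \<phi>)
  case 0
  then show ?case
    using continuous_on_compose2[of UNIV \<phi> UNIV "\<lambda>x. x + a"] by (simp add: continuous_on_add)
next
  case (Suc k)
  have diff: "\<phi> differentiable (at x)" for x using Suc.prems by simp
  have "partial_deriv i (\<lambda>x. \<phi> (x + a)) = (\<lambda>x. partial_deriv i \<phi> (x + a))" for i
    using partial_deriv_translate[OF diff] by (rule ext)
  moreover have "(\<lambda>x. \<phi> (x + a)) differentiable (at x)" for x
  proof -
    have "(\<phi> has_derivative frechet_derivative \<phi> (at (x + a))) (at (x + a))"
      using diff by (simp add: frechet_derivative_works[symmetric])
    moreover have "((\<lambda>x. x + a) has_derivative (\<lambda>h. h)) (at x)" by (auto intro!: derivative_eq_intros)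
    ultimately have "((\<lambda>x. \<phi> (x + a)) has_derivative frechet_derivative \<phi> (at (x + a))) (at x)"
      by (rule has_derivative_compose[rotated])
    then show ?thesis by (rule differentiableI)
  qed
  ultimately show ?case using Suc by simp
qed

lemma test_function_translate:
  assumes "test_function \<phi>"
  shows "test_function (\<lambda>x. \<phi> (x + a))"
proof -
  have "C_k k (\<lambda>x. \<phi> (x + a))" for k
    using assms by (intro C_k_translate) (simp add: test_function_def)
  moreover have "bounded {x. \<phi> (x + a) \<noteq> 0}"
  proof -
    have "{x. \<phi> (x + a) \<noteq> 0} \<subseteq> (+) (- a) ` {x. \<phi> x \<noteq> 0}"
      by (auto simp: image_iff intro!: exI[of _ "_ + a"])
    then show ?thesis
      using bounded_translation[OF test_function_bounded_support[OF assms], of "- a"] bounded_subset by blast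
  qed
  ultimately show ?thesis by (simp add: test_function_def compact_closure)
qed

lemma has_weak_partial_iff:
  "has_weak_partial i u g \<longleftrightarrow>
     (\<forall>\<phi>. test_function \<phi> \<longrightarrow> cinner u (l2_of (partial_deriv i \<phi>)) = - cinner g (l2_of \<phi>))"
  unfolding has_weak_partial_def
  by (auto simp: cinner_l2_of cinner_l2_of[OF test_function_partial_deriv])

lemma partial_deriv_translate_test:
  "test_function \<phi> \<Longrightarrow> partial_deriv i (\<lambda>x. \<phi> (x + a)) = (\<lambda>x. partial_deriv i \<phi> (x + a))"
  using partial_deriv_translate[OF test_function_differentiable] by blast

lemma has_weak_partial_translate:
  assumes "has_weak_partial i u g"
  shows "has_weak_partial i (translate a u) (translate a g)"
  unfolding has_weak_partial_iff
proof (intro allI impI)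
  fix \<phi> :: "real^'a \<Rightarrow> real" assume \<phi>: "test_function \<phi>"
  have "cinner u (l2_of (partial_deriv i (\<lambda>x. \<phi> (x + - a)))) = - cinner g (l2_of (\<lambda>x. \<phi> (x + - a)))"
    using assms test_function_translate[OF \<phi>] unfolding has_weak_partial_iff by blast
  then show "cinner (translate a u) (l2_of (partial_deriv i \<phi>)) = - cinner (translate a g) (l2_of \<phi>)"
    unfolding partial_deriv_translate_test[OF \<phi>]
      translate_l2_of[OF \<phi>, symmetric] translate_l2_of[OF test_function_partial_deriv[OF \<phi>], symmetric]
    by (simp only: cinner_translate_left)
qed


lemma has_weak_laplacian_iff:
  "has_weak_laplacian u w \<longleftrightarrow>
     (\<forall>\<phi>. test_function \<phi> \<longrightarrow> (\<Sum>i\<in>UNIV. cinner u (l2_of (partial_deriv i (partial_deriv i \<phi>)))) = cinner w (l2_of \<phi>))"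
  unfolding has_weak_laplacian_def laplacian_def
  by (auto simp: cinner_l2_of test_function_partial_deriv scaleR_sum_left Bochner_Integration.integral_sum
      integrable_test_function_mult)

lemma has_weak_laplacian_translate:
  assumes "has_weak_laplacian u w"
  shows "has_weak_laplacian (translate a u) (translate a w)"
  unfolding has_weak_laplacian_iff
proof (intro allI impI)
  fix \<phi> :: "real^'a \<Rightarrow> real" assume \<phi>: "test_function \<phi>"
  note \<phi>' = test_function_partial_deriv[OF \<phi>]
  have "(\<Sum>i\<in>UNIV. cinner u (l2_of (partial_deriv i (partial_deriv i (\<lambda>x. \<phi> (x + - a)))))) = cinner w (l2_of (\<lambda>x. \<phi> (x + - a)))"
    using assms test_function_translate[OF \<phi>] unfolding has_weak_laplacian_iff by blast
  then show "(\<Sum>i\<in>UNIV. cinner (translate a u) (l2_of (partial_deriv i (partial_deriv i \<phi>)))) = cinner (translate a w) (l2_of \<phi>)"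
    unfolding partial_deriv_translate_test[OF \<phi>] partial_deriv_translate_test[OF \<phi>']
      translate_l2_of[OF \<phi>, symmetric] translate_l2_of[OF test_function_partial_deriv[OF \<phi>'], symmetric]
    by (simp only: cinner_translate_left)
qed

section \<open>Difference quotients\<close>

definition dquot :: "'d \<Rightarrow> real \<Rightarrow> 'd::finite l2 \<Rightarrow> 'd l2" where
  "dquot i h u = (1 / h) *\<^sub>R (translate (h *\<^sub>R axis i 1) u - u)"

lemma bounded_linear_dquot: "bounded_linear (dquot i h)"
  unfolding dquot_def
  by (intro bounded_linear_compose[OF bounded_linear_scaleR_right] bounded_linear_sub
      bounded_linear_translate bounded_linear_ident)

lemma dquot_cscale: "dquot i h (cscale c u) = cscale c (dquot i h u)"
  by (simp add: dquot_def translate_cscale cscale_scaleR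
      linear_diff[OF bounded_linear.linear[OF bounded_linear_cscale]] algebra_simps)


text \<open>Discrete integration by parts: the change of variables reverses the shift, and the
  quotient with the opposite step absorbs the sign of the step.\<close>

lemma cinner_dquot_left: "cinner (dquot i h u) v = - cinner u (dquot i (- h) v)"
  unfolding dquot_def
  by (simp add: bounded_bilinear.scaleR_left[OF bounded_bilinear_cinner] bounded_bilinear.scaleR_right[OF bounded_bilinear_cinner]
      bounded_bilinear.diff_left[OF bounded_bilinear_cinner] bounded_bilinear.diff_right[OF bounded_bilinear_cinner]
      bounded_bilinear.minus_right[OF bounded_bilinear_cinner] cinner_translate_left)

lemma inner_dquot_left: "inner (dquot i h u) v = - inner u (dquot i (- h) v)"
  by (simp add: inner_l2_def cinner_dquot_left)

lemma test_function_line_DERIV: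
  assumes "test_function \<phi>"
  shows "((\<lambda>s. \<phi> (x + s *\<^sub>R axis i 1)) has_real_derivative partial_deriv i \<phi> (x + s *\<^sub>R axis i 1)) (at s)"
proof -
  let ?y = "x + s *\<^sub>R axis i 1"
  have D: "(\<phi> has_derivative frechet_derivative \<phi> (at ?y)) (at ?y)"
    using test_function_differentiable[OF assms] by (simp add: frechet_derivative_works)
  have "((\<lambda>s. x + s *\<^sub>R axis i 1) has_derivative (\<lambda>h. h *\<^sub>R axis i 1)) (at s)"
    by (auto intro!: derivative_eq_intros)
  from has_derivative_compose[OF this D]
  have "((\<lambda>s. \<phi> (x + s *\<^sub>R axis i 1)) has_derivative (\<lambda>h. frechet_derivative \<phi> (at ?y) (h *\<^sub>R axis i 1))) (at s)" .
  moreover have "(\<lambda>h. frechet_derivative \<phi> (at ?y) (h *\<^sub>R axis i 1)) = (*) (partial_deriv i \<phi> ?y)"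
    using has_derivative_linear[OF D] by (auto simp: partial_deriv_def linear_scale)
  ultimately show ?thesis by (simp add: has_field_derivative_def)
qed

text \<open>Pointwise convergence is differentiability along a line; it improves to mean square
  convergence because the errors are bounded uniformly and supported in one fixed ball.\<close>

lemma dquot_l2_of_tendsto:
  assumes \<phi>: "test_function \<phi>"
  shows "((\<lambda>h. dquot i h (l2_of \<phi>)) \<longlongrightarrow> l2_of (partial_deriv i \<phi>)) (at 0)"
  unfolding tendsto_at_iff_sequentially
proof (intro allI impI)
  fix X :: "nat \<Rightarrow> real"
  assume X: "\<forall>n. X n \<in> UNIV - {0}" "X \<longlonglongrightarrow> 0"
  note d\<phi> = test_function_partial_deriv[OF \<phi>, of i]
  define q where "q n x = (\<phi> (x + X n *\<^sub>R axis i 1) - \<phi> x) / X n - partial_deriv i \<phi> x" for n x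
  have [measurable]: "\<phi> \<in> borel_measurable borel" "partial_deriv i \<phi> \<in> borel_measurable borel"
    by (rule borel_measurable_continuous_onI[OF test_function_continuous], rule \<phi> d\<phi>)+
  have q_meas: "q n \<in> borel_measurable lborel" for n unfolding q_def by measurable
  obtain C where C: "\<And>x. \<bar>partial_deriv i \<phi> x\<bar> \<le> C" "0 \<le> C"
    using test_function_bdd[OF d\<phi>] by blast
  obtain H where H: "\<And>n. \<bar>X n\<bar> \<le> H"
    using convergent_imp_bounded[OF X(2)] by (auto simp: bounded_iff)
  obtain r where r: "\<And>x. \<phi> x \<noteq> 0 \<Longrightarrow> norm x \<le> r"
    using test_function_bounded_support[OF \<phi>] by (auto simp: bounded_iff)
  have "closed {x. norm x \<le> r}" by (intro closed_Collect_le continuous_intros)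
  then have "closure {x. \<phi> x \<noteq> 0} \<subseteq> {x. norm x \<le> r}" by (intro closure_minimal) (auto dest: r)
  then have r': "norm x \<le> r" if "partial_deriv i \<phi> x \<noteq> 0" for x
    using partial_deriv_nonzero[OF that] by blast
  \<comment> \<open>The mean value theorem bounds the quotient by \<open>C\<close>, and the
    derivative contributes another \<open>C\<close>. The steps are bounded by \<open>H\<close>, so
    the shifted supports stay in the ball of radius \<open>r + H\<close>.\<close>
  have q_bound: "\<bar>q n x\<bar> \<le> 2 * C * indicator (cball 0 (r + H)) x" for n x
  proof (cases "norm x \<le> r + H")
    case True
    have "norm (\<phi> (x + X n *\<^sub>R axis i 1) - \<phi> (x + 0 *\<^sub>R axis i 1)) \<le> C * norm (X n - 0)"
      by (rule field_differentiable_bound[of UNIV "\<lambda>s. \<phi> (x + s *\<^sub>R axis i 1)"])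
        (use test_function_line_DERIV[OF \<phi>] C in auto)
    then have "\<bar>(\<phi> (x + X n *\<^sub>R axis i 1) - \<phi> x) / X n\<bar> \<le> C"
      using X(1) by (simp add: divide_le_eq)
    then have "\<bar>q n x\<bar> \<le> C + C"
      unfolding q_def using C(1)[of x] by (intro order_trans[OF abs_triangle_ineq4] add_mono)
    then show ?thesis using True by simp
  next
    case False
    have "norm x \<le> norm (x + X n *\<^sub>R axis i 1) + \<bar>X n\<bar>"
      using norm_triangle_ineq4[of "x + X n *\<^sub>R axis i 1" "X n *\<^sub>R axis i 1"] by simp
    then have "\<not> norm (x + X n *\<^sub>R axis i 1) \<le> r" using False H[of n] by linarith
    moreover have "\<not> norm x \<le> r" using False H[of n] by linarith
    ultimately have "q n x = 0" unfolding q_def using r r' by (metis diff_self div_0)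
    then show ?thesis using C(2) by simp
  qed
  have q_lim: "(\<lambda>n. q n x) \<longlonglongrightarrow> 0" for x
  proof -
    have "((\<lambda>h. (\<phi> (x + h *\<^sub>R axis i 1) - \<phi> x) / h) \<longlongrightarrow> partial_deriv i \<phi> x) (at 0)"
      using test_function_line_DERIV[OF \<phi>, of x i 0] by (simp add: has_field_derivative_iff)
    then have "(\<lambda>n. (\<phi> (x + X n *\<^sub>R axis i 1) - \<phi> x) / X n) \<longlonglongrightarrow> partial_deriv i \<phi> x"
      using X unfolding tendsto_at_iff_sequentially by (auto simp: o_def)
    then show ?thesis unfolding q_def by (rule LIM_zero)
  qed
  have norm_eq: "(norm (dquot i (X n) (l2_of \<phi>) - l2_of (partial_deriv i \<phi>)))\<^sup>2 = (\<integral>x. (q n x)\<^sup>2 \<partial>lborel)" for n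
    unfolding power2_norm_l2
  proof (rule integral_cong_AE)
    show "AE x in lborel. (norm (rep_l2 (dquot i (X n) (l2_of \<phi>) - l2_of (partial_deriv i \<phi>)) x))\<^sup>2 = (q n x)\<^sup>2"
      using rep_l2_minus[of "dquot i (X n) (l2_of \<phi>)" "l2_of (partial_deriv i \<phi>)"] rep_l2_of[OF d\<phi>]
        rep_l2_scaleR[of "1 / X n" "translate (X n *\<^sub>R axis i 1) (l2_of \<phi>) - l2_of \<phi>"]
        rep_l2_minus[of "translate (X n *\<^sub>R axis i 1) (l2_of \<phi>)" "l2_of \<phi>"] rep_l2_of[OF \<phi>]
        rep_l2_of[OF test_function_translate[OF \<phi>], of "X n *\<^sub>R axis i 1"]
    proof eventually_elim
      case (elim x)
      have "rep_l2 (dquot i (X n) (l2_of \<phi>) - l2_of (partial_deriv i \<phi>)) x = complex_of_real (q n x)"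
        using elim by (simp add: dquot_def translate_l2_of[OF \<phi>] q_def scaleR_conv_of_real diff_divide_distrib)
      then show ?case by (simp add: norm_of_real)
    qed
    show "(\<lambda>x. (q n x)\<^sup>2) \<in> borel_measurable lborel" using q_meas by measurable
  qed measurable
  have "(\<lambda>n. \<integral>x. (q n x)\<^sup>2 \<partial>lborel) \<longlonglongrightarrow> (\<integral>x. 0 \<partial>(lborel :: (real^'a) measure))"
  proof (rule integral_dominated_convergence[where w="\<lambda>x. (2 * C)\<^sup>2 * indicator (cball 0 (r + H)) x"])
    show "integrable lborel (\<lambda>x::real^'a. (2 * C)\<^sup>2 * indicat_real (cball 0 (r + H)) x)"
      by (intro integrable_mult_right integrable_real_indicator) (simp_all add: emeasure_bounded_finite[OF bounded_cball, unfolded infinity_ennreal_def])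
    show "AE x in lborel. norm ((q n x)\<^sup>2) \<le> (2 * C)\<^sup>2 * indicator (cball 0 (r + H)) x" for n
    proof (rule AE_I2)
      fix x
      have "\<bar>q n x\<bar>\<^sup>2 \<le> (2 * C * indicator (cball 0 (r + H)) x)\<^sup>2"
        by (rule power_mono[OF q_bound]) simp
      then show "norm ((q n x)\<^sup>2) \<le> (2 * C)\<^sup>2 * indicator (cball 0 (r + H)) x"
        by (cases "x \<in> cball 0 (r + H)") (simp_all add: power_mult_distrib)
    qed
    show "AE x in lborel. (\<lambda>n. (q n x)\<^sup>2) \<longlonglongrightarrow> 0"
      using tendsto_power[OF q_lim, where n=2] by (intro AE_I2) simp
    show "(\<lambda>x. (q n x)\<^sup>2) \<in> borel_measurable lborel" for n using q_meas by measurable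
  qed simp
  then have "(\<lambda>n. (norm (dquot i (X n) (l2_of \<phi>) - l2_of (partial_deriv i \<phi>)))\<^sup>2) \<longlonglongrightarrow> 0"
    by (simp add: norm_eq)
  then have "(\<lambda>n. sqrt ((norm (dquot i (X n) (l2_of \<phi>) - l2_of (partial_deriv i \<phi>)))\<^sup>2)) \<longlonglongrightarrow> sqrt 0"
    by (rule tendsto_real_sqrt)
  then have "(\<lambda>n. norm (dquot i (X n) (l2_of \<phi>) - l2_of (partial_deriv i \<phi>))) \<longlonglongrightarrow> 0" by simp
  then have "(\<lambda>n. dquot i (X n) (l2_of \<phi>)) \<longlonglongrightarrow> l2_of (partial_deriv i \<phi>)"
    by (simp add: tendsto_norm_zero_iff LIM_zero_iff)
  then show "((\<lambda>h. dquot i h (l2_of \<phi>)) \<circ> X) \<longlonglongrightarrow> l2_of (partial_deriv i \<phi>)" by (simp add: o_def)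
qed

section \<open>Weak partial derivatives as limits of difference quotients\<close>

lemma filterlim_uminus_at_0: "filterlim uminus (at 0) (at (0::real))"
  by (rule filterlim_atI) (auto simp: eventually_at_filter intro!: tendsto_eq_intros)

text \<open>Discrete integration by parts puts the quotient on the bump, where it converges in norm;
  the definition of the weak derivative identifies the limit.\<close>

lemma dquot_tendsto_span_bumps:
  fixes u g w :: "'d::finite l2"
  assumes "has_weak_partial i u g" "w \<in> span bumps"
  shows "((\<lambda>h. inner (dquot i h u) w) \<longlongrightarrow> inner g w) (at 0)"
  using assms(2)
proof (induction rule: span_induct_alt)
  case base
  show ?case by simp
next
  case (step r b y)
  obtain c and \<phi> :: "real^'d \<Rightarrow> real" where \<phi>: "test_function \<phi>" "b = cscale c (l2_of \<phi>)"
    using step.hyps(1) by (rule bumpsE)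
  from filterlim_uminus_at_0 have "((\<lambda>h. dquot i (- h) (l2_of \<phi>)) \<longlongrightarrow> l2_of (partial_deriv i \<phi>)) (at 0)"
    by (rule filterlim_compose[OF dquot_l2_of_tendsto[OF \<phi>(1)]])
  then have "((\<lambda>h. - inner u (cscale c (dquot i (- h) (l2_of \<phi>)))) \<longlongrightarrow> - inner u (cscale c (l2_of (partial_deriv i \<phi>)))) (at 0)"
    by (intro tendsto_minus tendsto_inner tendsto_const bounded_linear.tendsto[OF bounded_linear_cscale])
  moreover have "- inner u (cscale c (dquot i (- h) (l2_of \<phi>))) = inner (dquot i h u) b" for h
    by (simp add: inner_dquot_left \<phi>(2) dquot_cscale)
  moreover have "- inner u (cscale c (l2_of (partial_deriv i \<phi>))) = inner g b"
    using assms(1) \<phi> by (simp add: inner_l2_def cinner_cscale_right has_weak_partial_iff)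
  ultimately have "((\<lambda>h. inner (dquot i h u) b) \<longlongrightarrow> inner g b) (at 0)" by simp
  then have "((\<lambda>h. r * inner (dquot i h u) b + inner (dquot i h u) y) \<longlongrightarrow> r * inner g b + inner g y) (at 0)"
    by (intro tendsto_add tendsto_mult tendsto_const step.IH)
  then show ?case by (simp add: inner_add_right)
qed

text \<open>The mean value theorem for the scalar function \<open>f\<close>. Its derivative exists
  at every point because translation commutes with weak derivatives, and it is bounded by |g| |w|
  because translation is isometric. Density of the span removes \<open>w\<close>.\<close>

lemma norm_dquot_le:
  fixes u g :: "'d::finite l2"
  assumes g: "has_weak_partial i u g" and "h \<noteq> 0"
  shows "norm (dquot i h u) \<le> norm g"
proof (rule norm_le_of_dense[OF norm_ge_zero dense_bumps])
  fix w :: "'d l2"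
  assume w: "w \<in> span bumps"
  define f where "f s = inner (translate (s *\<^sub>R axis i 1) u) w" for s
  have "(f has_real_derivative inner (translate (s *\<^sub>R axis i 1) g) w) (at s)" for s
  proof -
    have "((\<lambda>h. inner (dquot i h (translate (s *\<^sub>R axis i 1) u)) w) \<longlongrightarrow> inner (translate (s *\<^sub>R axis i 1) g) w) (at 0)"
      by (rule dquot_tendsto_span_bumps[OF has_weak_partial_translate[OF g] w])
    moreover have "inner (dquot i h (translate (s *\<^sub>R axis i 1) u)) w = (f (s + h) - f s) / h" for h
      by (simp add: dquot_def f_def translate_translate scaleR_add_left inner_diff_left add.commute)
    ultimately show ?thesis by (simp add: DERIV_def)
  qed
  then have "norm (f h - f 0) \<le> (norm g * norm w) * norm (h - 0)"
    by (intro field_differentiable_bound[of UNIV f])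
      (auto simp: Cauchy_Schwarz_ineq2[of "translate _ g" w, unfolded norm_translate])
  moreover have "inner (dquot i h u) w = (f h - f 0) / h"
    by (simp add: dquot_def f_def inner_diff_left)
  ultimately show "\<bar>inner (dquot i h u) w\<bar> \<le> norm g * norm w"
    using assms(2) by (simp add: divide_le_eq)
qed

text \<open>In |v - g|^2 = |v|^2 - |g|^2 - 2 (v - g, g) the norm bound makes the first difference
  nonpositive, and weak convergence handles the inner product once \<open>g\<close> is replaced by a
  nearby \<open>w\<close> from the dense set.\<close>

lemma weak_tendsto_imp_tendsto:
  fixes v :: "'b \<Rightarrow> 'a::real_inner"
  assumes dense: "closure S = UNIV" and lim: "\<And>w. w \<in> S \<Longrightarrow> ((\<lambda>h. inner (v h) w) \<longlongrightarrow> inner g w) F"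
    and le: "eventually (\<lambda>h. norm (v h) \<le> norm g) F"
  shows "(v \<longlongrightarrow> g) F"
proof (rule tendstoI)
  fix e :: real assume e: "e > 0"
  \<comment> \<open>The replacement error is at most 2 |g| d \<le> e^2/4; doubled and added to twice
    e^2/8 it remains below e^2. The summand 1 keeps the denominator positive when \<open>g\<close>
    is zero.\<close>
  define d where "d = e\<^sup>2 / (8 * (norm g + 1))"
  have d: "d > 0" using e by (simp add: d_def add_nonneg_pos)
  have "g \<in> closure S" using dense by simp
  then obtain w where w: "w \<in> S" "dist w g < d" using d unfolding closure_approachable by blast
  have "eventually (\<lambda>h. dist (inner (v h) w) (inner g w) < e\<^sup>2 / 8) F"
    using lim[OF w(1)] e by (intro tendstoD) auto
  with le show "eventually (\<lambda>h. dist (v h) g < e) F"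
  proof eventually_elim
    case (elim h)
    have "\<bar>inner (v h - g) (g - w)\<bar> \<le> norm (v h - g) * norm (g - w)" by (rule Cauchy_Schwarz_ineq2)
    also have "\<dots> \<le> (2 * norm g) * d"
    proof (rule mult_mono)
      show "norm (v h - g) \<le> 2 * norm g" using norm_triangle_ineq4[of "v h" g] elim(1) by linarith
      show "norm (g - w) \<le> d" using w(2) by (simp add: dist_norm norm_minus_commute)
    qed auto
    also have "\<dots> \<le> e\<^sup>2 / 4"
    proof -
      have "2 * norm g * e\<^sup>2 \<le> 2 * (norm g + 1) * e\<^sup>2" by (intro mult_right_mono) auto
      then show ?thesis by (simp add: d_def field_simps add_pos_nonneg)
    qed
    finally have 1: "\<bar>inner (v h - g) (g - w)\<bar> \<le> e\<^sup>2 / 4" .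
    have 2: "\<bar>inner (v h) w - inner g w\<bar> < e\<^sup>2 / 8" using elim(2) by (simp add: dist_real_def)
    have "(norm (v h - g))\<^sup>2 = (norm (v h))\<^sup>2 - (norm g)\<^sup>2 - 2 * inner (v h - g) (g - w) - 2 * (inner (v h) w - inner g w)"
      unfolding power2_norm_eq_inner by (simp add: algebra_simps inner_commute)
    moreover have "(norm (v h))\<^sup>2 \<le> (norm g)\<^sup>2" using elim(1) by (intro power_mono) auto
    moreover have "- 2 * A - 2 * B < e\<^sup>2" if "\<bar>A\<bar> \<le> e\<^sup>2 / 4" "\<bar>B\<bar> < e\<^sup>2 / 8" for A B
      using that zero_less_power[OF e, of 2] by linarith
    ultimately have "(norm (v h - g))\<^sup>2 < e\<^sup>2"
      using 1 2 by (smt (verit))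
    then show ?case using e by (simp add: dist_norm power2_less_imp_less)
  qed
qed

lemma dquot_tendsto:
  fixes u g :: "'d::finite l2"
  assumes "has_weak_partial i u g"
  shows "((\<lambda>h. dquot i h u) \<longlongrightarrow> g) (at 0)"
proof (rule weak_tendsto_imp_tendsto[OF dense_bumps])
  show "eventually (\<lambda>h. norm (dquot i h u) \<le> norm g) (at 0)"
    using norm_dquot_le[OF assms] by (simp add: eventually_at_filter)
qed (rule dquot_tendsto_span_bumps[OF assms])

text \<open>The converse direction holds along arbitrary nonzero steps tending to 0. The generality
  in the filter covers the full limit at 0, the fixed sequence of steps, and the subsequence used
  for the stochastic convolution.\<close>

lemma has_weak_partial_limit:
  fixes u g :: "'d::finite l2"
  assumes h: "filterlim h (at 0) F" "F \<noteq> bot" and lim: "((\<lambda>n. dquot i (h n) u) \<longlongrightarrow> g) F"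
  shows "has_weak_partial i u g"
  unfolding has_weak_partial_iff
proof (intro allI impI)
  fix \<phi> :: "real^'d \<Rightarrow> real" assume \<phi>: "test_function \<phi>"
  have "filterlim (\<lambda>n. - h n) (at 0) F" by (rule filterlim_compose[OF filterlim_uminus_at_0 h(1)])
  then have "((\<lambda>n. dquot i (- h n) (l2_of \<phi>)) \<longlongrightarrow> l2_of (partial_deriv i \<phi>)) F"
    by (rule filterlim_compose[OF dquot_l2_of_tendsto[OF \<phi>]])
  then have "((\<lambda>n. - cinner u (dquot i (- h n) (l2_of \<phi>))) \<longlongrightarrow> - cinner u (l2_of (partial_deriv i \<phi>))) F"
    by (intro tendsto_minus tendsto_cinner tendsto_const)
  moreover have "((\<lambda>n. cinner (dquot i (h n) u) (l2_of \<phi>)) \<longlongrightarrow> cinner g (l2_of \<phi>)) F"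
    by (intro tendsto_cinner tendsto_const lim)
  ultimately have "- cinner u (l2_of (partial_deriv i \<phi>)) = cinner g (l2_of \<phi>)"
    unfolding cinner_dquot_left by (rule tendsto_unique[OF h(2)])
  then show "cinner u (l2_of (partial_deriv i \<phi>)) = - cinner g (l2_of \<phi>)"
    by (metis minus_minus)
qed

lemma has_weak_partial_iff_tendsto:
  "has_weak_partial i u g \<longleftrightarrow> ((\<lambda>h. dquot i h u) \<longlongrightarrow> g) (at 0)"
  using dquot_tendsto has_weak_partial_limit[OF filterlim_ident] by (auto simp: at_neq_bot)

lemma has_weak_partial_unique:
  "has_weak_partial i u g \<Longrightarrow> has_weak_partial i u g' \<Longrightarrow> g = g'"
  unfolding has_weak_partial_iff_tendsto by (rule tendsto_unique[OF at_neq_bot])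

lemma weak_partial_eqI: "has_weak_partial i u g \<Longrightarrow> weak_partial i u = g"
  unfolding weak_partial_def using has_weak_partial_unique by blast

lemma H1D: "u \<in> H1 \<Longrightarrow> has_weak_partial i u (weak_partial i u)"
  unfolding H1_def using weak_partial_eqI by fastforce

lemma has_weak_partial_add:
  "has_weak_partial i u g \<Longrightarrow> has_weak_partial i v k \<Longrightarrow> has_weak_partial i (u + v) (g + k)"
  unfolding has_weak_partial_iff_tendsto
  by (simp add: linear_add[OF bounded_linear.linear[OF bounded_linear_dquot]] tendsto_add)

lemma has_weak_partial_cscale:
  "has_weak_partial i u g \<Longrightarrow> has_weak_partial i (cscale c u) (cscale c g)"
  unfolding has_weak_partial_iff_tendsto
  by (simp add: dquot_cscale bounded_linear.tendsto[OF bounded_linear_cscale])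

text \<open>Integration by parts in the Sobolev space, as the limit of its discrete version.\<close>

lemma inner_weak_partial_left:
  assumes "has_weak_partial i u g" "has_weak_partial i v k"
  shows "inner g v = - inner u k"
proof (rule tendsto_unique[OF at_neq_bot])
  show "((\<lambda>h. inner (dquot i h u) v) \<longlongrightarrow> inner g v) (at 0)"
    using dquot_tendsto[OF assms(1)] by (intro tendsto_inner tendsto_const)
  from filterlim_uminus_at_0 have "((\<lambda>h. dquot i (- h) v) \<longlongrightarrow> k) (at 0)"
    by (rule filterlim_compose[OF dquot_tendsto[OF assms(2)]])
  then show "((\<lambda>h. inner (dquot i h u) v) \<longlongrightarrow> - inner u k) (at 0)"
    unfolding inner_dquot_left by (intro tendsto_minus tendsto_inner tendsto_const)
qed

text \<open>Measurability arguments and Fatou's lemma need countable limits, hence one fixed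
  sequence of nonzero steps.\<close>

definition mesh :: "nat \<Rightarrow> real" where
  "mesh n = 1 / real (Suc n)"

lemma mesh_nonzero: "mesh n \<noteq> 0"
  by (simp add: mesh_def)

lemma filterlim_mesh: "filterlim mesh (at 0) sequentially"
  unfolding mesh_def filterlim_at
  using LIMSEQ_inverse_real_of_nat by (simp add: inverse_eq_divide)

lemma has_weak_partial_iff_LIMSEQ:
  "has_weak_partial i u g \<longleftrightarrow> (\<lambda>n. dquot i (mesh n) u) \<longlonglongrightarrow> g"
  using filterlim_compose[OF dquot_tendsto filterlim_mesh] has_weak_partial_limit[OF filterlim_mesh]
  by auto

text \<open>Outside of the domain of the weak derivative, \<^const>\<open>weak_partial\<close> is the fixed junk value of
  \<^const>\<open>The\<close> on the empty predicate, so that it is Borel measurable on the whole space.\<close>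

lemma borel_measurable_weak_partial [measurable]:
  "weak_partial i \<in> borel_measurable (borel :: 'd::finite l2 measure)"
proof -
  have [measurable]: "dquot i (mesh n) \<in> borel_measurable (borel :: 'd l2 measure)" for n
    by (intro borel_measurable_continuous_onI linear_continuous_on bounded_linear_dquot)
  have "weak_partial i u = (if Cauchy (\<lambda>n. dquot i (mesh n) u) then lim (\<lambda>n. dquot i (mesh n) u) else (THE g. False))" for u :: "'d l2"
  proof (cases "Cauchy (\<lambda>n. dquot i (mesh n) u)")
    case True
    then have "has_weak_partial i u (lim (\<lambda>n. dquot i (mesh n) u))"
      unfolding has_weak_partial_iff_LIMSEQ by (simp add: Cauchy_convergent_iff convergent_LIMSEQ_iff)
    then show ?thesis using True weak_partial_eqI by simp
  next
    case False
    then have "\<not> has_weak_partial i u g" for g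
      unfolding has_weak_partial_iff_LIMSEQ by (meson LIMSEQ_imp_Cauchy)
    then show ?thesis using False by (simp add: weak_partial_def)
  qed
  moreover have "(\<lambda>u::'d l2. if Cauchy (\<lambda>n. dquot i (mesh n) u) then lim (\<lambda>n. dquot i (mesh n) u) else (THE g. False)) \<in> borel_measurable borel"
    by (intro measurable_If borel_measurable_lim_metric measurable_const) (measurable; fail)+
  ultimately show ?thesis by (simp cong: measurable_cong)
qed

text \<open>For z the complex inner product of \<open>u\<close> with its derivative, \<i> (z - cnj
  z) equals -2 Im z, and \<open>Im_cinner\<close> makes this a real inner product.\<close>

lemma momentum_nth: "momentum u $ i = - 2 * inner u (cscale \<i> (weak_partial i u))"
proof -
  let ?f = "rep_l2 u" and ?g = "rep_l2 (weak_partial i u)"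
  have int: "integrable lborel (\<lambda>x. ?f x * cnj (?g x))" "integrable lborel (\<lambda>x. ?g x * cnj (?f x))"
    by (rule square_integrable_prod; rule square_integrable_rep)+
  have "(\<integral>x. ?f x * cnj (?g x) - cnj (?f x) * ?g x \<partial>lborel) = cinner u (weak_partial i u) - cinner (weak_partial i u) u"
    unfolding cinner.rep_eq using int by (simp add: mult.commute[of "cnj (?f _)"])
  then have "momentum u $ i = Re (\<i> * (cinner u (weak_partial i u) - cnj (cinner u (weak_partial i u))))"
    by (simp add: momentum_def cinner_commute[of "weak_partial i u"])
  then show ?thesis by (simp add: Im_cinner[symmetric])
qed

lemma borel_measurable_momentum [measurable]:
  "momentum \<in> borel_measurable (borel :: 'd::finite l2 measure)"
proof -
  have [measurable]: "cscale \<i> \<in> borel_measurable (borel :: 'd l2 measure)"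
    by (intro borel_measurable_continuous_onI linear_continuous_on bounded_linear_cscale)
  have "(\<lambda>u::'d l2. momentum u $ i) \<in> borel_measurable borel" for i
    unfolding momentum_nth by measurable
  then have "(\<lambda>u::'d l2. \<Sum>i\<in>UNIV. (momentum u $ i) *\<^sub>R axis i 1 :: real^'d) \<in> borel_measurable borel"
    by measurable
  then show ?thesis by (simp add: basis_expansion scalar_mult_eq_scaleR[symmetric])
qed

section \<open>Isometric groups and their generators\<close>

definition generates :: "(real \<Rightarrow> 'a::real_normed_vector \<Rightarrow> 'a) \<Rightarrow> 'a \<Rightarrow> 'a \<Rightarrow> bool" where
  "generates S u v \<longleftrightarrow> ((\<lambda>h. (S h u - u) /\<^sub>R h) \<longlongrightarrow> v) (at 0)"

lemma has_vector_derivative_iff_quotient: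
  "(f has_vector_derivative f') (at t) \<longleftrightarrow> ((\<lambda>h. (f (t + h) - f t) /\<^sub>R h) \<longlongrightarrow> f') (at 0)"
proof -
  have "(f has_vector_derivative f') (at t)
      \<longleftrightarrow> ((\<lambda>h. norm (f (t + h) - f t - h *\<^sub>R f') / norm h) \<longlongrightarrow> 0) (at 0)"
    by (simp add: has_vector_derivative_def has_derivative_at bounded_linear_scaleR_left)
  also have "\<dots> \<longleftrightarrow> ((\<lambda>h. norm ((f (t + h) - f t) /\<^sub>R h - f')) \<longlongrightarrow> 0) (at 0)"
  proof (rule filterlim_cong[OF refl refl])
    show "eventually (\<lambda>h. norm (f (t + h) - f t - h *\<^sub>R f') / norm h = norm ((f (t + h) - f t) /\<^sub>R h - f')) (at 0)"
      unfolding eventually_at_filter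
    proof (rule always_eventually, intro allI impI)
      fix h :: real assume "h \<noteq> 0"
      then have "(f (t + h) - f t) /\<^sub>R h - f' = (f (t + h) - f t - h *\<^sub>R f') /\<^sub>R h" by (simp add: algebra_simps)
      then show "norm (f (t + h) - f t - h *\<^sub>R f') / norm h = norm ((f (t + h) - f t) /\<^sub>R h - f')"
        by (simp add: divide_inverse mult.commute)
    qed
  qed
  also have "\<dots> \<longleftrightarrow> ((\<lambda>h. (f (t + h) - f t) /\<^sub>R h) \<longlongrightarrow> f') (at 0)"
    by (simp add: tendsto_norm_zero_iff LIM_zero_iff)
  finally show ?thesis .
qed

lemma has_real_derivative_inner:
  assumes "(f has_vector_derivative f') (at t)" "(g has_vector_derivative g') (at t)"
  shows "((\<lambda>s. inner (f s) (g s)) has_real_derivative inner f' (g t) + inner (f t) g') (at t)"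
proof -
  have "(\<lambda>h. inner (f t) (h *\<^sub>R g') + inner (h *\<^sub>R f') (g t)) = (*) (inner f' (g t) + inner (f t) g')"
    by (auto simp: algebra_simps)
  then show ?thesis
    using has_derivative_inner[OF assms[unfolded has_vector_derivative_def]]
    by (simp only: has_field_derivative_def)
qed

text \<open>The common abstraction of the Schroedinger group and its conjugate by a translation, the
  two groups to be compared. Only the real structure is recorded.\<close>

locale isometric_group =
  fixes S :: "real \<Rightarrow> 'a::{real_inner, banach} \<Rightarrow> 'a"
  assumes add: "S t (u + v) = S t u + S t v"
    and scaleR: "S t (r *\<^sub>R u) = r *\<^sub>R S t u"
    and isometric: "inner (S t u) (S t v) = inner u v"
    and zero [simp]: "S 0 u = u"
    and plus: "S (s + t) u = S s (S t u)"
    and continuous: "continuous_on UNIV (\<lambda>t. S t u)"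
begin

lemma norm_eq [simp]: "norm (S t u) = norm u"
  by (simp add: norm_eq_sqrt_inner isometric)

lemma bounded_linear_group: "bounded_linear (S t)"
  by (rule bounded_linear_intro[of _ 1]) (simp_all add: add scaleR)

lemma group_diff: "S t (u - v) = S t u - S t v"
  by (rule linear_diff[OF bounded_linear.linear[OF bounded_linear_group]])

lemma generates_shift:
  assumes "generates S u v"
  shows "generates S (S t u) (S t v)"
proof -
  have "((\<lambda>h. S t ((S h u - u) /\<^sub>R h)) \<longlongrightarrow> S t v) (at 0)"
    using assms unfolding generates_def by (rule bounded_linear.tendsto[OF bounded_linear_group])
  moreover have "S t ((S h u - u) /\<^sub>R h) = (S h (S t u) - S t u) /\<^sub>R h" for h
    by (simp add: scaleR group_diff plus[symmetric] add.commute)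
  ultimately show ?thesis by (simp add: generates_def)
qed

lemma generates_scaleR:
  assumes "generates S u v"
  shows "generates S (r *\<^sub>R u) (r *\<^sub>R v)"
proof -
  have "((\<lambda>h. r *\<^sub>R ((S h u - u) /\<^sub>R h)) \<longlongrightarrow> r *\<^sub>R v) (at 0)"
    using assms unfolding generates_def by (intro tendsto_scaleR tendsto_const)
  moreover have "r *\<^sub>R ((S h u - u) /\<^sub>R h) = (S h (r *\<^sub>R u) - r *\<^sub>R u) /\<^sub>R h" for h
    by (simp add: scaleR scaleR_diff_right mult.commute)
  ultimately show ?thesis by (simp add: generates_def)
qed

lemma orbit_DERIV:
  assumes S: "generates S u v"
  shows "((\<lambda>s. S s u) has_vector_derivative S t v) (at t)"
proof -
  have "((\<lambda>h. (S h (S t u) - S t u) /\<^sub>R h) \<longlongrightarrow> S t v) (at 0)"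
    using generates_shift[OF S] by (simp add: generates_def)
  then have "((\<lambda>h. (S (t + h) u - S t u) /\<^sub>R h) \<longlongrightarrow> S t v) (at 0)"
    by (simp add: plus[symmetric] add.commute)
  then show ?thesis by (simp add: has_vector_derivative_iff_quotient)
qed

text \<open>The constant function (S h u, S h u') is differentiated at 0; the two quotients below
  are its exact discrete product rule.\<close>

lemma skew:
  assumes "generates S u v" "generates S u' v'"
  shows "inner v u' + inner u v' = 0"
proof -
  have cont: "((\<lambda>h. S h u') \<longlongrightarrow> u') (at 0)"
    using continuous[of u'] by (auto simp: continuous_on_eq_continuous_at isCont_def dest!: spec[of _ 0])
  have "((\<lambda>h. inner ((S h u - u) /\<^sub>R h) (S h u') + inner u ((S h u' - u') /\<^sub>R h)) \<longlongrightarrow> inner v u' + inner u v') (at 0)"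
    using assms unfolding generates_def by (intro tendsto_add tendsto_inner tendsto_const cont)
  moreover have "inner ((S h u - u) /\<^sub>R h) (S h u') + inner u ((S h u' - u') /\<^sub>R h) = 0" for h
    by (simp add: inner_diff_left inner_diff_right isometric algebra_simps)
  ultimately show ?thesis by (simp add: tendsto_const_iff)
qed

text \<open>The averages \<open>1/\<epsilon> \<integral>\<^sub>0\<^sup>\<epsilon> S(s) u ds\<close> lie in the domain of the generator and converge to \<open>u\<close>.\<close>

lemma dense_domain: "closure {u. \<exists>v. generates S u v} = UNIV"
proof -
  have "u \<in> closure {u. \<exists>v. generates S u v}" for u
  proof -
    \<comment> \<open>An antiderivative of the orbit takes the place of the integral. The interval
      extends beyond [0, 1] on both sides so that all arguments \<open>e + h\<close> with |h| < 1
      and 0 < e < 1 remain inside.\<close>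
    obtain F where F0: "\<And>t. t \<in> {-1..2} \<Longrightarrow> (F has_vector_derivative S t u) (at t within {-1..2})"
      using antiderivative_continuous[of "-1" 2 "\<lambda>t. S t u"] continuous_on_subset[OF continuous] by blast
    then have F: "(F has_vector_derivative S t u) (at t)" if "-1 < t" "t < 2" for t
      using that F0[of t] by (simp add: at_within_Icc_at)
    \<comment> \<open>The group moves the window of integration from [0, e] to [h, e + h]. In
      antiderivative form: the difference of both sides has derivative zero on [0, e].\<close>
    have shift: "S h (F e - F 0) = F (e + h) - F h" if e: "0 < e" "e < 1" and h: "\<bar>h\<bar> < 1" for e h
    proof -
      have deriv: "((\<lambda>t. S h (F t) - F (t + h)) has_vector_derivative 0) (at t within {0..e})" if "t \<in> {0..e}" for t
      proof -
        have "((\<lambda>t. S h (F t)) has_vector_derivative S h (S t u)) (at t)"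
          using that e by (intro bounded_linear.has_vector_derivative[OF bounded_linear_group] F) auto
        moreover have "((\<lambda>t. F (t + h)) has_vector_derivative S (t + h) u) (at t)"
        proof -
          have "- 1 < t + h" "t + h < 2" using that e h by auto
          from F[OF this] show ?thesis by (simp add: has_vector_derivative_iff_quotient add_ac)
        qed
        ultimately have "((\<lambda>t. S h (F t) - F (t + h)) has_vector_derivative S h (S t u) - S (t + h) u) (at t)"
          by (rule has_vector_derivative_diff)
        then show ?thesis by (simp add: plus[symmetric] add.commute has_vector_derivative_at_within)
      qed
      obtain c where c: "\<And>t. t \<in> {0..e} \<Longrightarrow> S h (F t) - F (t + h) = c"
        by (rule has_vector_derivative_zero_constant[OF convex_real_interval(5) deriv]) (assumption, rule that)
      from c[of e] c[of 0] e show ?thesis by (simp add: group_diff algebra_simps)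
    qed
    have quot: "((\<lambda>h. (F (t + h) - F t) /\<^sub>R h) \<longlongrightarrow> S t u) (at 0)" if "-1 < t" "t < 2" for t
      using F[OF that] by (simp add: has_vector_derivative_iff_quotient)
    have dom: "generates S (F e - F 0) (S e u - u)" if e: "0 < e" "e < 1" for e
    proof -
      have "((\<lambda>h. (F (e + h) - F e) /\<^sub>R h - (F (0 + h) - F 0) /\<^sub>R h) \<longlongrightarrow> S e u - S 0 u) (at 0)"
        by (intro tendsto_diff quot) (use e in auto)
      moreover have "eventually (\<lambda>h. (F (e + h) - F e) /\<^sub>R h - (F (0 + h) - F 0) /\<^sub>R h = (S h (F e - F 0) - (F e - F 0)) /\<^sub>R h) (at 0)"
        unfolding eventually_at by (rule exI[of _ 1]) (auto simp: dist_real_def shift[OF e] scaleR_diff_right)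
      ultimately show ?thesis unfolding generates_def by (simp add: Lim_transform_eventually)
    qed
    have "generates S ((F e - F 0) /\<^sub>R e) ((S e u - u) /\<^sub>R e)" if "0 < e" "e < 1" for e
      by (rule generates_scaleR[OF dom[OF that]])
    moreover have "0 < mesh (Suc n)" "mesh (Suc n) < 1" for n by (simp_all add: mesh_def)
    ultimately have "(F (mesh (Suc n)) - F 0) /\<^sub>R mesh (Suc n) \<in> {u. \<exists>v. generates S u v}" for n
      by blast
    moreover have "(\<lambda>n. (F (mesh (Suc n)) - F 0) /\<^sub>R mesh (Suc n)) \<longlonglongrightarrow> u"
      using filterlim_compose[OF quot[of 0] filterlim_mesh[THEN filterlim_sequentially_Suc[THEN iffD2]]] by simp
    ultimately show ?thesis by (rule closure_seqI)
  qed
  then show ?thesis by blast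
qed

end

text \<open>For u in the common domain, (S s u, V s u) has derivative zero by skew symmetry, because
  \<open>V s u\<close> lies in the domain of the generator of \<open>S\<close> too. Its value is
  therefore |u|^2, and two vectors of norm |u| with that inner product coincide. Density of the
  domain and boundedness finish.\<close>

lemma isometric_group_unique:
  fixes S V :: "real \<Rightarrow> 'a::{real_inner, banach} \<Rightarrow> 'a"
  assumes "isometric_group S" "isometric_group V"
    and gen: "\<And>u v. generates S u v \<longleftrightarrow> generates V u v"
  shows "S t u = V t u"
proof -
  interpret S: isometric_group S by fact
  interpret V: isometric_group V by fact
  have dom: "S t u = V t u" if u: "generates S u v" for u v
  proof -
    have uV: "generates V u v" using u gen by blast
    have "((\<lambda>s. inner (S s u) (V s u)) has_real_derivative 0) (at s)" for s
    proof -
      have "((\<lambda>s. inner (S s u) (V s u)) has_real_derivative inner (S s v) (V s u) + inner (S s u) (V s v)) (at s)"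
        by (rule has_real_derivative_inner[OF S.orbit_DERIV[OF u] V.orbit_DERIV[OF uV]])
      moreover have "inner (S s v) (V s u) + inner (S s u) (V s v) = 0"
        by (rule S.skew[OF S.generates_shift[OF u]]) (use V.generates_shift[OF uV] gen in blast)
      ultimately show ?thesis by simp
    qed
    then have "inner (S t u) (V t u) = inner (S 0 u) (V 0 u)"
      by (intro DERIV_isconst_all) blast
    then have "(norm (S t u - V t u))\<^sup>2 = 0"
      unfolding power2_norm_eq_inner
      by (simp add: inner_diff_left inner_diff_right S.isometric V.isometric inner_commute[of "V t u"])
    then show ?thesis by simp
  qed
  have "u \<in> closure {u. \<exists>v. generates S u v}" using S.dense_domain by simp
  then obtain f where f: "\<And>n. f n \<in> {u. \<exists>v. generates S u v}" "f \<longlonglongrightarrow> u" by (rule closure_seqE) (rule that)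
  have "(\<lambda>n. S t (f n)) \<longlonglongrightarrow> S t u" by (rule bounded_linear.tendsto[OF S.bounded_linear_group f(2)])
  moreover have "(\<lambda>n. V t (f n)) \<longlonglongrightarrow> V t u" by (rule bounded_linear.tendsto[OF V.bounded_linear_group f(2)])
  moreover have "S t (f n) = V t (f n)" for n using dom f(1)[of n] by blast
  ultimately show ?thesis using LIMSEQ_unique by simp
qed

section \<open>The Schroedinger group commutes with weak derivatives\<close>

lemma isometric_group_schroedinger:
  assumes "schroedinger_group S"
  shows "isometric_group S"
proof
  note S = assms[unfolded schroedinger_group_def]
  fix s t r :: real and u v :: "'a l2"
  show "S t (u + v) = S t u + S t v" "inner (S t u) (S t v) = inner u v" "S t (r *\<^sub>R u) = r *\<^sub>R S t u"
    using S by (simp_all add: inner_l2_def scaleR_l2_def)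
  show "S 0 u = u" "S (s + t) u = S s (S t u)" using S by simp_all
  show "continuous_on UNIV (\<lambda>t. S t u)" using S by blast
qed

lemma generates_schroedinger:
  assumes "schroedinger_group S"
  shows "generates S u v \<longleftrightarrow> (\<exists>w. has_weak_laplacian u w \<and> v = cscale (- \<i>) w)"
  using assms unfolding schroedinger_group_def generates_def by blast

lemma schroedinger_translate:
  assumes "schroedinger_group S"
  shows "S t (translate a u) = translate a (S t u)"
proof -
  interpret S: isometric_group S by (rule isometric_group_schroedinger[OF assms])
  define V where "V t u = translate (- a) (S t (translate a u))" for t u
  have V: "isometric_group V"
  proof
    fix s t r :: real and u v :: "'a l2"
    show "V t (u + v) = V t u + V t v" "inner (V t u) (V t v) = inner u v" "V t (r *\<^sub>R u) = r *\<^sub>R V t u"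
      "V 0 u = u" "V (s + t) u = V s (V t u)"
      by (simp_all add: V_def translate_add translate_scaleR S.add S.scaleR inner_translate S.isometric S.plus)
    show "continuous_on UNIV (\<lambda>t. V t u)"
      unfolding V_def by (rule bounded_linear.continuous_on[OF bounded_linear_translate S.continuous])
  qed
  have lap: "has_weak_laplacian (translate a u) (translate a w) \<longleftrightarrow> has_weak_laplacian u w" for a u w
    using has_weak_laplacian_translate[of u w a] has_weak_laplacian_translate[of "translate a u" "translate a w" "- a"]
    by auto
  have gen: "generates S u v \<longleftrightarrow> generates V u v" for u v
  proof -
    have quot: "translate b ((x - y) /\<^sub>R h) = (translate b x - translate b y) /\<^sub>R h" for b x y h
      by (simp add: translate_scaleR linear_diff[OF bounded_linear.linear[OF bounded_linear_translate]])
    have "generates V u v \<longleftrightarrow> generates S (translate a u) (translate a v)"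
    proof
      assume "generates V u v"
      from bounded_linear.tendsto[OF bounded_linear_translate this[unfolded generates_def], of a]
      show "generates S (translate a u) (translate a v)" by (simp add: generates_def quot V_def)
    next
      assume "generates S (translate a u) (translate a v)"
      from bounded_linear.tendsto[OF bounded_linear_translate this[unfolded generates_def], of "- a"]
      show "generates V u v" by (simp add: generates_def quot V_def)
    qed
    also have "\<dots> \<longleftrightarrow> (\<exists>w. has_weak_laplacian (translate a u) w \<and> translate a v = cscale (- \<i>) w)"
      by (rule generates_schroedinger[OF assms])
    also have "\<dots> \<longleftrightarrow> (\<exists>w. has_weak_laplacian u w \<and> v = cscale (- \<i>) w)"
    proof safe
      fix w assume "has_weak_laplacian (translate a u) w" "translate a v = cscale (- \<i>) w"
      then show "\<exists>w. has_weak_laplacian u w \<and> v = cscale (- \<i>) w"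
        using lap[of a u "translate (- a) w"]
        by (intro exI[of _ "translate (- a) w"]) (simp add: translate_cscale[symmetric] flip: \<open>translate a v = _\<close>)
    next
      fix w assume "has_weak_laplacian u w"
      then show "\<exists>w'. has_weak_laplacian (translate a u) w' \<and> translate a (cscale (- \<i>) w) = cscale (- \<i>) w'"
        by (intro exI[of _ "translate a w"]) (simp add: lap translate_cscale)
    qed
    also have "\<dots> \<longleftrightarrow> generates S u v" by (rule generates_schroedinger[OF assms, symmetric])
    finally show ?thesis by (rule sym)
  qed
  have "S t u = translate (- a) (S t (translate a u))" for u
    using isometric_group_unique[OF S.isometric_group_axioms V gen, of t u] by (simp add: V_def)
  then show ?thesis by (metis translate_minus_cancel(2))
qed

lemma schroedinger_dquot:
  assumes "schroedinger_group S"
  shows "S t (dquot i h u) = dquot i h (S t u)"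
proof -
  interpret S: isometric_group S by (rule isometric_group_schroedinger[OF assms])
  show ?thesis by (simp add: dquot_def S.scaleR S.group_diff schroedinger_translate[OF assms])
qed

lemma schroedinger_weak_partial:
  assumes "schroedinger_group S" "has_weak_partial i u g"
  shows "has_weak_partial i (S t u) (S t g)"
proof -
  interpret S: isometric_group S by (rule isometric_group_schroedinger[OF assms(1)])
  show ?thesis
    using bounded_linear.tendsto[OF S.bounded_linear_group dquot_tendsto[OF assms(2)]]
    by (simp add: has_weak_partial_iff_tendsto schroedinger_dquot[OF assms(1)])
qed

section \<open>Expansion in an orthonormal basis\<close>

definition fourier_sum :: "(nat \<Rightarrow> 'a::real_inner) \<Rightarrow> nat \<Rightarrow> 'a \<Rightarrow> 'a" where
  "fourier_sum e n v = (\<Sum>j<n. inner v (e j) *\<^sub>R e j)"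

lemma inner_fourier_sum: "inner (fourier_sum e n u) v = (\<Sum>j<n. inner u (e j) * inner v (e j))"
  by (simp add: fourier_sum_def inner_sum_left inner_commute[of "e _" v])

lemma fourier_sum_add: "fourier_sum e n (u + v) = fourier_sum e n u + fourier_sum e n v"
  by (simp add: fourier_sum_def inner_add_left scaleR_add_left sum.distrib)

lemma fourier_sum_scaleR: "fourier_sum e n (r *\<^sub>R u) = r *\<^sub>R fourier_sum e n u"
  by (simp add: fourier_sum_def scaleR_sum_right)

lemma fourier_sum_diff: "fourier_sum e n (u - v) = fourier_sum e n u - fourier_sum e n v"
  by (simp add: fourier_sum_def inner_diff_left scaleR_diff_left sum_subtractf)

text \<open>Bessel's inequality: the partial sum P is a projection, so |P v|^2 = (P v, v). It
  supplies the dominating functions for every expansion of an increment in the basis.\<close>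

lemma norm_fourier_sum_le:
  assumes "orthonormal_basis e"
  shows "norm (fourier_sum e n v) \<le> norm v"
proof -
  have e: "inner (e j) (e k) = (if j = k then 1 else 0)" for j k
    using assms by (simp add: orthonormal_basis_def)
  have "inner (fourier_sum e n v) (e j) = (if j < n then inner v (e j) else 0)" for j
    by (simp add: fourier_sum_def inner_sum_left e if_distrib cong: if_cong)
  then have "inner (fourier_sum e n v) (fourier_sum e n v) = inner (fourier_sum e n v) v"
    by (simp add: inner_fourier_sum)
  then have "(norm (fourier_sum e n v))\<^sup>2 \<le> norm (fourier_sum e n v) * norm v"
    using norm_cauchy_schwarz[of "fourier_sum e n v" v] by (simp add: power2_norm_eq_inner)
  then show ?thesis
    by (cases "norm (fourier_sum e n v) = 0") (simp_all add: power2_eq_square)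
qed

lemma fourier_sum_tendsto:
  assumes "orthonormal_basis e"
  shows "(\<lambda>n. fourier_sum e n v) \<longlonglongrightarrow> v"
proof (rule LIMSEQ_I)
  fix r :: real assume r: "0 < r"
  have e: "inner (e j) (e k) = (if j = k then 1 else 0)" for j k
    using assms by (simp add: orthonormal_basis_def)
  \<comment> \<open>On the span the partial sums are eventually exact; Bessel's inequality carries
    convergence over to the closure.\<close>
  have fin: "\<exists>N. \<forall>n\<ge>N. fourier_sum e n w = w" if "w \<in> span (range e)" for w
    using that
  proof (induction rule: span_induct_alt)
    case base
    show ?case by (simp add: fourier_sum_def)
  next
    case (step c b y)
    then obtain k N where k: "b = e k" and N: "\<And>n. n \<ge> N \<Longrightarrow> fourier_sum e n y = y" by blast
    have "fourier_sum e n (c *\<^sub>R b + y) = c *\<^sub>R b + y" if "n \<ge> max N (Suc k)" for n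
    proof -
      have "fourier_sum e n b = b"
        using that by (simp add: fourier_sum_def k e if_distrib[of "\<lambda>x. x *\<^sub>R _"] cong: if_cong)
      then show ?thesis using N[of n] that by (simp add: fourier_sum_add fourier_sum_scaleR)
    qed
    then show ?case by blast
  qed
  have "v \<in> closure (span (range e))" using assms by (simp add: orthonormal_basis_def)
  then obtain w where w: "w \<in> span (range e)" "dist w v < r / 2"
    using r unfolding closure_approachable by (meson half_gt_zero)
  obtain N where N: "\<And>n. n \<ge> N \<Longrightarrow> fourier_sum e n w = w" using fin[OF w(1)] by blast
  have "norm (fourier_sum e n v - v) < r" if "n \<ge> N" for n
  proof -
    have "fourier_sum e n v - v = fourier_sum e n (v - w) - (v - w)"
      using N[OF that] by (simp add: fourier_sum_diff)
    then have "norm (fourier_sum e n v - v) = norm (fourier_sum e n (v - w) - (v - w))" by (simp only:)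
    then have "norm (fourier_sum e n v - v) \<le> norm (v - w) + norm (v - w)"
      using norm_triangle_ineq4[of "fourier_sum e n (v - w)" "v - w"] norm_fourier_sum_le[OF assms, of n "v - w"]
      by linarith
    then show ?thesis using w(2) by (simp add: dist_norm norm_minus_commute)
  qed
  then show "\<exists>N. \<forall>n\<ge>N. norm (fourier_sum e n v - v) < r" by blast
qed

lemma parseval_sums:
  assumes "orthonormal_basis e"
  shows "(\<lambda>j. inner u (e j) * inner v (e j)) sums inner u v"
  unfolding sums_def using tendsto_inner[OF fourier_sum_tendsto[OF assms, of u] tendsto_const[of v]]
  by (simp add: inner_fourier_sum)

section \<open>Bounded bilinear forms and their quadratic forms\<close>

lemma bounded_bilinear_le:
  fixes B :: "'a::real_normed_vector \<Rightarrow> 'b::real_normed_vector \<Rightarrow> 'c::real_normed_vector"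
  assumes "bounded_bilinear B"
  obtains K where "0 < K" "\<And>a b. norm (B a b) \<le> norm a * norm b * K"
  using bounded_bilinear.pos_bounded[OF assms] by blast

lemma continuous_on_bounded_bilinear:
  assumes "bounded_bilinear B"
  shows "continuous_on UNIV (\<lambda>p. B (fst p) (snd p))"
  by (intro bounded_bilinear.continuous_on[OF assms] continuous_intros)

lemma borel_measurable_bounded_bilinear:
  fixes B :: "'a::{second_countable_topology, real_normed_vector} \<Rightarrow> 'b::{second_countable_topology, real_normed_vector} \<Rightarrow> 'c::real_normed_vector"
  assumes B: "bounded_bilinear B" and f: "f \<in> borel_measurable M" and g: "g \<in> borel_measurable M"
  shows "(\<lambda>x. B (f x) (g x)) \<in> borel_measurable M"
  using borel_measurable_continuous_Pair[OF f g continuous_on_bounded_bilinear[OF B]] by simp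

lemma borel_measurable_bounded_linear:
  assumes "bounded_linear L" "f \<in> borel_measurable M"
  shows "(\<lambda>x. L (f x)) \<in> borel_measurable M"
  by (rule borel_measurable_continuous_on[OF linear_continuous_on[OF assms(1)] assms(2)])

lemma summable_bounded_bilinear:
  fixes B :: "'a::real_normed_vector \<Rightarrow> 'a \<Rightarrow> real"
  assumes B: "bounded_bilinear B" and a: "summable (\<lambda>j. (norm (a j))\<^sup>2)"
  shows "summable (\<lambda>j. B (a j) (a j))"
proof -
  obtain K where K: "0 < K" "\<And>a b. norm (B a b) \<le> norm a * norm b * K" using bounded_bilinear_le[OF B] by blast
  show ?thesis
  proof (rule summable_comparison_test)
    show "\<exists>N. \<forall>n\<ge>N. norm (B (a n) (a n)) \<le> (norm (a n))\<^sup>2 * K"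
      using K(2) by (auto simp: power2_eq_square)
    show "summable (\<lambda>j. (norm (a j))\<^sup>2 * K)" using a by (rule summable_mult2)
  qed
qed

lemma summable_bounded_linear_norm2:
  assumes L: "bounded_linear L" and a: "summable (\<lambda>j. (norm (a j))\<^sup>2)"
  shows "summable (\<lambda>j. (norm (L (a j)))\<^sup>2)"
proof -
  obtain K where K: "\<And>x. norm (L x) \<le> norm x * K" using bounded_linear.bounded[OF L] by blast
  show ?thesis
  proof (rule summable_comparison_test)
    have "norm ((norm (L (a n)))\<^sup>2) \<le> (norm (a n))\<^sup>2 * K\<^sup>2" for n
      using power_mono[OF K[of "a n"] norm_ge_zero, of 2] by (simp add: power_mult_distrib)
    then show "\<exists>N. \<forall>n\<ge>N. norm ((norm (L (a n)))\<^sup>2) \<le> (norm (a n))\<^sup>2 * K\<^sup>2" by blast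
    show "summable (\<lambda>j. (norm (a j))\<^sup>2 * K\<^sup>2)" using a by (rule summable_mult2)
  qed
qed

text \<open>Expansion around \<open>b\<close> followed by 2xy \<le> x^2/\<epsilon> + \<epsilon> y^2.
  The bound contains squares only, so it can be summed or integrated term by term, and \<epsilon>
  stays free until after that.\<close>

lemma bounded_bilinear_quadratic_diff:
  fixes B :: "'a::real_normed_vector \<Rightarrow> 'a \<Rightarrow> real"
  assumes B: "bounded_bilinear B" and K: "0 < K" "\<And>a b. norm (B a b) \<le> norm a * norm b * K" and \<epsilon>: "0 < \<epsilon>"
  shows "\<bar>B a a - B b b\<bar> \<le> K * ((1 + 1 / \<epsilon>) * (norm (a - b))\<^sup>2 + \<epsilon> * (norm b)\<^sup>2)"
proof -
  let ?d = "norm (a - b)" and ?b = "norm b"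
  have "B a a - B b b = B (a - b) (a - b) + B (a - b) b + B b (a - b)"
    by (simp add: bounded_bilinear.diff_left[OF B] bounded_bilinear.diff_right[OF B])
  then have "\<bar>B a a - B b b\<bar> \<le> \<bar>B (a - b) (a - b)\<bar> + \<bar>B (a - b) b\<bar> + \<bar>B b (a - b)\<bar>" by linarith
  also have "\<dots> \<le> ?d * ?d * K + ?d * ?b * K + ?b * ?d * K"
    using K(2) by (intro add_mono) auto
  also have "\<dots> = K * (?d\<^sup>2 + 2 * (?d * ?b))" by (simp add: power2_eq_square algebra_simps)
  also have "\<dots> \<le> K * (?d\<^sup>2 + (?d\<^sup>2 / \<epsilon> + \<epsilon> * ?b\<^sup>2))"
  proof -
    have "0 \<le> (?d - \<epsilon> * ?b)\<^sup>2 / \<epsilon>" using \<epsilon> by simp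
    also have "\<dots> = ?d\<^sup>2 / \<epsilon> + \<epsilon> * ?b\<^sup>2 - 2 * (?d * ?b)"
      using \<epsilon> by (simp add: power2_eq_square field_simps)
    finally show ?thesis using K(1) by simp
  qed
  finally show ?thesis by (simp add: algebra_simps)
qed

text \<open>The companion of the preceding estimates: for fixed \<epsilon> the first term vanishes
  as \<open>n\<close> grows, and the second is as small as desired.\<close>

lemma tendsto_0_of_epsilon_bound:
  fixes x :: "nat \<Rightarrow> real" and d :: "nat \<Rightarrow> ennreal"
  assumes d: "d \<longlonglongrightarrow> 0" and "0 \<le> A" "0 \<le> C"
    and bound: "\<And>\<epsilon> n. 0 < \<epsilon> \<Longrightarrow> ennreal \<bar>x n\<bar> \<le> ennreal (A * (1 + 1 / \<epsilon>)) * d n + ennreal (C * \<epsilon>)"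
  shows "x \<longlonglongrightarrow> 0"
proof (rule LIMSEQ_I)
  fix r :: real assume r: "0 < r"
  \<comment> \<open>This gives C \<epsilon> \<le> r/2, also when \<open>C\<close> is zero.\<close>
  define \<epsilon> where "\<epsilon> = r / (2 * (C + 1))"
  have \<epsilon>: "0 < \<epsilon>" and C\<epsilon>: "C * \<epsilon> < r"
    using r \<open>0 \<le> C\<close> by (auto simp: \<epsilon>_def field_simps add_pos_nonneg) (smt (verit) mult_nonneg_nonneg)
  have "(\<lambda>n. ennreal (A * (1 + 1 / \<epsilon>)) * d n + ennreal (C * \<epsilon>)) \<longlonglongrightarrow> ennreal (A * (1 + 1 / \<epsilon>)) * 0 + ennreal (C * \<epsilon>)"
    by (intro tendsto_add tendsto_const ennreal_tendsto_cmult d) simp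
  moreover have "ennreal (A * (1 + 1 / \<epsilon>)) * 0 + ennreal (C * \<epsilon>) < ennreal r"
    using C\<epsilon> r by (simp add: ennreal_lessI)
  ultimately have "eventually (\<lambda>n. ennreal (A * (1 + 1 / \<epsilon>)) * d n + ennreal (C * \<epsilon>) < ennreal r) sequentially"
    by (rule order_tendstoD(2))
  then have "eventually (\<lambda>n. norm (x n - 0) < r) sequentially"
  proof eventually_elim
    case (elim n)
    then have "ennreal \<bar>x n\<bar> < ennreal r" using bound[OF \<epsilon>, of n] by (rule le_less_trans[rotated])
    then show ?case by (simp add: ennreal_less_iff)
  qed
  then show "\<exists>N. \<forall>n\<ge>N. norm (x n - 0) < r" by (simp add: eventually_sequentially)
qed

section \<open>The Wiener process\<close>

lemma (in prob_space) integrable_of_square: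
  fixes f :: "'a \<Rightarrow> 'b::{banach, second_countable_topology}"
  assumes "f \<in> borel_measurable M" "integrable M (\<lambda>x. (norm (f x))\<^sup>2)"
  shows "integrable M f"
proof (rule Bochner_Integration.integrable_bound)
  show "integrable M (\<lambda>x. 1 + (norm (f x))\<^sup>2)" using assms(2) by simp
  have "norm (f x) \<le> norm (1 + (norm (f x))\<^sup>2)" for x
    using zero_le_power2[of "norm (f x) - 1"] by (simp add: power2_diff)
      (smt (verit) norm_ge_zero)
  then show "AE x in M. norm (f x) \<le> norm (1 + (norm (f x))\<^sup>2)" by simp
qed fact

lemma integrable_norm_mult:
  fixes f :: "'a \<Rightarrow> 'b::{real_normed_vector, second_countable_topology}" and g :: "'a \<Rightarrow> 'c::{real_normed_vector, second_countable_topology}"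
  assumes [measurable]: "f \<in> borel_measurable M" "g \<in> borel_measurable M"
    and int: "integrable M (\<lambda>x. (norm (f x))\<^sup>2)" "integrable M (\<lambda>x. (norm (g x))\<^sup>2)"
  shows "integrable M (\<lambda>x. norm (f x) * norm (g x))"
proof (rule Bochner_Integration.integrable_bound)
  show "integrable M (\<lambda>x. (norm (f x))\<^sup>2 + (norm (g x))\<^sup>2)" using int by simp
  have "norm (norm (f x) * norm (g x)) \<le> norm ((norm (f x))\<^sup>2 + (norm (g x))\<^sup>2)" for x
  proof -
    have "norm (f x) * norm (g x) \<le> (norm (f x))\<^sup>2 + (norm (g x))\<^sup>2"
      using sum_squares_bound[of "norm (f x)" "norm (g x)"]
        mult_nonneg_nonneg[OF norm_ge_zero[of "f x"] norm_ge_zero[of "g x"]] by linarith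
    then show ?thesis by (simp add: abs_mult)
  qed
  then show "AE x in M. norm (norm (f x) * norm (g x)) \<le> norm ((norm (f x))\<^sup>2 + (norm (g x))\<^sup>2)" by simp
qed measurable

lemma norm2_diff_le:
  fixes x y :: "'a::real_normed_vector"
  shows "(norm (x - y))\<^sup>2 \<le> 2 * (norm (x - d))\<^sup>2 + 2 * (norm (y - d))\<^sup>2"
proof -
  have "(norm (x - y))\<^sup>2 \<le> (norm (x - d) + norm (y - d))\<^sup>2"
    using norm_triangle_ineq4[of "x - d" "y - d"] by (intro power_mono) auto
  also have "\<dots> \<le> 2 * (norm (x - d))\<^sup>2 + 2 * (norm (y - d))\<^sup>2"
    using sum_squares_bound[of "norm (x - d)" "norm (y - d)"] by (simp add: power2_sum)
  finally show ?thesis .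
qed

lemma integrable_norm2_diff:
  fixes f g :: "'a \<Rightarrow> 'b::{real_normed_vector, second_countable_topology}"
  assumes [measurable]: "f \<in> borel_measurable M" "g \<in> borel_measurable M"
    and int: "integrable M (\<lambda>x. (norm (f x))\<^sup>2)" "integrable M (\<lambda>x. (norm (g x))\<^sup>2)"
  shows "integrable M (\<lambda>x. (norm (f x - g x))\<^sup>2)"
proof (rule Bochner_Integration.integrable_bound)
  show "integrable M (\<lambda>x. 2 * (norm (f x))\<^sup>2 + 2 * (norm (g x))\<^sup>2)" using int by simp
  have "norm ((norm (f x - g x))\<^sup>2) \<le> norm (2 * (norm (f x))\<^sup>2 + 2 * (norm (g x))\<^sup>2)" for x
    using norm2_diff_le[of "f x" "g x" 0] by simp
  then show "AE x in M. norm ((norm (f x - g x))\<^sup>2) \<le> norm (2 * (norm (f x))\<^sup>2 + 2 * (norm (g x))\<^sup>2)" by simp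
qed measurable

lemma (in prob_space) centred_normal_moments:
  assumes X: "centred_normal M X v" and v: "0 \<le> v"
  shows "expectation X = 0" "expectation (\<lambda>\<omega>. (X \<omega>)\<^sup>2) = v"
proof -
  have "expectation X = 0 \<and> expectation (\<lambda>\<omega>. (X \<omega>)\<^sup>2) = v"
  proof (cases "v = 0")
    case True
    then have [measurable]: "X \<in> borel_measurable M" and "AE \<omega> in M. X \<omega> = 0"
      using X by (auto simp: centred_normal_def)
    then have "expectation X = expectation (\<lambda>\<omega>. 0)" "expectation (\<lambda>\<omega>. (X \<omega>)\<^sup>2) = expectation (\<lambda>\<omega>. 0)"
      by (intro integral_cong_AE; auto)+
    then show ?thesis using True by simp
  next
    case False
    then have D: "distributed M lborel X (normal_density 0 (sqrt v))" and pos: "0 < sqrt v"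
      using X v by (auto simp: centred_normal_def)
    have "expectation X = 0" by (rule normal_distributed_expectation[OF pos D])
    then show ?thesis using normal_distributed_variance[OF pos D] v by simp
  qed
  then show "expectation X = 0" "expectation (\<lambda>\<omega>. (X \<omega>)\<^sup>2) = v" by auto
qed

text \<open>\<open>R_summable\<close> says that the square root of the covariance is
  Hilbert-Schmidt, so that the trace series below converge absolutely for every bounded bilinear
  form.\<close>

locale wiener_process = normal_filtration M F for M :: "'w measure" and F +
  fixes e :: "nat \<Rightarrow> 'h::{real_inner, banach, second_countable_topology}"
    and Q R :: "'h \<Rightarrow> 'h" and W :: "real \<Rightarrow> 'w \<Rightarrow> 'h"
  assumes onb: "orthonormal_basis e"
    and Q: "nonneg_selfadjoint Q" and R: "is_sqrt_operator Q R"
    and W: "Q_wiener_process M F Q W"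
    and R_summable: "summable (\<lambda>j. (norm (R (e j)))\<^sup>2)"
begin

definition increment :: "real \<Rightarrow> real \<Rightarrow> 'w \<Rightarrow> 'h" where
  "increment s t \<omega> = W t \<omega> - W s \<omega>"

lemma measurable_filtration: "0 \<le> t \<Longrightarrow> f \<in> measurable (F t) N \<Longrightarrow> f \<in> measurable M N"
  using measurable_from_subalg subalgebra_M by blast

lemma measurable_filtration_mono:
  assumes "0 \<le> s" "s \<le> t" "f \<in> measurable (F s) N"
  shows "f \<in> measurable (F t) N"
proof (rule measurable_from_subalg[OF _ assms(3)])
  show "subalgebra (F t) (F s)"
    using subalgebra_M[of s] subalgebra_M[of t] increasing[OF assms(1,2)] assms(1,2)
    by (simp add: subalgebra_def)
qed

lemma increment_measurable:
  assumes "0 \<le> s" "s \<le> t"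
  shows "increment s t \<in> borel_measurable (F t)"
proof -
  have "W t \<in> borel_measurable (F t)" "W s \<in> borel_measurable (F s)"
    using W assms unfolding Q_wiener_process_def by auto
  then show ?thesis
    unfolding increment_def using measurable_filtration_mono[OF assms] by (intro borel_measurable_diff) auto
qed

lemma increment_measurable_M: "0 \<le> s \<Longrightarrow> s \<le> t \<Longrightarrow> increment s t \<in> borel_measurable M"
  by (rule measurable_filtration[of t]) (auto intro: increment_measurable)

lemma increment_square_integrable:
  assumes "0 \<le> s" "s \<le> t"
  shows "integrable M (\<lambda>\<omega>. (norm (increment s t \<omega>))\<^sup>2)"
  unfolding increment_def
proof (rule integrable_norm2_diff)
  have 0: "0 \<le> t" using assms by simp
  then have Wm: "W t \<in> borel_measurable (F t)" "W s \<in> borel_measurable (F s)"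
    using W assms(1) unfolding Q_wiener_process_def by blast+
  show "W t \<in> borel_measurable M" by (rule measurable_filtration[OF 0 Wm(1)])
  show "W s \<in> borel_measurable M" by (rule measurable_filtration[OF assms(1) Wm(2)])
qed (use W assms in \<open>auto simp: Q_wiener_process_def\<close>)

lemma increment_integrable: "0 \<le> s \<Longrightarrow> s \<le> t \<Longrightarrow> integrable M (increment s t)"
  by (rule integrable_of_square[OF increment_measurable_M increment_square_integrable])

lemma increment_moments:
  assumes st: "0 \<le> s" "s \<le> t"
  shows "expectation (\<lambda>\<omega>. inner (increment s t \<omega>) h) = 0"
    "expectation (\<lambda>\<omega>. (inner (increment s t \<omega>) h)\<^sup>2) = (t - s) * inner (Q h) h"
proof -
  have "centred_normal M (\<lambda>\<omega>. inner (increment s t \<omega>) h) ((t - s) * inner (Q h) h)"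
    unfolding increment_def using W st by (simp add: Q_wiener_process_def)
  moreover have "0 \<le> inner (Q h) h" using Q unfolding nonneg_selfadjoint_def by blast
  then have "0 \<le> (t - s) * inner (Q h) h" using st by simp
  ultimately show "expectation (\<lambda>\<omega>. inner (increment s t \<omega>) h) = 0"
    "expectation (\<lambda>\<omega>. (inner (increment s t \<omega>) h)\<^sup>2) = (t - s) * inner (Q h) h"
    by (rule centred_normal_moments)+
qed

lemma increment_inner_integrable:
  assumes st: "0 \<le> s" "s \<le> t"
  shows "integrable M (\<lambda>\<omega>. inner (increment s t \<omega>) a * inner (increment s t \<omega>) b)"
proof (rule Bochner_Integration.integrable_bound)
  have [measurable]: "increment s t \<in> borel_measurable M" by (rule increment_measurable_M[OF st])
  show "integrable M (\<lambda>\<omega>. (norm (increment s t \<omega>))\<^sup>2 * (norm a * norm b))"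
    using increment_square_integrable[OF st] by simp
  show "(\<lambda>\<omega>. inner (increment s t \<omega>) a * inner (increment s t \<omega>) b) \<in> borel_measurable M" by measurable
  have "norm (inner x a * inner x b) \<le> norm ((norm x)\<^sup>2 * (norm a * norm b))" for x :: 'h
  proof -
    have "\<bar>inner x a\<bar> * \<bar>inner x b\<bar> \<le> (norm x * norm a) * (norm x * norm b)"
      by (intro mult_mono Cauchy_Schwarz_ineq2) auto
    then show ?thesis by (simp add: abs_mult power2_eq_square mult_ac)
  qed
  then show "AE \<omega> in M. norm (inner (increment s t \<omega>) a * inner (increment s t \<omega>) b)
      \<le> norm ((norm (increment s t \<omega>))\<^sup>2 * (norm a * norm b))" by simp
qed

text \<open>Polarisation of the variances given by the normal law. Splitting \<open>Q\<close> as
  \<open>R\<close> after \<open>R\<close> and using symmetry makes the covariance an inner product,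
  ready for Parseval's identity.\<close>

lemma increment_covariance:
  assumes st: "0 \<le> s" "s \<le> t"
  shows "expectation (\<lambda>\<omega>. inner (increment s t \<omega>) a * inner (increment s t \<omega>) b) = (t - s) * inner (R a) (R b)"
proof -
  have Rs: "inner (R u) v = inner u (R v)" "R (R u) = Q u" for u v
    using R by (simp_all add: is_sqrt_operator_def nonneg_selfadjoint_def)
  have Qs: "inner (Q u) v = inner u (Q v)" for u v
    using Q by (simp add: nonneg_selfadjoint_def)
  have Qadd: "Q (a + b) = Q a + Q b"
    using Q by (simp add: nonneg_selfadjoint_def linear_add bounded_linear.linear)
  let ?x = "\<lambda>\<omega>. inner (increment s t \<omega>)"
  have int: "integrable M (\<lambda>\<omega>. (?x \<omega> h)\<^sup>2)" for h
    using increment_inner_integrable[OF st, of h h] by (simp add: power2_eq_square)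
  have "expectation (\<lambda>\<omega>. ?x \<omega> a * ?x \<omega> b)
      = expectation (\<lambda>\<omega>. ((?x \<omega> (a + b))\<^sup>2 - (?x \<omega> a)\<^sup>2 - (?x \<omega> b)\<^sup>2) / 2)"
    by (intro Bochner_Integration.integral_cong) (auto simp: inner_add_right power2_eq_square algebra_simps)
  also have "\<dots> = (expectation (\<lambda>\<omega>. (?x \<omega> (a + b))\<^sup>2) - expectation (\<lambda>\<omega>. (?x \<omega> a)\<^sup>2) - expectation (\<lambda>\<omega>. (?x \<omega> b)\<^sup>2)) / 2"
    using int by (simp del: inner_add_right)
  also have "\<dots> = (t - s) * (inner (Q (a + b)) (a + b) - inner (Q a) a - inner (Q b) b) / 2"
    unfolding increment_moments[OF st] by (simp add: right_diff_distrib del: inner_add_right)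
  also have "\<dots> = (t - s) * inner (Q a) b"
    by (simp add: Qadd inner_add_left inner_add_right Qs[of b a] inner_commute[of b "Q a"])
  also have "inner (Q a) b = inner (R a) (R b)" by (simp add: Rs(1) flip: Rs(2))
  finally show ?thesis .
qed

lemma indep_increment:
  assumes st: "0 \<le> s" "s \<le> t" and X: "X \<in> measurable (F s) N" and g: "g \<in> measurable borel N'"
  shows "indep_var N X N' (\<lambda>\<omega>. g (increment s t \<omega>))"
  unfolding indep_var_eq
proof (intro conjI)
  have space: "space (F s) = space M" using subalgebra_M[OF st(1)] by (simp add: subalgebra_def)
  show "random_variable N X" by (rule measurable_filtration[OF st(1) X])
  show "random_variable N' (\<lambda>\<omega>. g (increment s t \<omega>))"
    by (rule measurable_compose[OF increment_measurable_M[OF st] g])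
  let ?V = "vimage_algebra (space M) (increment s t) borel"
  have ind: "indep_set (sets (F s)) (sets ?V)"
    using W st unfolding Q_wiener_process_def increment_def by blast
  have "sigma_sets (space M) {X -` A \<inter> space M |A. A \<in> sets N} \<subseteq> sets (F s)"
    using sets.sigma_sets_subset[of "{X -` A \<inter> space M |A. A \<in> sets N}" "F s"] measurable_sets[OF X]
    by (auto simp: space)
  moreover have "sigma_sets (space M) {(\<lambda>\<omega>. g (increment s t \<omega>)) -` A \<inter> space M |A. A \<in> sets N'} \<subseteq> sets ?V"
  proof -
    have "(\<lambda>\<omega>. g (increment s t \<omega>)) -` A \<inter> space M \<in> sets ?V" if "A \<in> sets N'" for A
    proof -
      have "(\<lambda>\<omega>. g (increment s t \<omega>)) -` A \<inter> space M = increment s t -` (g -` A \<inter> space borel) \<inter> space M" by auto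
      then show ?thesis using in_vimage_algebra[OF measurable_sets[OF g that], of "increment s t" "space M"] by simp
    qed
    then show ?thesis
      using sets.sigma_sets_subset[of "{(\<lambda>\<omega>. g (increment s t \<omega>)) -` A \<inter> space M |A. A \<in> sets N'}" ?V] by auto
  qed
  ultimately show "indep_set (sigma_sets (space M) {X -` A \<inter> space M |A. A \<in> sets N})
     (sigma_sets (space M) {(\<lambda>\<omega>. g (increment s t \<omega>)) -` A \<inter> space M |A. A \<in> sets N'})"
    using ind unfolding indep_set_def
    by (elim indep_sets_mono_sets) (auto split: bool.split)
qed

text \<open>Expanding the increment in the basis reduces this to real random variables.\<close>

lemma expectation_bilinear_increment:
  fixes B :: "'b::{real_normed_vector, second_countable_topology} \<Rightarrow> 'h \<Rightarrow> real"
  assumes st: "0 \<le> s" "s \<le> t" and B: "bounded_bilinear B"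
    and X: "X \<in> borel_measurable (F s)" "integrable M (\<lambda>\<omega>. norm (X \<omega>))"
  shows "integrable M (\<lambda>\<omega>. B (X \<omega>) (increment s t \<omega>))"
    "expectation (\<lambda>\<omega>. B (X \<omega>) (increment s t \<omega>)) = 0"
proof -
  obtain K where K: "0 < K" "\<And>a b. norm (B a b) \<le> norm a * norm b * K" using bounded_bilinear_le[OF B] by blast
  have [measurable]: "X \<in> borel_measurable M" "increment s t \<in> borel_measurable M"
    using measurable_filtration[OF st(1) X(1)] increment_measurable_M[OF st] by auto
  have B_meas: "(\<lambda>\<omega>. B (X \<omega>) (g \<omega>)) \<in> borel_measurable M" if "g \<in> borel_measurable M" for g
    by (rule borel_measurable_bounded_bilinear[OF B _ that]) measurable
  \<comment> \<open>Independence makes the product of the norms integrable from first moments alone,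
    so no second moment of \<open>X\<close> is involved.\<close>
  have "indep_var borel (\<lambda>\<omega>. norm (X \<omega>)) borel (\<lambda>\<omega>. norm (increment s t \<omega>))"
    by (rule indep_increment[OF st]) (use X(1) in measurable)
  then have "integrable M (\<lambda>\<omega>. norm (X \<omega>) * norm (increment s t \<omega>))"
    using X(2) increment_integrable[OF st] by (intro indep_var_integrable) auto
  then have dom: "integrable M (\<lambda>\<omega>. norm (X \<omega>) * norm (increment s t \<omega>) * K)" by simp
  show "integrable M (\<lambda>\<omega>. B (X \<omega>) (increment s t \<omega>))"
  proof (rule Bochner_Integration.integrable_bound[OF dom B_meas])
    show "AE \<omega> in M. norm (B (X \<omega>) (increment s t \<omega>)) \<le> norm (norm (X \<omega>) * norm (increment s t \<omega>) * K)"
      using K by (intro AE_I2) (auto simp: abs_mult)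
  qed measurable
  let ?P = "\<lambda>n \<omega>. B (X \<omega>) (fourier_sum e n (increment s t \<omega>))"
  have fs_meas: "(\<lambda>\<omega>. fourier_sum e n (increment s t \<omega>)) \<in> borel_measurable M" for n
    unfolding fourier_sum_def by measurable
  have "(\<lambda>n. expectation (?P n)) \<longlonglongrightarrow> expectation (\<lambda>\<omega>. B (X \<omega>) (increment s t \<omega>))"
  proof (rule integral_dominated_convergence[OF _ _ dom])
    show "AE \<omega> in M. (\<lambda>n. ?P n \<omega>) \<longlonglongrightarrow> B (X \<omega>) (increment s t \<omega>)"
      by (intro AE_I2 bounded_bilinear.tendsto[OF B] tendsto_const fourier_sum_tendsto[OF onb])
    have "norm (?P n \<omega>) \<le> norm (X \<omega>) * norm (increment s t \<omega>) * K" for n \<omega>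
    proof -
      have "norm (X \<omega>) * norm (fourier_sum e n (increment s t \<omega>)) * K \<le> norm (X \<omega>) * norm (increment s t \<omega>) * K"
        using K(1) norm_fourier_sum_le[OF onb] by (intro mult_right_mono mult_left_mono) auto
      then show ?thesis using K(2)[of "X \<omega>" "fourier_sum e n (increment s t \<omega>)"] by linarith
    qed
    then show "AE \<omega> in M. norm (?P n \<omega>) \<le> norm (X \<omega>) * norm (increment s t \<omega>) * K" for n by simp
  qed (use B_meas fs_meas in auto)
  moreover have "expectation (?P n) = 0" for n
  proof -
    have ind: "indep_var borel (\<lambda>\<omega>. B (X \<omega>) (e j)) borel (\<lambda>\<omega>. inner (increment s t \<omega>) (e j))" for j
      by (rule indep_increment[OF st]) (auto intro!: borel_measurable_bounded_linear[OF bounded_bilinear.bounded_linear_left[OF B] X(1)])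
    have int: "integrable M (\<lambda>\<omega>. B (X \<omega>) (e j))" for j
    proof (rule Bochner_Integration.integrable_bound)
      show "integrable M (\<lambda>\<omega>. norm (X \<omega>) * (norm (e j) * K))" using X(2) by simp
      show "AE \<omega> in M. norm (B (X \<omega>) (e j)) \<le> norm (norm (X \<omega>) * (norm (e j) * K))"
        using K by (intro AE_I2) (auto simp: abs_mult mult.assoc)
    qed (rule B_meas, simp)
    have int2: "integrable M (\<lambda>\<omega>. inner (increment s t \<omega>) (e j))" for j
      using increment_integrable[OF st] by simp
    have "expectation (?P n) = expectation (\<lambda>\<omega>. \<Sum>j<n. B (X \<omega>) (e j) * inner (increment s t \<omega>) (e j))"
      unfolding fourier_sum_def
      by (intro Bochner_Integration.integral_cong)
        (auto simp: bounded_bilinear.sum_right[OF B] bounded_bilinear.scaleR_right[OF B] mult.commute)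
    also have "\<dots> = (\<Sum>j<n. expectation (\<lambda>\<omega>. B (X \<omega>) (e j) * inner (increment s t \<omega>) (e j)))"
      by (intro Bochner_Integration.integral_sum indep_var_integrable[OF ind int int2])
    also have "\<dots> = 0"
      by (simp add: indep_var_lebesgue_integral[OF ind int int2] increment_moments[OF st])
    finally show ?thesis .
  qed
  ultimately show "expectation (\<lambda>\<omega>. B (X \<omega>) (increment s t \<omega>)) = 0"
    by (simp add: LIMSEQ_const_iff)
qed

end

section \<open>The Ito isometry for bounded bilinear forms\<close>

lemma bounded_bilinear_sum_sum:
  assumes "bounded_bilinear B"
  shows "B (\<Sum>j\<in>I. f j) (\<Sum>k\<in>J. g k) = (\<Sum>j\<in>I. \<Sum>k\<in>J. B (f j) (g k))"
  by (subst bounded_bilinear.sum_left[OF assms]) (simp add: bounded_bilinear.sum_right[OF assms])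

lemma bounded_bilinear_fourier_sum:
  fixes B :: "'a::real_inner \<Rightarrow> 'a \<Rightarrow> real"
  assumes "bounded_bilinear B"
  shows "B (fourier_sum e n v) (fourier_sum e n v) = (\<Sum>j<n. \<Sum>k<n. (inner v (e j) * inner v (e k)) * B (e j) (e k))"
  unfolding fourier_sum_def bounded_bilinear_sum_sum[OF assms]
  by (simp add: bounded_bilinear.scaleR_left[OF assms] bounded_bilinear.scaleR_right[OF assms] mult_ac)

context wiener_process
begin

lemma R_symmetric: "inner (R u) v = inner (R v) u"
  using R unfolding is_sqrt_operator_def nonneg_selfadjoint_def by (metis inner_commute)

text \<open>For the truncated expansion both sides are finite double sums over the matrix of
  \<open>B\<close>, matched by the covariance formula. The truncation is then removed on both sides
  by dominated convergence.\<close>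

lemma expectation_quadratic_increment:
  fixes B :: "'h \<Rightarrow> 'h \<Rightarrow> real"
  assumes st: "0 \<le> s" "s \<le> t" and B: "bounded_bilinear B"
  shows "integrable M (\<lambda>\<omega>. B (increment s t \<omega>) (increment s t \<omega>))"
    "expectation (\<lambda>\<omega>. B (increment s t \<omega>) (increment s t \<omega>)) = (t - s) * (\<Sum>l. B (R (e l)) (R (e l)))"
proof -
  obtain K where K: "0 < K" "\<And>a b. norm (B a b) \<le> norm a * norm b * K" using bounded_bilinear_le[OF B] by blast
  have [measurable]: "increment s t \<in> borel_measurable M" by (rule increment_measurable_M[OF st])
  have fs_meas: "(\<lambda>\<omega>. fourier_sum e n (increment s t \<omega>)) \<in> borel_measurable M" for n
    unfolding fourier_sum_def by measurable
  have dom: "integrable M (\<lambda>\<omega>. (norm (increment s t \<omega>))\<^sup>2 * K)"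
    using increment_square_integrable[OF st] by simp
  show "integrable M (\<lambda>\<omega>. B (increment s t \<omega>) (increment s t \<omega>))"
  proof (rule Bochner_Integration.integrable_bound[OF dom])
    show "(\<lambda>\<omega>. B (increment s t \<omega>) (increment s t \<omega>)) \<in> borel_measurable M"
      by (rule borel_measurable_bounded_bilinear[OF B]) measurable
    show "AE \<omega> in M. norm (B (increment s t \<omega>) (increment s t \<omega>)) \<le> norm ((norm (increment s t \<omega>))\<^sup>2 * K)"
      using K by (intro AE_I2) (auto simp: abs_mult power2_eq_square)
  qed
  let ?P = "\<lambda>n v. B (fourier_sum e n v) (fourier_sum e n v)"
  have P_le: "norm (?P n v) \<le> (norm v)\<^sup>2 * K" for n v
  proof -
    have "norm (fourier_sum e n v) * norm (fourier_sum e n v) * K \<le> norm v * norm v * K"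
      using K(1) norm_fourier_sum_le[OF onb] by (intro mult_right_mono mult_mono) auto
    then show ?thesis using K(2)[of "fourier_sum e n v" "fourier_sum e n v"] by (simp add: power2_eq_square)
  qed
  have P_lim: "(\<lambda>n. ?P n v) \<longlonglongrightarrow> B v v" for v
    by (intro bounded_bilinear.tendsto[OF B] fourier_sum_tendsto[OF onb])
  have lim1: "(\<lambda>n. expectation (\<lambda>\<omega>. ?P n (increment s t \<omega>))) \<longlonglongrightarrow> expectation (\<lambda>\<omega>. B (increment s t \<omega>) (increment s t \<omega>))"
  proof (rule integral_dominated_convergence[OF _ _ dom])
    show "AE \<omega> in M. (\<lambda>n. ?P n (increment s t \<omega>)) \<longlonglongrightarrow> B (increment s t \<omega>) (increment s t \<omega>)"
      using P_lim by (intro AE_I2)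
    show "AE \<omega> in M. norm (?P n (increment s t \<omega>)) \<le> (norm (increment s t \<omega>))\<^sup>2 * K" for n
      using P_le by (intro AE_I2)
    show "(\<lambda>\<omega>. ?P n (increment s t \<omega>)) \<in> borel_measurable M" for n
      by (rule borel_measurable_bounded_bilinear[OF B fs_meas fs_meas])
    show "(\<lambda>\<omega>. B (increment s t \<omega>) (increment s t \<omega>)) \<in> borel_measurable M"
      by (rule borel_measurable_bounded_bilinear[OF B]) measurable
  qed
  have "expectation (\<lambda>\<omega>. ?P n (increment s t \<omega>)) = (t - s) * (\<Sum>l. ?P n (R (e l)))" for n
  proof -
    have "expectation (\<lambda>\<omega>. ?P n (increment s t \<omega>))
      = (\<Sum>j<n. \<Sum>k<n. expectation (\<lambda>\<omega>. (inner (increment s t \<omega>) (e j) * inner (increment s t \<omega>) (e k)) * B (e j) (e k)))"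
      unfolding bounded_bilinear_fourier_sum[OF B]
      by (subst Bochner_Integration.integral_sum; simp add: increment_inner_integrable[OF st])+
    also have "\<dots> = (t - s) * (\<Sum>j<n. \<Sum>k<n. inner (R (e j)) (R (e k)) * B (e j) (e k))"
      by (simp add: increment_covariance[OF st]) (simp add: sum_distrib_left mult.assoc)
    \<comment> \<open>Parseval's identity in \<open>l\<close>, with the symmetry of \<open>R\<close>
      shifting it between the two slots: the covariance matrix turns into a sum over the vectors
      \<open>R (e l)\<close>.\<close>
    also have "(\<Sum>j<n. \<Sum>k<n. inner (R (e j)) (R (e k)) * B (e j) (e k)) = (\<Sum>l. ?P n (R (e l)))"
    proof (rule sums_unique)
      have "(\<lambda>l. inner (R (e l)) (e j) * inner (R (e l)) (e k)) sums inner (R (e j)) (R (e k))" for j k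
        using parseval_sums[OF onb, of "R (e j)" "R (e k)"] by (simp add: R_symmetric[of "e j"] R_symmetric[of "e k"])
      then show "(\<lambda>l. ?P n (R (e l))) sums (\<Sum>j<n. \<Sum>k<n. inner (R (e j)) (R (e k)) * B (e j) (e k))"
        unfolding bounded_bilinear_fourier_sum[OF B] by (intro sums_sum sums_mult2)
    qed
    finally show ?thesis .
  qed
  \<comment> \<open>Dominated convergence for series; the majorant is summable because
    \<open>R\<close> is Hilbert-Schmidt.\<close>
  moreover have "(\<lambda>n. \<Sum>l. ?P n (R (e l))) \<longlonglongrightarrow> (\<Sum>l. B (R (e l)) (R (e l)))"
  proof -
    have "summable (\<lambda>l. (norm (R (e l)))\<^sup>2 * K)" using R_summable by (rule summable_mult2)
    then show ?thesis
      using tannerys_theorem[of "\<lambda>l n. ?P n (R (e l))" "\<lambda>l. B (R (e l)) (R (e l))" sequentially "\<lambda>l. (norm (R (e l)))\<^sup>2 * K"]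
        P_lim P_le by (simp add: case_prod_unfold)
  qed
  ultimately have "(\<lambda>n. expectation (\<lambda>\<omega>. ?P n (increment s t \<omega>))) \<longlonglongrightarrow> (t - s) * (\<Sum>l. B (R (e l)) (R (e l)))"
    by (simp add: tendsto_mult_left)
  with lim1 show "expectation (\<lambda>\<omega>. B (increment s t \<omega>) (increment s t \<omega>)) = (t - s) * (\<Sum>l. B (R (e l)) (R (e l)))"
    by (rule LIMSEQ_unique)
qed

lemma expectation_weighted_increment:
  fixes B :: "'h \<Rightarrow> 'h \<Rightarrow> real"
  assumes st: "0 \<le> s" "s \<le> t" and B: "bounded_bilinear B"
    and \<phi>: "\<phi> \<in> borel_measurable (F s)" "integrable M \<phi>"
  shows "integrable M (\<lambda>\<omega>. \<phi> \<omega> * B (increment s t \<omega>) (increment s t \<omega>))"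
    "expectation (\<lambda>\<omega>. \<phi> \<omega> * B (increment s t \<omega>) (increment s t \<omega>)) = expectation \<phi> * ((t - s) * (\<Sum>l. B (R (e l)) (R (e l))))"
proof -
  have "(\<lambda>x. B x x) \<in> borel_measurable borel"
    by (rule borel_measurable_bounded_bilinear[OF B]) auto
  from indep_increment[OF st \<phi>(1) this]
  have ind: "indep_var borel \<phi> borel (\<lambda>\<omega>. B (increment s t \<omega>) (increment s t \<omega>))" .
  show "integrable M (\<lambda>\<omega>. \<phi> \<omega> * B (increment s t \<omega>) (increment s t \<omega>))"
    by (rule indep_var_integrable[OF ind \<phi>(2) expectation_quadratic_increment(1)[OF st B]])
  show "expectation (\<lambda>\<omega>. \<phi> \<omega> * B (increment s t \<omega>) (increment s t \<omega>)) = expectation \<phi> * ((t - s) * (\<Sum>l. B (R (e l)) (R (e l))))"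
    by (simp add: indep_var_lebesgue_integral[OF ind \<phi>(2) expectation_quadratic_increment(1)[OF st B]]
        expectation_quadratic_increment(2)[OF st B])
qed

text \<open>The weight and the earlier increment together form one random variable known at the
  start of the later increment, so the centring of bilinear pairings applies to it.\<close>

lemma expectation_cross_increment:
  fixes B :: "'h \<Rightarrow> 'h \<Rightarrow> real"
  assumes st: "0 \<le> s" "s \<le> t" "t \<le> s'" "s' \<le> t'" and B: "bounded_bilinear B"
    and \<phi>: "\<phi> \<in> borel_measurable (F 0)" "\<And>\<omega>. \<bar>\<phi> \<omega>\<bar> \<le> c"
  shows "integrable M (\<lambda>\<omega>. \<phi> \<omega> * B (increment s t \<omega>) (increment s' t' \<omega>))"
    "expectation (\<lambda>\<omega>. \<phi> \<omega> * B (increment s t \<omega>) (increment s' t' \<omega>)) = 0"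
proof -
  have 0: "0 \<le> t" "0 \<le> s'" using st by auto
  have 1: "(\<lambda>\<omega>. \<phi> \<omega> *\<^sub>R increment s t \<omega>) \<in> borel_measurable (F s')"
    using measurable_filtration_mono[OF order_refl 0(2) \<phi>(1)]
      measurable_filtration_mono[OF 0(1) st(3) increment_measurable[OF st(1,2)]] by measurable
  have 2: "integrable M (\<lambda>\<omega>. norm (\<phi> \<omega> *\<^sub>R increment s t \<omega>))"
  proof (rule Bochner_Integration.integrable_bound)
    show "integrable M (\<lambda>\<omega>. c * norm (increment s t \<omega>))" using increment_integrable[OF st(1,2)] by simp
    show "(\<lambda>\<omega>. norm (\<phi> \<omega> *\<^sub>R increment s t \<omega>)) \<in> borel_measurable M"
      using measurable_filtration[OF 0(2) 1] by measurable
    have "0 \<le> c" using \<phi>(2)[of undefined] by linarith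
    then show "AE \<omega> in M. norm (norm (\<phi> \<omega> *\<^sub>R increment s t \<omega>)) \<le> norm (c * norm (increment s t \<omega>))"
      using \<phi>(2) by (intro AE_I2) (simp add: abs_mult mult_right_mono)
  qed
  note * = expectation_bilinear_increment[OF 0(2) st(4) B 1 2]
  show "integrable M (\<lambda>\<omega>. \<phi> \<omega> * B (increment s t \<omega>) (increment s' t' \<omega>))"
    "expectation (\<lambda>\<omega>. \<phi> \<omega> * B (increment s t \<omega>) (increment s' t' \<omega>)) = 0"
    using * by (simp_all add: bounded_bilinear.scaleR_left[OF B])
qed

end

section \<open>Elementary integrands and their integrals\<close>

lemma elementary_integrand_mono:
  assumes "elementary_integrand t N \<tau> L" "k \<le> l" "l \<le> N"
  shows "\<tau> k \<le> \<tau> l"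
  using assms(2,3)
proof (induction l rule: dec_induct)
  case (step n)
  then have "\<tau> n \<le> \<tau> (Suc n)" using assms(1) by (simp add: elementary_integrand_def)
  then show ?case using step by simp
qed simp

lemma elementary_integrand_nonneg: "elementary_integrand t N \<tau> L \<Longrightarrow> l \<le> N \<Longrightarrow> 0 \<le> \<tau> l"
  using elementary_integrand_mono[of t N \<tau> L 0 l] by (simp add: elementary_integrand_def)

lemma elementary_indicator_eq:
  assumes el: "elementary_integrand t N \<tau> L" and k: "k < N" "\<tau> k < r" "r \<le> \<tau> (Suc k)" and l: "l < N"
  shows "indicat_real {\<tau> l<..\<tau> (Suc l)} r = (if l = k then 1 else 0)"
proof (cases l k rule: linorder_cases)
  case less
  then show ?thesis using elementary_integrand_mono[OF el, of "Suc l" k] k by simp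
next
  case greater
  then show ?thesis using elementary_integrand_mono[OF el, of "Suc k" l] k l by simp
qed (use k in simp)

lemma elementary_value_eq:
  assumes el: "elementary_integrand t N \<tau> L" and k: "k < N" "\<tau> k < r" "r \<le> \<tau> (Suc k)"
  shows "elementary_value N \<tau> L r = L k"
proof
  fix h
  have "elementary_value N \<tau> L r h = (\<Sum>l<N. if l = k then L k h else 0)"
    unfolding elementary_value_def by (intro sum.cong) (simp_all add: elementary_indicator_eq[OF el k])
  then show "elementary_value N \<tau> L r h = L k h" using k(1) by simp
qed

lemma elementary_interval:
  assumes el: "elementary_integrand t N \<tau> L" and r: "0 < r" "r \<le> t"
  obtains k where "k < N" "\<tau> k < r" "r \<le> \<tau> (Suc k)"
proof -
  have t: "\<tau> 0 = 0" "\<tau> N = t" using el by (auto simp: elementary_integrand_def)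
  \<comment> \<open>The least partition index that reaches \<open>r\<close>. It is not 0 because
    \<open>r\<close> is positive, and its predecessor lies strictly below \<open>r\<close>, matching
    the half-open intervals.\<close>
  define m where "m = (LEAST m. r \<le> \<tau> m)"
  have m: "r \<le> \<tau> m" unfolding m_def by (rule LeastI[of _ N]) (use r t in simp)
  have mN: "m \<le> N" unfolding m_def by (rule Least_le) (use r t in simp)
  have "m \<noteq> 0" using m r t by (metis not_le)
  then obtain k where k: "m = Suc k" by (cases m) auto
  have "\<not> r \<le> \<tau> k" using not_less_Least[of k "\<lambda>m. r \<le> \<tau> m"] k by (simp add: m_def[symmetric])
  then show ?thesis using that[of k] k m mN by simp
qed

context wiener_process
begin

lemma elementary_integral_increment:
  "elementary_integral N \<tau> L W \<omega> = (\<Sum>k<N. L k (increment (\<tau> k) (\<tau> (Suc k)) \<omega>))"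
  by (simp add: elementary_integral_def increment_def)

lemma elementary_integral_measurable:
  assumes el: "elementary_integrand t N \<tau> L"
  shows "elementary_integral N \<tau> L W \<in> borel_measurable M"
  unfolding elementary_integral_increment
proof (rule borel_measurable_sum)
  fix k assume k: "k \<in> {..<N}"
  then have "bounded_linear (L k)" and \<tau>: "0 \<le> \<tau> k" "\<tau> k \<le> \<tau> (Suc k)"
    using el elementary_integrand_nonneg[OF el, of k] by (auto simp: elementary_integrand_def)
  then show "(\<lambda>\<omega>. L k (increment (\<tau> k) (\<tau> (Suc k)) \<omega>)) \<in> borel_measurable M"
    by (intro borel_measurable_bounded_linear[OF _ increment_measurable_M[OF \<tau>]])
qed

text \<open>The double sum over pairs of increments reduces to its diagonal, since disjoint
  increments are uncorrelated even under a weight known at time 0. Symmetry of \<open>B\<close> is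
  not assumed.\<close>

lemma elementary_integral_isometry:
  fixes B :: "'h \<Rightarrow> 'h \<Rightarrow> real"
  assumes el: "elementary_integrand t N \<tau> L" and B: "bounded_bilinear B"
    and \<phi>: "\<phi> \<in> borel_measurable (F 0)" "\<And>\<omega>. \<bar>\<phi> \<omega>\<bar> \<le> c"
  shows "integrable M (\<lambda>\<omega>. \<phi> \<omega> * B (elementary_integral N \<tau> L W \<omega>) (elementary_integral N \<tau> L W \<omega>))"
    "expectation (\<lambda>\<omega>. \<phi> \<omega> * B (elementary_integral N \<tau> L W \<omega>) (elementary_integral N \<tau> L W \<omega>))
      = expectation \<phi> * (\<Sum>k<N. (\<tau> (Suc k) - \<tau> k) * (\<Sum>j. B (L k (R (e j))) (L k (R (e j)))))"
proof -
  let ?i = "\<lambda>k. increment (\<tau> k) (\<tau> (Suc k))"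
  let ?s = "\<lambda>k. (\<tau> (Suc k) - \<tau> k) * (\<Sum>j. B (L k (R (e j))) (L k (R (e j))))"
  have L: "bounded_linear (L k)" "0 \<le> \<tau> k" "\<tau> k \<le> \<tau> (Suc k)" if "k < N" for k
    using el elementary_integrand_nonneg[OF el, of k] that by (auto simp: elementary_integrand_def)
  have \<phi>_int: "integrable M \<phi>"
    by (rule integrable_const_bound[of _ c]) (use \<phi> measurable_filtration[OF order_refl \<phi>(1)] in auto)
  have termE: "integrable M (\<lambda>\<omega>. \<phi> \<omega> * B (L k (?i k \<omega>)) (L l (?i l \<omega>))) \<and>
      expectation (\<lambda>\<omega>. \<phi> \<omega> * B (L k (?i k \<omega>)) (L l (?i l \<omega>))) = (if l = k then expectation \<phi> * ?s k else 0)"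
    if kl: "k < N" "l < N" for k l
  proof -
    have BL: "bounded_bilinear (\<lambda>a b. B (L k a) (L l b))"
      by (rule bounded_bilinear.comp[OF B L(1)[OF kl(1)] L(1)[OF kl(2)]])
    show ?thesis
    proof (cases k l rule: linorder_cases)
      case less
      then have "\<tau> (Suc k) \<le> \<tau> l" using elementary_integrand_mono[OF el, of "Suc k" l] kl by simp
      then show ?thesis
        using expectation_cross_increment[OF L(2,3)[OF kl(1)] _ L(3)[OF kl(2)] BL \<phi>] less by simp
    next
      case equal
      have "\<phi> \<in> borel_measurable (F (\<tau> k))" by (rule measurable_filtration_mono[OF order_refl L(2)[OF kl(1)] \<phi>(1)])
      then show ?thesis
        using expectation_weighted_increment[OF L(2,3)[OF kl(1)] BL _ \<phi>_int] equal by simp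
    next
      \<comment> \<open>Now the later increment sits in the first slot, so the form is flipped to
        bring the earlier one to the front.\<close>
      case greater
      then have "\<tau> (Suc l) \<le> \<tau> k" using elementary_integrand_mono[OF el, of "Suc l" k] kl by simp
      then show ?thesis
        using expectation_cross_increment[OF L(2,3)[OF kl(2)] _ L(3)[OF kl(1)] bounded_bilinear.flip[OF BL] \<phi>] greater by simp
    qed
  qed
  have eq: "\<phi> \<omega> * B (elementary_integral N \<tau> L W \<omega>) (elementary_integral N \<tau> L W \<omega>)
      = (\<Sum>k<N. \<Sum>l<N. \<phi> \<omega> * B (L k (?i k \<omega>)) (L l (?i l \<omega>)))" for \<omega>
    by (simp add: elementary_integral_increment bounded_bilinear_sum_sum[OF B] sum_distrib_left)
  have row: "integrable M (\<lambda>\<omega>. \<Sum>l<N. \<phi> \<omega> * B (L k (?i k \<omega>)) (L l (?i l \<omega>)))" if "k < N" for k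
    by (rule Bochner_Integration.integrable_sum) (use termE that in blast)
  show "integrable M (\<lambda>\<omega>. \<phi> \<omega> * B (elementary_integral N \<tau> L W \<omega>) (elementary_integral N \<tau> L W \<omega>))"
    unfolding eq by (rule Bochner_Integration.integrable_sum) (use row in blast)
  have "expectation (\<lambda>\<omega>. \<Sum>k<N. \<Sum>l<N. \<phi> \<omega> * B (L k (?i k \<omega>)) (L l (?i l \<omega>)))
      = (\<Sum>k<N. expectation (\<lambda>\<omega>. \<Sum>l<N. \<phi> \<omega> * B (L k (?i k \<omega>)) (L l (?i l \<omega>))))"
    by (rule Bochner_Integration.integral_sum) (use row in blast)
  also have "\<dots> = (\<Sum>k<N. \<Sum>l<N. expectation (\<lambda>\<omega>. \<phi> \<omega> * B (L k (?i k \<omega>)) (L l (?i l \<omega>))))"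
    by (intro sum.cong refl Bochner_Integration.integral_sum) (use termE in blast)
  also have "\<dots> = (\<Sum>k<N. \<Sum>l<N. if l = k then expectation \<phi> * ?s k else 0)"
    by (intro sum.cong refl) (use termE in blast)
  finally show "expectation (\<lambda>\<omega>. \<phi> \<omega> * B (elementary_integral N \<tau> L W \<omega>) (elementary_integral N \<tau> L W \<omega>))
      = expectation \<phi> * (\<Sum>k<N. ?s k)"
    unfolding eq by (simp add: sum_distrib_left)
qed

lemma elementary_integral_square_integrable:
  assumes el: "elementary_integrand t N \<tau> L"
  shows "integrable M (\<lambda>\<omega>. (norm (elementary_integral N \<tau> L W \<omega>))\<^sup>2)"
  using elementary_integral_isometry(1)[OF el bounded_bilinear_inner, of "\<lambda>_. 1" 1]
  by (simp add: power2_norm_eq_inner)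

text \<open>The trace sum is the time integral of a step function. Invariance of \<open>B\<close>
  under \<open>\<Phi> r\<close> makes the trace for the true integrand constant in time, so a
  pointwise comparison of traces, integrated over time, suffices.\<close>

lemma elementary_trace_bound:
  fixes B :: "'h \<Rightarrow> 'h \<Rightarrow> real"
  assumes el: "elementary_integrand t N \<tau> L" and t: "0 \<le> t" and B: "bounded_bilinear B"
    and K: "0 < K" "\<And>a b. norm (B a b) \<le> norm a * norm b * K" and \<epsilon>: "0 < \<epsilon>"
    and \<Phi>: "\<And>x. (\<lambda>r. \<Phi> r x) \<in> borel_measurable borel"
      "\<And>r x. norm (\<Phi> r x) = norm x" "\<And>r x. B (\<Phi> r x) (\<Phi> r x) = B x x"
  shows "ennreal \<bar>(\<Sum>k<N. (\<tau> (Suc k) - \<tau> k) * (\<Sum>j. B (L k (R (e j))) (L k (R (e j))))) - t * (\<Sum>j. B (R (e j)) (R (e j)))\<bar>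
    \<le> ennreal (K * (1 + 1 / \<epsilon>)) * (\<integral>\<^sup>+r\<in>{0..t}. hs_norm2 e (\<lambda>h. elementary_value N \<tau> L r (R h) - \<Phi> r (R h)) \<partial>lborel)
      + ennreal (K * t * (\<Sum>j. (norm (R (e j)))\<^sup>2) * \<epsilon>)"
proof -
  define s where "s k = (\<Sum>j. B (L k (R (e j))) (L k (R (e j))))" for k
  define s0 where "s0 = (\<Sum>j. B (R (e j)) (R (e j)))"
  define c where "c = (\<Sum>j. (norm (R (e j)))\<^sup>2)"
  \<comment> \<open>The trace of the elementary integrand as a step function of time;
    \<open>H\<close> is its squared Hilbert-Schmidt distance to the true integrand.\<close>
  define h where "h r = (\<Sum>k<N. indicator {\<tau> k<..\<tau> (Suc k)} r * s k)" for r
  define H where "H r = hs_norm2 e (\<lambda>h. elementary_value N \<tau> L r (R h) - \<Phi> r (R h))" for r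
  have \<tau>: "\<tau> 0 = 0" "\<tau> N = t" "\<And>k. k < N \<Longrightarrow> bounded_linear (L k)" "\<And>k. k < N \<Longrightarrow> \<tau> k \<le> \<tau> (Suc k)"
    using el by (auto simp: elementary_integrand_def)
  have c0: "0 \<le> c" unfolding c_def by (intro suminf_nonneg R_summable) simp
  have H_meas [measurable]: "H \<in> borel_measurable borel"
    unfolding H_def hs_norm2_def elementary_value_def using \<Phi>(1) by measurable
  have h_meas [measurable]: "h \<in> borel_measurable borel" unfolding h_def by measurable
  have h_eq: "h r = s k" if k: "k < N" "\<tau> k < r" "r \<le> \<tau> (Suc k)" for r k
  proof -
    have "h r = (\<Sum>l<N. if l = k then s k else 0)"
      unfolding h_def by (intro sum.cong) (simp_all add: elementary_indicator_eq[OF el k])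
    then show ?thesis using k(1) by simp
  qed
  \<comment> \<open>The time 0 is left out because the half-open intervals do not cover it, so the
    elementary value vanishes there.\<close>
  have pointwise: "ennreal \<bar>h r - s0\<bar> \<le> ennreal (K * (1 + 1 / \<epsilon>)) * H r + ennreal (K * c * \<epsilon>)"
    if r: "0 < r" "r \<le> t" for r
  proof -
    obtain k where k: "k < N" "\<tau> k < r" "r \<le> \<tau> (Suc k)" using elementary_interval[OF el r] by blast
    define a where "a j = L k (R (e j))" for j
    define b where "b j = \<Phi> r (R (e j))" for j
    have sa: "summable (\<lambda>j. (norm (a j))\<^sup>2)" unfolding a_def
      by (rule summable_bounded_linear_norm2[OF \<tau>(3)[OF k(1)] R_summable])
    have sb: "summable (\<lambda>j. (norm (b j))\<^sup>2)" using R_summable by (simp add: b_def \<Phi>(2))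
    have sd: "summable (\<lambda>j. (norm (a j - b j))\<^sup>2)"
    proof (rule summable_comparison_test)
      have "norm ((norm (a j - b j))\<^sup>2) \<le> 2 * (norm (a j))\<^sup>2 + 2 * (norm (b j))\<^sup>2" for j
        using norm2_diff_le[of "a j" "b j" 0] by simp
      then show "\<exists>N. \<forall>j\<ge>N. norm ((norm (a j - b j))\<^sup>2) \<le> 2 * (norm (a j))\<^sup>2 + 2 * (norm (b j))\<^sup>2" by blast
      show "summable (\<lambda>j. 2 * (norm (a j))\<^sup>2 + 2 * (norm (b j))\<^sup>2)"
        by (intro summable_add summable_mult sa sb)
    qed
    have Ba: "summable (\<lambda>j. B (a j) (a j))" and Bb: "summable (\<lambda>j. B (b j) (b j))"
      by (rule summable_bounded_bilinear[OF B sa] summable_bounded_bilinear[OF B sb])+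
    let ?u = "\<lambda>j. K * ((1 + 1 / \<epsilon>) * (norm (a j - b j))\<^sup>2 + \<epsilon> * (norm (b j))\<^sup>2)"
    have su: "summable ?u" by (intro summable_add summable_mult sd sb)
    have le: "\<bar>B (a j) (a j) - B (b j) (b j)\<bar> \<le> ?u j" for j
      by (rule bounded_bilinear_quadratic_diff[OF B K \<epsilon>])
    have "h r - s0 = (\<Sum>j. B (a j) (a j) - B (b j) (b j))"
      using suminf_diff[OF Ba Bb] by (simp add: h_eq[OF k] s_def s0_def a_def b_def \<Phi>(3))
    then have "\<bar>h r - s0\<bar> = norm (\<Sum>j. B (a j) (a j) - B (b j) (b j))" by simp
    also have "\<dots> \<le> (\<Sum>j. ?u j)"
      by (rule norm_suminf_le[OF _ su]) (use le in simp)
    also have "\<dots> = K * ((1 + 1 / \<epsilon>) * (\<Sum>j. (norm (a j - b j))\<^sup>2) + \<epsilon> * (\<Sum>j. (norm (b j))\<^sup>2))"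
      by (rule sums_unique[symmetric]) (intro sums_mult sums_add summable_sums sd sb)
    also have "(\<Sum>j. (norm (b j))\<^sup>2) = c" by (simp add: b_def c_def \<Phi>(2))
    finally have fin: "\<bar>h r - s0\<bar> \<le> K * (1 + 1 / \<epsilon>) * (\<Sum>j. (norm (a j - b j))\<^sup>2) + K * c * \<epsilon>"
      by (simp add: algebra_simps)
    have "H r = ennreal (\<Sum>j. (norm (a j - b j))\<^sup>2)"
      unfolding H_def hs_norm2_def elementary_value_eq[OF el k] a_def[symmetric] b_def[symmetric]
      by (rule suminf_ennreal2[OF _ sd]) simp
    moreover have "0 \<le> (\<Sum>j. (norm (a j - b j))\<^sup>2)" by (intro suminf_nonneg sd) simp
    ultimately show ?thesis
      using ennreal_leI[OF fin] K(1) \<epsilon> c0 by (simp add: ennreal_plus ennreal_mult)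
  qed
  have ind_int: "integrable lborel (indicat_real {\<tau> k<..\<tau> (Suc k)})" if "k < N" for k
    using \<tau>(4)[OF that] by (intro integrable_real_indicator) (auto simp: emeasure_lborel_Ioc)
  have h_int: "integrable lborel h"
    unfolding h_def using ind_int by (intro Bochner_Integration.integrable_sum) auto
  have h_val: "(\<integral>r. h r \<partial>lborel) = (\<Sum>k<N. (\<tau> (Suc k) - \<tau> k) * s k)"
    unfolding h_def using ind_int \<tau>(4) by (subst Bochner_Integration.integral_sum) (auto simp: measure_def emeasure_lborel_Ioc)
  have i0: "integrable lborel (\<lambda>r. indicator {0<..t} r * s0)"
    using t by (intro integrable_mult_left integrable_real_indicator) (auto simp: emeasure_lborel_Ioc)
  have i0_val: "(\<integral>r. indicator {0<..t} r * s0 \<partial>lborel) = t * s0"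
    using t by (simp add: measure_def emeasure_lborel_Ioc)
  have "(\<Sum>k<N. (\<tau> (Suc k) - \<tau> k) * s k) - t * s0 = (\<integral>r. h r - indicator {0<..t} r * s0 \<partial>lborel)"
    by (simp only: Bochner_Integration.integral_diff[OF h_int i0] h_val i0_val)
  then have "ennreal \<bar>(\<Sum>k<N. (\<tau> (Suc k) - \<tau> k) * s k) - t * s0\<bar> \<le> (\<integral>\<^sup>+r. norm (h r - indicator {0<..t} r * s0) \<partial>lborel)"
    using integral_norm_bound_ennreal[OF Bochner_Integration.integrable_diff[OF h_int i0]] by simp
  also have "\<dots> \<le> (\<integral>\<^sup>+r. (ennreal (K * (1 + 1 / \<epsilon>)) * (H r * indicator {0..t} r)) + ennreal (K * c * \<epsilon>) * indicator {0..t} r \<partial>lborel)"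
  proof (rule nn_integral_mono)
    fix r
    show "ennreal (norm (h r - indicator {0<..t} r * s0))
      \<le> ennreal (K * (1 + 1 / \<epsilon>)) * (H r * indicator {0..t} r) + ennreal (K * c * \<epsilon>) * indicator {0..t} r"
    proof (cases "0 < r \<and> r \<le> t")
      case True
      then show ?thesis using pointwise[of r] by (simp add: mult.assoc)
    next
      \<comment> \<open>Outside of the half-open interval from 0 to \<open>t\<close> both terms on
        the left vanish.\<close>
      case False
      have "indicator {\<tau> k<..\<tau> (Suc k)} r * s k = 0" if "k < N" for k
        using False elementary_integrand_nonneg[OF el, of k] elementary_integrand_mono[OF el, of "Suc k" N] that \<tau>(2)
        by (auto simp: indicator_def)
      then have "h r = 0" unfolding h_def by (intro sum.neutral ballI) (simp only: lessThan_iff)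
      then show ?thesis using False by (auto simp: indicator_def)
    qed
  qed
  also have "\<dots> = ennreal (K * (1 + 1 / \<epsilon>)) * (\<integral>\<^sup>+r\<in>{0..t}. H r \<partial>lborel) + ennreal (K * c * \<epsilon>) * ennreal t"
    using t by (subst nn_integral_add) (auto simp: nn_integral_cmult nn_integral_cmult_indicator)
  also have "ennreal (K * c * \<epsilon>) * ennreal t = ennreal (K * t * c * \<epsilon>)"
    using K(1) c0 \<epsilon> t by (simp add: ennreal_mult[symmetric] mult_ac)
  finally show ?thesis unfolding s_def s0_def c_def H_def .
qed

end

section \<open>Passage to general deterministic integrands\<close>

context wiener_process
begin

text \<open>A single elementary integral \<open>Z\<close> at finite mean square distance is enough,
  because X = Z - (Z - X); the threshold 1 is an arbitrary finite number.\<close>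

lemma stochastic_integral_square_integrable:
  assumes "has_stochastic_integral M e R W \<Phi> t X"
  shows "X \<in> borel_measurable M" "integrable M (\<lambda>\<omega>. (norm (X \<omega>))\<^sup>2)"
proof -
  show [measurable]: "X \<in> borel_measurable M" using assms by (simp add: has_stochastic_integral_def)
  obtain N \<tau> L where el: "\<And>n. elementary_integrand t (N n) (\<tau> n) (L n)"
    and lim: "(\<lambda>n. \<integral>\<^sup>+\<omega>. ennreal ((norm (elementary_integral (N n) (\<tau> n) (L n) W \<omega> - X \<omega>))\<^sup>2) \<partial>M) \<longlonglongrightarrow> 0"
    using assms unfolding has_stochastic_integral_def by blast
  have "eventually (\<lambda>n. (\<integral>\<^sup>+\<omega>. ennreal ((norm (elementary_integral (N n) (\<tau> n) (L n) W \<omega> - X \<omega>))\<^sup>2) \<partial>M) < 1) sequentially"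
    by (rule order_tendstoD(2)[OF lim]) simp
  then obtain n where n: "(\<integral>\<^sup>+\<omega>. ennreal ((norm (elementary_integral (N n) (\<tau> n) (L n) W \<omega> - X \<omega>))\<^sup>2) \<partial>M) < 1"
    by (auto simp: eventually_sequentially)
  define Z where "Z = elementary_integral (N n) (\<tau> n) (L n) W"
  have [measurable]: "Z \<in> borel_measurable M" unfolding Z_def by (rule elementary_integral_measurable[OF el])
  have "integrable M (\<lambda>\<omega>. (norm (Z \<omega> - X \<omega>))\<^sup>2)"
    unfolding integrable_iff_bounded using n by (auto simp: Z_def[symmetric] intro: less_trans)
  then have "integrable M (\<lambda>\<omega>. (norm (Z \<omega> - (Z \<omega> - X \<omega>)))\<^sup>2)"
    using elementary_integral_square_integrable[OF el, of n]
    by (intro integrable_norm2_diff[of Z M "\<lambda>\<omega>. Z \<omega> - X \<omega>"]) (simp_all add: Z_def[symmetric])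
  then show "integrable M (\<lambda>\<omega>. (norm (X \<omega>))\<^sup>2)" by simp
qed

text \<open>The means for the elementary approximations have two limits: one computed from the
  traces, the other from mean square convergence to \<open>X\<close>. Both follow from the quadratic
  difference bound, and they must agree. Boundedness of \<phi> lets the weight pass through the
  second limit.\<close>

lemma stochastic_integral_isometry:
  fixes B :: "'h \<Rightarrow> 'h \<Rightarrow> real"
  assumes X: "has_stochastic_integral M e R W \<Phi> t X" and t: "0 \<le> t" and B: "bounded_bilinear B"
    and \<phi>: "\<phi> \<in> borel_measurable (F 0)" "\<And>\<omega>. \<bar>\<phi> \<omega>\<bar> \<le> c"
    and \<Phi>: "\<And>x. (\<lambda>r. \<Phi> r x) \<in> borel_measurable borel"
      "\<And>r x. norm (\<Phi> r x) = norm x" "\<And>r x. B (\<Phi> r x) (\<Phi> r x) = B x x"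
  shows "integrable M (\<lambda>\<omega>. \<phi> \<omega> * B (X \<omega>) (X \<omega>))"
    "expectation (\<lambda>\<omega>. \<phi> \<omega> * B (X \<omega>) (X \<omega>)) = expectation \<phi> * (t * (\<Sum>j. B (R (e j)) (R (e j))))"
proof -
  obtain N \<tau> L where el: "\<And>n. elementary_integrand t (N n) (\<tau> n) (L n)"
    and lim1: "(\<lambda>n. \<integral>\<^sup>+r\<in>{0..t}. hs_norm2 e (\<lambda>h. elementary_value (N n) (\<tau> n) (L n) r (R h) - \<Phi> r (R h)) \<partial>lborel) \<longlonglongrightarrow> 0"
    and lim2: "(\<lambda>n. \<integral>\<^sup>+\<omega>. ennreal ((norm (elementary_integral (N n) (\<tau> n) (L n) W \<omega> - X \<omega>))\<^sup>2) \<partial>M) \<longlonglongrightarrow> 0"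
    using X unfolding has_stochastic_integral_def by blast
  define Z where "Z n = elementary_integral (N n) (\<tau> n) (L n) W" for n
  obtain K where K: "0 < K" "\<And>a b. norm (B a b) \<le> norm a * norm b * K" using bounded_bilinear_le[OF B] by blast
  have c: "0 \<le> c" using \<phi>(2)[of undefined] by linarith
  note X_meas [measurable] = stochastic_integral_square_integrable(1)[OF X]
  note X_int = stochastic_integral_square_integrable(2)[OF X]
  have Z_meas [measurable]: "Z n \<in> borel_measurable M" for n
    unfolding Z_def by (rule elementary_integral_measurable[OF el])
  have \<phi>_meas [measurable]: "\<phi> \<in> borel_measurable M" by (rule measurable_filtration[OF order_refl \<phi>(1)])
  have BX_meas [measurable]: "(\<lambda>\<omega>. B (X \<omega>) (X \<omega>)) \<in> borel_measurable M"
    by (rule borel_measurable_bounded_bilinear[OF B X_meas X_meas])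
  show BX_int: "integrable M (\<lambda>\<omega>. \<phi> \<omega> * B (X \<omega>) (X \<omega>))"
  proof (rule Bochner_Integration.integrable_bound)
    show "integrable M (\<lambda>\<omega>. c * ((norm (X \<omega>))\<^sup>2 * K))" using X_int by simp
    have "\<bar>\<phi> \<omega>\<bar> * \<bar>B (X \<omega>) (X \<omega>)\<bar> \<le> c * ((norm (X \<omega>))\<^sup>2 * K)" for \<omega>
      using K(2)[of "X \<omega>" "X \<omega>"] c \<phi>(2) by (intro mult_mono) (auto simp: power2_eq_square)
    then show "AE \<omega> in M. norm (\<phi> \<omega> * B (X \<omega>) (X \<omega>)) \<le> norm (c * ((norm (X \<omega>))\<^sup>2 * K))"
      using c K(1) by (simp add: abs_mult)
  qed measurable
  note Z_iso = elementary_integral_isometry[OF el B \<phi>]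
  define T where "T n = (\<Sum>k<N n. (\<tau> n (Suc k) - \<tau> n k) * (\<Sum>j. B (L n k (R (e j))) (L n k (R (e j)))))" for n
  define s0 where "s0 = (\<Sum>j. B (R (e j)) (R (e j)))"
  have "(\<lambda>n. T n - t * s0) \<longlonglongrightarrow> 0"
  proof (rule tendsto_0_of_epsilon_bound[OF lim1])
    show "0 \<le> K" using K(1) by simp
    show "0 \<le> K * t * (\<Sum>j. (norm (R (e j)))\<^sup>2)"
      using K(1) t by (intro mult_nonneg_nonneg suminf_nonneg R_summable) auto
    fix \<epsilon> :: real and n assume \<epsilon>: "0 < \<epsilon>"
    show "ennreal \<bar>T n - t * s0\<bar> \<le> ennreal (K * (1 + 1 / \<epsilon>)) *
        (\<integral>\<^sup>+r\<in>{0..t}. hs_norm2 e (\<lambda>h. elementary_value (N n) (\<tau> n) (L n) r (R h) - \<Phi> r (R h)) \<partial>lborel) +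
        ennreal (K * t * (\<Sum>j. (norm (R (e j)))\<^sup>2) * \<epsilon>)"
      unfolding T_def s0_def by (rule elementary_trace_bound[OF el t B K \<epsilon> \<Phi>])
  qed
  then have "(\<lambda>n. T n) \<longlonglongrightarrow> t * s0" by (simp add: LIM_zero_iff)
  then have T_lim: "(\<lambda>n. expectation \<phi> * T n) \<longlonglongrightarrow> expectation \<phi> * (t * s0)" by (rule tendsto_mult_left)
  have "(\<lambda>n. expectation \<phi> * T n - expectation (\<lambda>\<omega>. \<phi> \<omega> * B (X \<omega>) (X \<omega>))) \<longlonglongrightarrow> 0"
  proof (rule tendsto_0_of_epsilon_bound[OF lim2])
    show "0 \<le> c * K" "0 \<le> c * K * expectation (\<lambda>\<omega>. (norm (X \<omega>))\<^sup>2)"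
      using c K(1) by (auto intro!: mult_nonneg_nonneg)
    fix \<epsilon> :: real and n assume \<epsilon>: "0 < \<epsilon>"
    have "ennreal \<bar>expectation \<phi> * T n - expectation (\<lambda>\<omega>. \<phi> \<omega> * B (X \<omega>) (X \<omega>))\<bar>
      = ennreal (norm (expectation (\<lambda>\<omega>. \<phi> \<omega> * B (Z n \<omega>) (Z n \<omega>) - \<phi> \<omega> * B (X \<omega>) (X \<omega>))))"
      unfolding T_def Z_iso(2)[symmetric] Z_def
      by (simp add: Bochner_Integration.integral_diff[OF Z_iso(1) BX_int])
    also have "\<dots> \<le> (\<integral>\<^sup>+\<omega>. norm (\<phi> \<omega> * B (Z n \<omega>) (Z n \<omega>) - \<phi> \<omega> * B (X \<omega>) (X \<omega>)) \<partial>M)"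
      unfolding Z_def by (intro integral_norm_bound_ennreal Bochner_Integration.integrable_diff Z_iso(1) BX_int)
    also have "\<dots> \<le> (\<integral>\<^sup>+\<omega>. ennreal (c * K * (1 + 1 / \<epsilon>)) * ennreal ((norm (Z n \<omega> - X \<omega>))\<^sup>2)
        + ennreal (c * K * \<epsilon>) * ennreal ((norm (X \<omega>))\<^sup>2) \<partial>M)"
    proof (rule nn_integral_mono)
      fix \<omega>
      have "norm (\<phi> \<omega> * B (Z n \<omega>) (Z n \<omega>) - \<phi> \<omega> * B (X \<omega>) (X \<omega>)) = \<bar>\<phi> \<omega>\<bar> * \<bar>B (Z n \<omega>) (Z n \<omega>) - B (X \<omega>) (X \<omega>)\<bar>"
        by (simp add: right_diff_distrib[symmetric] abs_mult)
      also have "\<dots> \<le> c * (K * ((1 + 1 / \<epsilon>) * (norm (Z n \<omega> - X \<omega>))\<^sup>2 + \<epsilon> * (norm (X \<omega>))\<^sup>2))"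
        using c \<phi>(2) bounded_bilinear_quadratic_diff[OF B K \<epsilon>] by (intro mult_mono) auto
      also have "\<dots> = c * K * (1 + 1 / \<epsilon>) * (norm (Z n \<omega> - X \<omega>))\<^sup>2 + c * K * \<epsilon> * (norm (X \<omega>))\<^sup>2"
        by (simp add: algebra_simps)
      finally show "ennreal (norm (\<phi> \<omega> * B (Z n \<omega>) (Z n \<omega>) - \<phi> \<omega> * B (X \<omega>) (X \<omega>)))
        \<le> ennreal (c * K * (1 + 1 / \<epsilon>)) * ennreal ((norm (Z n \<omega> - X \<omega>))\<^sup>2) + ennreal (c * K * \<epsilon>) * ennreal ((norm (X \<omega>))\<^sup>2)"
        using c K(1) \<epsilon> by (simp add: ennreal_mult[symmetric] ennreal_plus[symmetric] ennreal_leI del: ennreal_plus)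
    qed
    also have "\<dots> = ennreal (c * K * (1 + 1 / \<epsilon>)) * (\<integral>\<^sup>+\<omega>. ennreal ((norm (Z n \<omega> - X \<omega>))\<^sup>2) \<partial>M)
        + ennreal (c * K * \<epsilon>) * (\<integral>\<^sup>+\<omega>. ennreal ((norm (X \<omega>))\<^sup>2) \<partial>M)"
      by (subst nn_integral_add) (simp_all add: nn_integral_cmult)
    also have "(\<integral>\<^sup>+\<omega>. ennreal ((norm (X \<omega>))\<^sup>2) \<partial>M) = ennreal (expectation (\<lambda>\<omega>. (norm (X \<omega>))\<^sup>2))"
      using X_int by (intro nn_integral_eq_integral) auto
    also have "ennreal (c * K * \<epsilon>) * ennreal (expectation (\<lambda>\<omega>. (norm (X \<omega>))\<^sup>2)) = ennreal (c * K * expectation (\<lambda>\<omega>. (norm (X \<omega>))\<^sup>2) * \<epsilon>)"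
      using c K(1) \<epsilon> by (simp add: ennreal_mult[symmetric] mult_ac)
    finally show "ennreal \<bar>expectation \<phi> * T n - expectation (\<lambda>\<omega>. \<phi> \<omega> * B (X \<omega>) (X \<omega>))\<bar>
      \<le> ennreal (c * K * (1 + 1 / \<epsilon>)) * (\<integral>\<^sup>+\<omega>. ennreal ((norm (elementary_integral (N n) (\<tau> n) (L n) W \<omega> - X \<omega>))\<^sup>2) \<partial>M)
        + ennreal (c * K * expectation (\<lambda>\<omega>. (norm (X \<omega>))\<^sup>2) * \<epsilon>)"
      unfolding Z_def .
  qed
  then have "(\<lambda>n. expectation \<phi> * T n) \<longlonglongrightarrow> expectation (\<lambda>\<omega>. \<phi> \<omega> * B (X \<omega>) (X \<omega>))" by (simp add: LIM_zero_iff)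
  from LIMSEQ_unique[OF this T_lim]
  show "expectation (\<lambda>\<omega>. \<phi> \<omega> * B (X \<omega>) (X \<omega>)) = expectation \<phi> * (t * (\<Sum>j. B (R (e j)) (R (e j))))"
    unfolding s0_def .
qed

lemma stochastic_integral_centred:
  assumes X: "has_stochastic_integral M e R W \<Phi> t X"
    and G: "G \<in> borel_measurable (F 0)" "\<And>\<omega>. norm (G \<omega>) \<le> c"
  shows "expectation (\<lambda>\<omega>. inner (G \<omega>) (X \<omega>)) = 0"
proof -
  obtain N \<tau> L where el: "\<And>n. elementary_integrand t (N n) (\<tau> n) (L n)"
    and lim2: "(\<lambda>n. \<integral>\<^sup>+\<omega>. ennreal ((norm (elementary_integral (N n) (\<tau> n) (L n) W \<omega> - X \<omega>))\<^sup>2) \<partial>M) \<longlonglongrightarrow> 0"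
    using X unfolding has_stochastic_integral_def by blast
  define Z where "Z n = elementary_integral (N n) (\<tau> n) (L n) W" for n
  have c: "0 \<le> c" using G(2)[of undefined] norm_ge_zero[of "G undefined"] by linarith
  note X_meas [measurable] = stochastic_integral_square_integrable(1)[OF X]
  have Z_meas [measurable]: "Z n \<in> borel_measurable M" for n
    unfolding Z_def by (rule elementary_integral_measurable[OF el])
  have G_meas [measurable]: "G \<in> borel_measurable M" by (rule measurable_filtration[OF order_refl G(1)])
  have G_int: "integrable M (\<lambda>\<omega>. norm (G \<omega>))"
    by (rule integrable_const_bound[of _ c]) (use G(2) in auto)
  have int: "integrable M (\<lambda>\<omega>. inner (G \<omega>) (Y \<omega>))" if [measurable]: "Y \<in> borel_measurable M" and "integrable M (\<lambda>\<omega>. (norm (Y \<omega>))\<^sup>2)" for Y :: "'w \<Rightarrow> 'h"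
  proof (rule Bochner_Integration.integrable_bound)
    show "integrable M (\<lambda>\<omega>. c * norm (Y \<omega>))" using integrable_of_square[OF that] by simp
    have "\<bar>inner (G \<omega>) (Y \<omega>)\<bar> \<le> c * norm (Y \<omega>)" for \<omega>
      using Cauchy_Schwarz_ineq2[of "G \<omega>" "Y \<omega>"] mult_right_mono[OF G(2)[of \<omega>] norm_ge_zero[of "Y \<omega>"]] by linarith
    then show "AE \<omega> in M. norm (inner (G \<omega>) (Y \<omega>)) \<le> norm (c * norm (Y \<omega>))" using c by simp
  qed measurable
  have GX_int: "integrable M (\<lambda>\<omega>. inner (G \<omega>) (X \<omega>))"
    by (rule int[OF stochastic_integral_square_integrable[OF X]])
  have GZ_int: "integrable M (\<lambda>\<omega>. inner (G \<omega>) (Z n \<omega>))" for n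
    by (rule int[OF Z_meas]) (use elementary_integral_square_integrable[OF el, of n] in \<open>simp add: Z_def\<close>)
  have GZ: "expectation (\<lambda>\<omega>. inner (G \<omega>) (Z n \<omega>)) = 0" for n
  proof -
    have *: "integrable M (\<lambda>\<omega>. inner (G \<omega>) (L n k (increment (\<tau> n k) (\<tau> n (Suc k)) \<omega>))) \<and>
        expectation (\<lambda>\<omega>. inner (G \<omega>) (L n k (increment (\<tau> n k) (\<tau> n (Suc k)) \<omega>))) = 0" if "k < N n" for k
    proof -
      have L: "bounded_linear (L n k)" "0 \<le> \<tau> n k" "\<tau> n k \<le> \<tau> n (Suc k)"
        using el[of n] elementary_integrand_nonneg[OF el[of n], of k] that by (auto simp: elementary_integrand_def)
      show ?thesis
        using expectation_bilinear_increment[OF L(2,3) bounded_bilinear.comp[OF bounded_bilinear_inner bounded_linear_ident L(1)]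
            measurable_filtration_mono[OF order_refl L(2) G(1)] G_int] by simp
    qed
    have "expectation (\<lambda>\<omega>. inner (G \<omega>) (Z n \<omega>)) = expectation (\<lambda>\<omega>. \<Sum>k<N n. inner (G \<omega>) (L n k (increment (\<tau> n k) (\<tau> n (Suc k)) \<omega>)))"
      by (simp add: Z_def elementary_integral_increment inner_sum_right)
    also have "\<dots> = (\<Sum>k<N n. expectation (\<lambda>\<omega>. inner (G \<omega>) (L n k (increment (\<tau> n k) (\<tau> n (Suc k)) \<omega>))))"
      by (rule Bochner_Integration.integral_sum) (use * in blast)
    also have "\<dots> = 0" by (rule sum.neutral) (use * in blast)
    finally show ?thesis .
  qed
  \<comment> \<open>The sequence is constant in \<open>n\<close>; convergence to 0 therefore says
    that its value is 0.\<close>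
  have "(\<lambda>n::nat. expectation (\<lambda>\<omega>. inner (G \<omega>) (X \<omega>))) \<longlonglongrightarrow> 0"
  proof (rule tendsto_0_of_epsilon_bound[OF lim2 c c])
    fix \<epsilon> :: real and n assume \<epsilon>: "0 < \<epsilon>"
    have "ennreal \<bar>expectation (\<lambda>\<omega>. inner (G \<omega>) (X \<omega>))\<bar> = ennreal (norm (expectation (\<lambda>\<omega>. inner (G \<omega>) (Z n \<omega>) - inner (G \<omega>) (X \<omega>))))"
      by (simp add: Bochner_Integration.integral_diff[OF GZ_int GX_int] GZ)
    also have "\<dots> \<le> (\<integral>\<^sup>+\<omega>. norm (inner (G \<omega>) (Z n \<omega>) - inner (G \<omega>) (X \<omega>)) \<partial>M)"
      by (intro integral_norm_bound_ennreal Bochner_Integration.integrable_diff GZ_int GX_int)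
    also have "\<dots> \<le> (\<integral>\<^sup>+\<omega>. ennreal (c * (1 + 1 / \<epsilon>)) * ennreal ((norm (Z n \<omega> - X \<omega>))\<^sup>2) + ennreal (c * \<epsilon>) \<partial>M)"
    proof (rule nn_integral_mono)
      fix \<omega>
      let ?d = "norm (Z n \<omega> - X \<omega>)"
      have "norm (inner (G \<omega>) (Z n \<omega>) - inner (G \<omega>) (X \<omega>)) = \<bar>inner (G \<omega>) (Z n \<omega> - X \<omega>)\<bar>"
        by (simp add: inner_diff_right)
      also have "\<dots> \<le> c * ?d"
        using Cauchy_Schwarz_ineq2[of "G \<omega>" "Z n \<omega> - X \<omega>"] mult_right_mono[OF G(2)[of \<omega>] norm_ge_zero[of "Z n \<omega> - X \<omega>"]] by linarith
      \<comment> \<open>The first power of the distance is traded for its square plus \<epsilon>,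
        since the approximation is known in mean square only.\<close>
      also have "\<dots> \<le> c * ((1 + 1 / \<epsilon>) * ?d\<^sup>2 + \<epsilon>)"
      proof (rule mult_left_mono[OF _ c])
        have "0 \<le> (?d - \<epsilon>)\<^sup>2 / \<epsilon>" using \<epsilon> by simp
        also have "\<dots> = ?d\<^sup>2 / \<epsilon> + \<epsilon> - 2 * ?d" using \<epsilon> by (simp add: power2_eq_square field_simps)
        finally have "2 * ?d \<le> ?d\<^sup>2 / \<epsilon> + \<epsilon>" by simp
        moreover have "(1 + 1 / \<epsilon>) * ?d\<^sup>2 + \<epsilon> = ?d\<^sup>2 + (?d\<^sup>2 / \<epsilon> + \<epsilon>)" by (simp add: algebra_simps)
        ultimately show "?d \<le> (1 + 1 / \<epsilon>) * ?d\<^sup>2 + \<epsilon>" using norm_ge_zero[of "Z n \<omega> - X \<omega>"] zero_le_power2[of ?d] by linarith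
      qed
      also have "\<dots> = c * (1 + 1 / \<epsilon>) * ?d\<^sup>2 + c * \<epsilon>" by (simp add: algebra_simps)
      finally show "ennreal (norm (inner (G \<omega>) (Z n \<omega>) - inner (G \<omega>) (X \<omega>)))
        \<le> ennreal (c * (1 + 1 / \<epsilon>)) * ennreal ((norm (Z n \<omega> - X \<omega>))\<^sup>2) + ennreal (c * \<epsilon>)"
        using c \<epsilon> by (simp add: ennreal_mult[symmetric] ennreal_plus[symmetric] ennreal_leI del: ennreal_plus)
    qed
    also have "\<dots> = ennreal (c * (1 + 1 / \<epsilon>)) * (\<integral>\<^sup>+\<omega>. ennreal ((norm (Z n \<omega> - X \<omega>))\<^sup>2) \<partial>M) + ennreal (c * \<epsilon>)"
      by (subst nn_integral_add) (simp_all add: nn_integral_cmult emeasure_space_1)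
    finally show "ennreal \<bar>expectation (\<lambda>\<omega>. inner (G \<omega>) (X \<omega>))\<bar>
      \<le> ennreal (c * (1 + 1 / \<epsilon>)) * (\<integral>\<^sup>+\<omega>. ennreal ((norm (elementary_integral (N n) (\<tau> n) (L n) W \<omega> - X \<omega>))\<^sup>2) \<partial>M) + ennreal (c * \<epsilon>)"
      unfolding Z_def .
  qed
  then show ?thesis by (simp add: LIMSEQ_const_iff)
qed

end

section \<open>The stochastic convolution\<close>

locale schroedinger_convolution = wiener_process M F e Q R W
  for M :: "'w measure" and F and e :: "nat \<Rightarrow> 'd::finite l2" and Q R W +
  fixes S :: "real \<Rightarrow> 'd l2 \<Rightarrow> 'd l2" and t :: real and X :: "'w \<Rightarrow> 'd l2"
  assumes S: "schroedinger_group S"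
    and R_H1: "hilbert_schmidt_H1 e R"
    and t: "0 \<le> t"
    and X: "has_stochastic_integral M e R W (\<lambda>r. S (t - r)) t X"
begin

sublocale group: isometric_group S
  by (rule isometric_group_schroedinger[OF S])

lemmas X_measurable [measurable] = stochastic_integral_square_integrable(1)[OF X]
lemmas X_square_integrable = stochastic_integral_square_integrable(2)[OF X]

lemma isometry:
  fixes B :: "'d l2 \<Rightarrow> 'd l2 \<Rightarrow> real"
  assumes B: "bounded_bilinear B" "\<And>r x. B (S r x) (S r x) = B x x"
    and \<phi>: "\<phi> \<in> borel_measurable (F 0)" "\<And>\<omega>. \<bar>\<phi> \<omega>\<bar> \<le> c"
  shows "integrable M (\<lambda>\<omega>. \<phi> \<omega> * B (X \<omega>) (X \<omega>))"
    "expectation (\<lambda>\<omega>. \<phi> \<omega> * B (X \<omega>) (X \<omega>)) = expectation \<phi> * (t * (\<Sum>j. B (R (e j)) (R (e j))))"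
proof -
  have "(\<lambda>r. S (t - r) x) \<in> borel_measurable borel" for x
    by (intro borel_measurable_continuous_onI continuous_on_compose2[OF group.continuous[of x], of UNIV "\<lambda>r. t - r"])
      (auto intro!: continuous_on_diff continuous_on_const continuous_on_id)
  note * = stochastic_integral_isometry[OF X t B(1) \<phi> this group.norm_eq B(2)]
  show "integrable M (\<lambda>\<omega>. \<phi> \<omega> * B (X \<omega>) (X \<omega>))"
    "expectation (\<lambda>\<omega>. \<phi> \<omega> * B (X \<omega>) (X \<omega>)) = expectation \<phi> * (t * (\<Sum>j. B (R (e j)) (R (e j))))"
    by (rule *)+
qed

text \<open>An operator that commutes with the group makes the form (A x, A y) invariant. It is
  applied to difference quotients and to differences of two of them.\<close>

lemma isometry_norm2:
  assumes A: "bounded_linear A" "\<And>r x. A (S r x) = S r (A x)"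
    and \<phi>: "\<phi> \<in> borel_measurable (F 0)" "\<And>\<omega>. \<bar>\<phi> \<omega>\<bar> \<le> c"
  shows "integrable M (\<lambda>\<omega>. \<phi> \<omega> * (norm (A (X \<omega>)))\<^sup>2)"
    "expectation (\<lambda>\<omega>. \<phi> \<omega> * (norm (A (X \<omega>)))\<^sup>2) = expectation \<phi> * (t * (\<Sum>j. (norm (A (R (e j))))\<^sup>2))"
proof -
  have "bounded_bilinear (\<lambda>x y. inner (A x) (A y))"
    by (rule bounded_bilinear.comp[OF bounded_bilinear_inner A(1) A(1)])
  from isometry[OF this _ \<phi>]
  show "integrable M (\<lambda>\<omega>. \<phi> \<omega> * (norm (A (X \<omega>)))\<^sup>2)"
    "expectation (\<lambda>\<omega>. \<phi> \<omega> * (norm (A (X \<omega>)))\<^sup>2) = expectation \<phi> * (t * (\<Sum>j. (norm (A (R (e j))))\<^sup>2))"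
    by (simp_all add: A(2) group.isometric power2_norm_eq_inner)
qed

section \<open>Weak differentiability of the stochastic convolution\<close>

lemma R_weak_partial: "has_weak_partial i (R x) (weak_partial i (R x))"
  using R_H1 H1D unfolding hilbert_schmidt_H1_def by blast

lemma R_weak_partial_summable: "summable (\<lambda>j. (norm (weak_partial i (R (e j))))\<^sup>2)"
proof (rule summable_comparison_test)
  show "summable (\<lambda>j. (H1_norm (R (e j)))\<^sup>2)" using R_H1 by (simp add: hilbert_schmidt_H1_def)
  have "norm ((norm (weak_partial i u))\<^sup>2) \<le> (H1_norm u)\<^sup>2" for u :: "'d l2"
  proof -
    have "(norm (weak_partial i u))\<^sup>2 \<le> (\<Sum>i\<in>UNIV. (norm (weak_partial i u))\<^sup>2)"
      by (rule member_le_sum) auto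
    also have "\<dots> \<le> (H1_norm u)\<^sup>2" unfolding H1_norm_def by (simp add: sum_nonneg)
    finally show ?thesis by simp
  qed
  then show "\<exists>N. \<forall>j\<ge>N. norm ((norm (weak_partial i (R (e j))))\<^sup>2) \<le> (H1_norm (R (e j)))\<^sup>2" by blast
qed

lemma norm_dquot_R_le: "norm (dquot i (mesh n) (R x)) \<le> norm (weak_partial i (R x))"
  by (rule norm_dquot_le[OF R_weak_partial mesh_nonzero])

text \<open>Summed over \<open>j\<close> this is the squared Hilbert-Schmidt distance between
  quotient and weak derivative after \<open>R\<close>. The isometry converts it into mean square
  estimates for \<open>X\<close>.\<close>

definition defect :: "'d \<Rightarrow> nat \<Rightarrow> nat \<Rightarrow> real" where
  "defect i n j = (norm (dquot i (mesh n) (R (e j)) - weak_partial i (R (e j))))\<^sup>2"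

lemma defect_le: "norm (defect i n j) \<le> 4 * (norm (weak_partial i (R (e j))))\<^sup>2"
proof -
  have "norm (dquot i (mesh n) (R (e j)) - weak_partial i (R (e j))) \<le> 2 * norm (weak_partial i (R (e j)))"
    using norm_triangle_ineq4[of "dquot i (mesh n) (R (e j))" "weak_partial i (R (e j))"] norm_dquot_R_le[of i n "e j"]
    by linarith
  from power_mono[OF this norm_ge_zero, of 2] show ?thesis by (simp add: defect_def power_mult_distrib)
qed

lemma defect_summable: "summable (defect i n)"
  using summable_comparison_test[OF _ summable_mult[OF R_weak_partial_summable[of i], of 4]] defect_le by blast

lemma defect_tendsto: "(\<lambda>n. \<Sum>j. defect i n j) \<longlonglongrightarrow> 0"
proof -
  have "(\<lambda>n. defect i n j) \<longlonglongrightarrow> 0" for j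
  proof -
    have "(\<lambda>n. dquot i (mesh n) (R (e j))) \<longlonglongrightarrow> weak_partial i (R (e j))"
      using R_weak_partial[of i "e j"] by (simp add: has_weak_partial_iff_LIMSEQ)
    from tendsto_norm_zero[OF LIM_zero[OF this]]
    show ?thesis unfolding defect_def using tendsto_power[where n=2] by fastforce
  qed
  then show ?thesis
    using tannerys_theorem[of "\<lambda>j n. defect i n j" "\<lambda>_. 0" sequentially "\<lambda>j. 4 * (norm (weak_partial i (R (e j))))\<^sup>2"]
      defect_le summable_mult[OF R_weak_partial_summable[of i], of 4] by (simp add: case_prod_unfold)
qed

text \<open>The isometry for the difference of two quotients reduces the claim to the vectors
  \<open>R (e j)\<close>, where both quotients are compared with the weak derivative; the factors 2
  come from the square of a sum.\<close>

lemma X_quotient_increment: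
  fixes i n m
  defines "Y \<equiv> \<lambda>\<omega>. norm (dquot i (mesh n) (X \<omega>) - dquot i (mesh m) (X \<omega>))"
  shows "integrable M (\<lambda>\<omega>. (Y \<omega>)\<^sup>2)"
    "expectation (\<lambda>\<omega>. (Y \<omega>)\<^sup>2) \<le> 2 * (t * (\<Sum>j. defect i n j)) + 2 * (t * (\<Sum>j. defect i m j))"
proof -
  let ?A = "\<lambda>x. dquot i (mesh n) x - dquot i (mesh m) x"
  have A: "bounded_linear ?A" by (intro bounded_linear_sub bounded_linear_dquot)
  have "?A (S r x) = S r (?A x)" for r x
    by (simp add: schroedinger_dquot[OF S] group.group_diff)
  note * = isometry_norm2[OF A this, of "\<lambda>_. 1" 1]
  show "integrable M (\<lambda>\<omega>. (Y \<omega>)\<^sup>2)" using *(1) by (simp add: Y_def)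
  have "expectation (\<lambda>\<omega>. (Y \<omega>)\<^sup>2) = t * (\<Sum>j. (norm (?A (R (e j))))\<^sup>2)"
    using *(2) by (simp add: Y_def prob_space)
  also have "\<dots> \<le> t * (\<Sum>j. 2 * defect i n j + 2 * defect i m j)"
    by (intro mult_left_mono suminf_le summable_add summable_mult defect_summable summable_bounded_linear_norm2[OF A R_summable] t)
      (simp add: defect_def norm2_diff_le)
  also have "(\<Sum>j. 2 * defect i n j + 2 * defect i m j) = 2 * (\<Sum>j. defect i n j) + 2 * (\<Sum>j. defect i m j)"
    by (rule sums_unique[symmetric]) (intro sums_add sums_mult summable_sums defect_summable)
  finally show "expectation (\<lambda>\<omega>. (Y \<omega>)\<^sup>2) \<le> 2 * (t * (\<Sum>j. defect i n j)) + 2 * (t * (\<Sum>j. defect i m j))"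
    by (simp add: algebra_simps)
qed

text \<open>The difference quotients form a Cauchy sequence in mean square; a fast subsequence converges
  almost surely.\<close>

lemma X_weak_partial: "AE \<omega> in M. has_weak_partial i (X \<omega>) (weak_partial i (X \<omega>))"
proof -
  have "(\<lambda>n. t * (\<Sum>j. defect i n j)) \<longlonglongrightarrow> 0"
    using tendsto_mult_left[OF defect_tendsto[of i], of t] by simp
  \<comment> \<open>The rate (1/4)^k is chosen for squared distances, so that the distances
    themselves are of summable order (1/2)^k.\<close>
  then have "\<exists>N. \<forall>n\<ge>N. t * (\<Sum>j. defect i n j) < (1/4)^k" for k
    using order_tendstoD(2)[of _ 0 sequentially "(1/4)^k :: real"] by (auto simp: eventually_sequentially)
  then have "\<forall>k. \<exists>n\<ge>k. t * (\<Sum>j. defect i n j) < (1/4)^k" by (meson nat_le_linear order_trans)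
  then obtain r where r: "\<And>k. k \<le> r k" "\<And>k. t * (\<Sum>j. defect i (r k) j) < (1/4)^k" by metis
  define Y where "Y k \<omega> = norm (dquot i (mesh (r (Suc k))) (X \<omega>) - dquot i (mesh (r k)) (X \<omega>))" for k \<omega>
  have dq_meas [measurable]: "(\<lambda>\<omega>. dquot i (mesh n) (X \<omega>)) \<in> borel_measurable M" for n
    by (rule borel_measurable_bounded_linear[OF bounded_linear_dquot X_measurable])
  have Y_meas [measurable]: "Y k \<in> borel_measurable M" for k unfolding Y_def by measurable
  have Y_le: "(\<integral>\<^sup>+\<omega>. ennreal (Y k \<omega>) \<partial>M) \<le> ennreal (5 * (1/2)^k)" for k
  proof -
    have int: "integrable M (\<lambda>\<omega>. (Y k \<omega>)\<^sup>2)" unfolding Y_def by (rule X_quotient_increment(1))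
    have "expectation (\<lambda>\<omega>. (Y k \<omega>)\<^sup>2) \<le> 2 * (1/4)^(Suc k) + 2 * (1/4)^k"
      using X_quotient_increment(2)[of i "r (Suc k)" "r k"] r(2)[of k] r(2)[of "Suc k"] unfolding Y_def by linarith
    then have E: "expectation (\<lambda>\<omega>. (Y k \<omega>)\<^sup>2) \<le> 4 * (1/4)^k" 
      using zero_le_power[of "1/4::real" k] power_Suc[of "1/4::real" k] by linarith
    have "(\<integral>\<^sup>+\<omega>. ennreal (Y k \<omega>) \<partial>M) \<le> (\<integral>\<^sup>+\<omega>. ennreal ((1/2)^k + 2^k * (Y k \<omega>)\<^sup>2) \<partial>M)"
    proof (intro nn_integral_mono ennreal_leI)
      fix \<omega>
      \<comment> \<open>Completing the square with weight 2^k gives Y \<le> 2^(-k) + 2^k Y^2.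
        Together with the second moment bound 4 (1/4)^k this yields the constant 5 = 1 + 4.\<close>
      define p where "p = (2::real)^k"
      have p: "0 < p" by (simp add: p_def)
      have "0 \<le> (1 - p * Y k \<omega>)\<^sup>2 / p" using p by simp
      also have "\<dots> = 1 / p + p * (Y k \<omega>)\<^sup>2 - 2 * Y k \<omega>" using p by (simp add: power2_eq_square field_simps)
      finally have "2 * Y k \<omega> \<le> 1 / p + p * (Y k \<omega>)\<^sup>2" by simp
      moreover have "0 \<le> Y k \<omega>" by (simp add: Y_def)
      ultimately show "Y k \<omega> \<le> (1/2)^k + 2^k * (Y k \<omega>)\<^sup>2" by (simp add: p_def power_one_over)
    qed
    also have "\<dots> = ennreal (expectation (\<lambda>\<omega>. (1/2)^k + 2^k * (Y k \<omega>)\<^sup>2))"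
      using int by (intro nn_integral_eq_integral) auto
    also have "expectation (\<lambda>\<omega>. (1/2)^k + 2^k * (Y k \<omega>)\<^sup>2) = (1/2)^k + 2^k * expectation (\<lambda>\<omega>. (Y k \<omega>)\<^sup>2)"
      using int by (simp add: prob_space)
    also have "ennreal \<dots> \<le> ennreal (5 * (1/2)^k)"
    proof (rule ennreal_leI)
      have "2^k * expectation (\<lambda>\<omega>. (Y k \<omega>)\<^sup>2) \<le> 2^k * (4 * (1/4)^k)" using E by (intro mult_left_mono) auto
      also have "\<dots> = 4 * (2 * (1/4))^k" by (simp only: power_mult_distrib mult_ac)
      also have "\<dots> = 4 * (1/2::real)^k" by simp
      finally show "(1/2)^k + 2^k * expectation (\<lambda>\<omega>. (Y k \<omega>)\<^sup>2) \<le> 5 * (1/2)^k" by simp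
    qed
    finally show ?thesis .
  qed
  have "(\<integral>\<^sup>+\<omega>. (\<Sum>k. ennreal (Y k \<omega>)) \<partial>M) = (\<Sum>k. \<integral>\<^sup>+\<omega>. ennreal (Y k \<omega>) \<partial>M)"
    by (rule nn_integral_suminf) measurable
  also have "\<dots> \<le> (\<Sum>k. ennreal (5 * (1/2)^k))" by (intro suminf_le Y_le) auto
  also have "\<dots> = ennreal (\<Sum>k. 5 * (1/2)^k)" by (rule suminf_ennreal2) (auto intro: summable_mult)
  finally have "(\<integral>\<^sup>+\<omega>. (\<Sum>k. ennreal (Y k \<omega>)) \<partial>M) \<noteq> \<infinity>" by (auto simp: top_unique)
  then have "AE \<omega> in M. (\<Sum>k. ennreal (Y k \<omega>)) \<noteq> \<infinity>" by (intro nn_integral_PInf_AE) auto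
  then show ?thesis
  proof eventually_elim
    case (elim \<omega>)
    have "summable (\<lambda>k. Y k \<omega>)" by (rule summable_suminf_not_top) (use elim in \<open>auto simp: Y_def\<close>)
    then have "convergent (\<lambda>k. dquot i (mesh (r k)) (X \<omega>))"
      unfolding Y_def by (rule l2_summable_increments_convergent)
    then obtain g where g: "(\<lambda>k. dquot i (mesh (r k)) (X \<omega>)) \<longlonglongrightarrow> g" by (auto simp: convergent_def)
    \<comment> \<open>The indices need not increase: \<open>k \<le> r k\<close> already sends the
      steps to 0.\<close>
    have "filterlim r at_top sequentially"
      by (rule filterlim_at_top_mono[OF filterlim_ident]) (use r(1) in simp)
    then have "filterlim (\<lambda>k. mesh (r k)) (at 0) sequentially" by (rule filterlim_compose[OF filterlim_mesh])
    from has_weak_partial_limit[OF this sequentially_bot g]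
    have "has_weak_partial i (X \<omega>) g" .
    then show ?case using weak_partial_eqI[of i "X \<omega>" g] by simp
  qed
qed

text \<open>For each quotient the weighted isometry is exact, and the quotients of
  \<open>R (e j)\<close> are bounded by the weak derivatives; Fatou's lemma along the steps does the
  rest. The weight is what the cross term with a random initial value requires.\<close>

lemma X_energy:
  assumes \<phi>: "\<phi> \<in> borel_measurable (F 0)" "\<And>\<omega>. \<bar>\<phi> \<omega>\<bar> \<le> c" "\<And>\<omega>. 0 \<le> \<phi> \<omega>"
  shows "(\<integral>\<^sup>+\<omega>. ennreal (\<phi> \<omega> * (norm (weak_partial i (X \<omega>)))\<^sup>2) \<partial>M)
    \<le> ennreal (expectation \<phi> * (t * (\<Sum>j. (norm (weak_partial i (R (e j))))\<^sup>2)))"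
proof -
  let ?b = "expectation \<phi> * (t * (\<Sum>j. (norm (weak_partial i (R (e j))))\<^sup>2))"
  have [measurable]: "\<phi> \<in> borel_measurable M" by (rule measurable_filtration[OF order_refl \<phi>(1)])
  have [measurable]: "(\<lambda>\<omega>. dquot i (mesh n) (X \<omega>)) \<in> borel_measurable M" for n
    by (rule borel_measurable_bounded_linear[OF bounded_linear_dquot X_measurable])
  have "(\<integral>\<^sup>+\<omega>. ennreal (\<phi> \<omega> * (norm (weak_partial i (X \<omega>)))\<^sup>2) \<partial>M)
      = (\<integral>\<^sup>+\<omega>. liminf (\<lambda>n. ennreal (\<phi> \<omega> * (norm (dquot i (mesh n) (X \<omega>)))\<^sup>2)) \<partial>M)"
  proof (rule nn_integral_cong_AE)
    show "AE \<omega> in M. ennreal (\<phi> \<omega> * (norm (weak_partial i (X \<omega>)))\<^sup>2)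
        = liminf (\<lambda>n. ennreal (\<phi> \<omega> * (norm (dquot i (mesh n) (X \<omega>)))\<^sup>2))"
      using X_weak_partial[of i]
    proof eventually_elim
      case (elim \<omega>)
      then have "(\<lambda>n. dquot i (mesh n) (X \<omega>)) \<longlonglongrightarrow> weak_partial i (X \<omega>)"
        by (simp add: has_weak_partial_iff_LIMSEQ)
      then have "(\<lambda>n. ennreal (\<phi> \<omega> * (norm (dquot i (mesh n) (X \<omega>)))\<^sup>2)) \<longlonglongrightarrow> ennreal (\<phi> \<omega> * (norm (weak_partial i (X \<omega>)))\<^sup>2)"
        by (intro tendsto_ennrealI tendsto_mult tendsto_const tendsto_power tendsto_norm)
      then show ?case by (intro lim_imp_Liminf[symmetric]) auto
    qed
  qed
  also have "\<dots> \<le> liminf (\<lambda>n. \<integral>\<^sup>+\<omega>. ennreal (\<phi> \<omega> * (norm (dquot i (mesh n) (X \<omega>)))\<^sup>2) \<partial>M)"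
    by (rule nn_integral_liminf) measurable
  also have "\<dots> \<le> liminf (\<lambda>n::nat. ennreal ?b)"
  proof (intro Liminf_mono always_eventually allI)
    fix n
    note * = isometry_norm2[OF bounded_linear_dquot[of i "mesh n"] schroedinger_dquot[OF S, symmetric] \<phi>(1,2)]
    have "(\<integral>\<^sup>+\<omega>. ennreal (\<phi> \<omega> * (norm (dquot i (mesh n) (X \<omega>)))\<^sup>2) \<partial>M)
        = ennreal (expectation \<phi> * (t * (\<Sum>j. (norm (dquot i (mesh n) (R (e j))))\<^sup>2)))"
      unfolding *(2)[symmetric] using *(1) \<phi>(3) by (intro nn_integral_eq_integral) auto
    also have "\<dots> \<le> ennreal ?b"
      by (intro ennreal_leI mult_left_mono suminf_le t integral_nonneg_AE R_weak_partial_summable power_mono norm_dquot_R_le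
          summable_bounded_linear_norm2[OF bounded_linear_dquot R_summable]) (use \<phi>(3) in auto)
    finally show "(\<integral>\<^sup>+\<omega>. ennreal (\<phi> \<omega> * (norm (dquot i (mesh n) (X \<omega>)))\<^sup>2) \<partial>M) \<le> ennreal ?b" .
  qed
  also have "\<dots> = ennreal ?b" by (simp add: Liminf_const)
  finally show ?thesis .
qed

lemma weak_partial_X_measurable [measurable]: "(\<lambda>\<omega>. weak_partial i (X \<omega>)) \<in> borel_measurable M"
  by measurable

lemma weak_partial_X_square_integrable: "integrable M (\<lambda>\<omega>. (norm (weak_partial i (X \<omega>)))\<^sup>2)"
proof -
  have "(\<integral>\<^sup>+\<omega>. ennreal ((norm (weak_partial i (X \<omega>)))\<^sup>2) \<partial>M) < \<infinity>"
    using X_energy[of "\<lambda>_. 1" 1 i] by (auto intro: le_less_trans)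
  then show ?thesis by (simp add: integrable_iff_bounded)
qed

text \<open>The isometry applies to the bounded form (u, \<i> D v) with D a difference quotient,
  invariant because the group commutes with \<i> and D. The limit is dominated by |X| |weak
  derivative of X| under the expectation and by a summable sequence in the trace.\<close>

lemma momentum_X:
  "integrable M (\<lambda>\<omega>. momentum (X \<omega>) $ i)"
  "expectation (\<lambda>\<omega>. momentum (X \<omega>) $ i) = - 2 * (t * (\<Sum>j. inner (R (e j)) (cscale \<i> (weak_partial i (R (e j))))))"
proof -
  let ?I = "\<lambda>u v. inner u (cscale \<i> v)"
  have I_le: "norm (?I u v) \<le> norm u * norm v" for u v :: "'d l2"
    using Cauchy_Schwarz_ineq2[of u "cscale \<i> v"] by (simp add: norm_cscale)
  have dom: "integrable M (\<lambda>\<omega>. norm (X \<omega>) * norm (weak_partial i (X \<omega>)))"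
    by (rule integrable_norm_mult[OF X_measurable weak_partial_X_measurable X_square_integrable weak_partial_X_square_integrable])
  have I_meas: "(\<lambda>\<omega>. ?I (X \<omega>) (g \<omega>)) \<in> borel_measurable M" if [measurable]: "g \<in> borel_measurable M" for g
    using borel_measurable_bounded_linear[OF bounded_linear_cscale that, of \<i>] by measurable
  have I_int: "integrable M (\<lambda>\<omega>. ?I (X \<omega>) (weak_partial i (X \<omega>)))"
    by (rule Bochner_Integration.integrable_bound[OF dom I_meas]) (use I_le in \<open>auto simp: abs_mult\<close>)
  show "integrable M (\<lambda>\<omega>. momentum (X \<omega>) $ i)" unfolding momentum_nth using I_int by simp
  let ?D = "\<lambda>n. dquot i (mesh n)"
  have lim1: "(\<lambda>n. expectation (\<lambda>\<omega>. ?I (X \<omega>) (?D n (X \<omega>)))) \<longlonglongrightarrow> expectation (\<lambda>\<omega>. ?I (X \<omega>) (weak_partial i (X \<omega>)))"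
  proof (rule integral_dominated_convergence[OF _ _ dom])
    show "(\<lambda>\<omega>. ?I (X \<omega>) (weak_partial i (X \<omega>))) \<in> borel_measurable M" by (rule I_meas) measurable
    show "(\<lambda>\<omega>. ?I (X \<omega>) (?D n (X \<omega>))) \<in> borel_measurable M" for n
      by (rule I_meas, rule borel_measurable_bounded_linear[OF bounded_linear_dquot X_measurable])
    show "AE \<omega> in M. (\<lambda>n. ?I (X \<omega>) (?D n (X \<omega>))) \<longlonglongrightarrow> ?I (X \<omega>) (weak_partial i (X \<omega>))"
      using X_weak_partial[of i]
      by eventually_elim (intro tendsto_inner tendsto_const bounded_linear.tendsto[OF bounded_linear_cscale], simp add: has_weak_partial_iff_LIMSEQ)
    show "AE \<omega> in M. norm (?I (X \<omega>) (?D n (X \<omega>))) \<le> norm (X \<omega>) * norm (weak_partial i (X \<omega>))" for n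
      using X_weak_partial[of i]
    proof eventually_elim
      case (elim \<omega>)
      show ?case
        using I_le[of "X \<omega>" "?D n (X \<omega>)"] mult_left_mono[OF norm_dquot_le[OF elim mesh_nonzero[of n]] norm_ge_zero[of "X \<omega>"]]
        by linarith
    qed
  qed
  have iso: "expectation (\<lambda>\<omega>. ?I (X \<omega>) (?D n (X \<omega>))) = t * (\<Sum>j. ?I (R (e j)) (?D n (R (e j))))" for n
  proof -
    have "bounded_bilinear (\<lambda>u v. ?I u (?D n v))"
      by (rule bounded_bilinear.comp[OF bounded_bilinear_inner bounded_linear_ident
            bounded_linear_compose[OF bounded_linear_cscale bounded_linear_dquot]])
    moreover have "?I (S r x) (?D n (S r x)) = ?I x (?D n x)" for r x
    proof -
      have "cscale \<i> (S r y) = S r (cscale \<i> y)" for y using S by (simp add: schroedinger_group_def)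
      then show ?thesis by (simp add: schroedinger_dquot[OF S, symmetric] group.isometric)
    qed
    ultimately show ?thesis using isometry(2)[of "\<lambda>u v. ?I u (?D n v)" "\<lambda>_. 1" 1] by (simp add: prob_space)
  qed
  have "(\<lambda>n. \<Sum>j. ?I (R (e j)) (?D n (R (e j)))) \<longlonglongrightarrow> (\<Sum>j. ?I (R (e j)) (weak_partial i (R (e j))))"
  proof -
    let ?m = "\<lambda>j. (norm (R (e j)))\<^sup>2 + (norm (weak_partial i (R (e j))))\<^sup>2"
    have "norm (?I (R (e j)) (?D n (R (e j)))) \<le> ?m j" for n j
    proof -
      have "norm (?I (R (e j)) (?D n (R (e j)))) \<le> norm (R (e j)) * norm (weak_partial i (R (e j)))"
        using I_le[of "R (e j)" "?D n (R (e j))"] mult_left_mono[OF norm_dquot_R_le[of i n "e j"] norm_ge_zero[of "R (e j)"]]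
        by linarith
      also have "\<dots> \<le> ?m j"
        using sum_squares_bound[of "norm (R (e j))" "norm (weak_partial i (R (e j)))"]
          mult_nonneg_nonneg[OF norm_ge_zero[of "R (e j)"] norm_ge_zero[of "weak_partial i (R (e j))"]] by linarith
      finally show ?thesis .
    qed
    moreover have "(\<lambda>n. ?I (R (e j)) (?D n (R (e j)))) \<longlonglongrightarrow> ?I (R (e j)) (weak_partial i (R (e j)))" for j
      using R_weak_partial[of i "e j"]
      by (intro tendsto_inner tendsto_const bounded_linear.tendsto[OF bounded_linear_cscale]) (simp add: has_weak_partial_iff_LIMSEQ)
    moreover have "summable ?m" by (intro summable_add R_summable R_weak_partial_summable)
    ultimately show ?thesis
      using tannerys_theorem[of "\<lambda>j n. ?I (R (e j)) (?D n (R (e j)))" "\<lambda>j. ?I (R (e j)) (weak_partial i (R (e j)))" sequentially ?m]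
      by (simp add: case_prod_unfold)
  qed
  from tendsto_mult_left[OF this, of t]
  have "(\<lambda>n. expectation (\<lambda>\<omega>. ?I (X \<omega>) (?D n (X \<omega>)))) \<longlonglongrightarrow> t * (\<Sum>j. ?I (R (e j)) (weak_partial i (R (e j))))"
    unfolding iso .
  from LIMSEQ_unique[OF lim1 this]
  show "expectation (\<lambda>\<omega>. momentum (X \<omega>) $ i) = - 2 * (t * (\<Sum>j. inner (R (e j)) (cscale \<i> (weak_partial i (R (e j))))))"
    unfolding momentum_nth by simp
qed

end

section \<open>The evolution of the momentum\<close>

lemma integrable_vec:
  fixes f :: "'a \<Rightarrow> real^'d::finite"
  assumes "\<And>i. integrable M (\<lambda>x. f x $ i)"
  shows "integrable M f"
proof -
  have "f = (\<lambda>x. \<Sum>i\<in>UNIV. (f x $ i) *\<^sub>R axis i 1)"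
    by (simp add: basis_expansion scalar_mult_eq_scaleR[symmetric])
  moreover have "integrable M (\<lambda>x. \<Sum>i\<in>UNIV. (f x $ i) *\<^sub>R (axis i 1 :: real^'d))"
    using assms by (intro Bochner_Integration.integrable_sum integrable_scaleR_left) auto
  ultimately show ?thesis by simp
qed

context schroedinger_convolution
begin

text \<open>The cross term comes from integration by parts and the isometry of the group.\<close>

lemma momentum_mild:
  assumes a: "has_weak_partial i a a'" and x: "has_weak_partial i x x'"
  shows "momentum (S t a - cscale \<i> x) $ i = momentum a $ i + momentum x $ i + 4 * inner (S t a') x"
    "has_weak_partial i (S t a - cscale \<i> x) (S t a' - cscale \<i> x')"
proof -
  have neg: "- cscale \<i> y = cscale (- \<i>) y" for y :: "'d l2"
    using cscale_cscale[of "- 1" \<i> y] cscale_of_real[of "- 1" "cscale \<i> y"] by simp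
  note Sa = schroedinger_weak_partial[OF S a, of t]
  show D: "has_weak_partial i (S t a - cscale \<i> x) (S t a' - cscale \<i> x')"
    using has_weak_partial_add[OF Sa has_weak_partial_cscale[OF x, of "- \<i>"]] by (simp add: neg[symmetric])
  have S\<i>: "cscale \<i> (S t y) = S t (cscale \<i> y)" for y using S by (simp add: schroedinger_group_def)
  have ii: "cscale \<i> (cscale \<i> y) = - y" for y :: "'d l2"
    using cscale_of_real[of "- 1" y] by (simp add: cscale_cscale)
  have "inner (S t a - cscale \<i> x) (cscale \<i> (S t a' - cscale \<i> x'))
      = inner (S t a - cscale \<i> x) (cscale \<i> (S t a') + x')"
    by (simp add: linear_diff[OF bounded_linear.linear[OF bounded_linear_cscale]] ii)
  \<comment> \<open>Of these four terms the two mixed ones each contribute -(S t a', x), the first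
    after integration by parts. The prefactor -2 of the momentum turns their sum into the
    coefficient 4.\<close>
  also have "\<dots> = inner (S t a) (cscale \<i> (S t a')) + inner (S t a) x'
      - inner (cscale \<i> x) (cscale \<i> (S t a')) - inner (cscale \<i> x) x'"
    by (simp add: inner_diff_left inner_add_right)
  also have "inner (S t a) (cscale \<i> (S t a')) = inner a (cscale \<i> a')" by (simp add: S\<i> group.isometric)
  also have "inner (S t a) x' = - inner (S t a') x" using inner_weak_partial_left[OF Sa x] by simp
  also have "inner (cscale \<i> x) (cscale \<i> (S t a')) = inner (S t a') x" by (simp add: inner_ii_ii inner_commute)
  also have "inner (cscale \<i> x) x' = - inner x (cscale \<i> x')" by (rule inner_ii_left)
  finally have "inner (S t a - cscale \<i> x) (cscale \<i> (S t a' - cscale \<i> x'))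
      = inner a (cscale \<i> a') + inner x (cscale \<i> x') - 2 * inner (S t a') x" by simp
  then show "momentum (S t a - cscale \<i> x) $ i = momentum a $ i + momentum x $ i + 4 * inner (S t a') x"
    unfolding momentum_nth weak_partial_eqI[OF D] weak_partial_eqI[OF a] weak_partial_eqI[OF x] by simp
qed

lemma cross_term_measurable:
  assumes "u0 \<in> borel_measurable (F 0)"
  shows "(\<lambda>\<omega>. S t (weak_partial i (u0 \<omega>))) \<in> borel_measurable (F 0)"
  by (rule borel_measurable_bounded_linear[OF group.bounded_linear_group
        measurable_compose[OF assms borel_measurable_weak_partial]])

text \<open>No moment of the gradient of \<open>u0\<close> is available, so the derivative is moved
  to \<open>X\<close>: the term is at most |u0| |d| \<le> |u0| (1 + |d|^2), with d the weak
  derivative of \<open>X\<close>. The energy bound with the weight min(|u0|, n), bounded and known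
  at time 0, controls the product uniformly in \<open>n\<close>, and monotone convergence removes
  the truncation.\<close>

lemma cross_term_integrable:
  assumes u0: "u0 \<in> borel_measurable (F 0)" "AE \<omega> in M. u0 \<omega> \<in> H1" "integrable M (\<lambda>\<omega>. norm (u0 \<omega>))"
  shows "integrable M (\<lambda>\<omega>. inner (S t (weak_partial i (u0 \<omega>))) (X \<omega>))"
proof -
  have [measurable]: "u0 \<in> borel_measurable M" by (rule measurable_filtration[OF order_refl u0(1)])
  have [measurable]: "(\<lambda>\<omega>. S t (weak_partial i (u0 \<omega>))) \<in> borel_measurable M"
    by (rule measurable_filtration[OF order_refl cross_term_measurable[OF u0(1)]])
  let ?c = "t * (\<Sum>j. (norm (weak_partial i (R (e j))))\<^sup>2)"
  let ?D = "\<lambda>\<omega>. (norm (weak_partial i (X \<omega>)))\<^sup>2"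
  have c: "0 \<le> ?c" using t by (intro mult_nonneg_nonneg suminf_nonneg R_weak_partial_summable) auto
  have "(\<integral>\<^sup>+\<omega>. ennreal (min (norm (u0 \<omega>)) (real n) * ?D \<omega>) \<partial>M) \<le> ennreal (expectation (\<lambda>\<omega>. norm (u0 \<omega>)) * ?c)" for n
  proof -
    have "(\<integral>\<^sup>+\<omega>. ennreal (min (norm (u0 \<omega>)) (real n) * ?D \<omega>) \<partial>M) \<le> ennreal (expectation (\<lambda>\<omega>. min (norm (u0 \<omega>)) (real n)) * ?c)"
      by (rule X_energy[of _ "real n"]) (use u0(1) in \<open>auto simp: min_def\<close>)
    also have "\<dots> \<le> ennreal (expectation (\<lambda>\<omega>. norm (u0 \<omega>)) * ?c)"
    proof (intro ennreal_leI mult_right_mono c integral_mono)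
      show "integrable M (\<lambda>\<omega>. min (norm (u0 \<omega>)) (real n))"
        by (rule Bochner_Integration.integrable_bound[OF u0(3)]) auto
    qed (use u0(3) in auto)
    finally show ?thesis .
  qed
  then have bound: "(SUP n. \<integral>\<^sup>+\<omega>. ennreal (min (norm (u0 \<omega>)) (real n) * ?D \<omega>) \<partial>M) \<le> ennreal (expectation (\<lambda>\<omega>. norm (u0 \<omega>)) * ?c)"
    by (intro SUP_least)
  have "(\<integral>\<^sup>+\<omega>. ennreal (norm (u0 \<omega>) * ?D \<omega>) \<partial>M) \<le> (\<integral>\<^sup>+\<omega>. (SUP n. ennreal (min (norm (u0 \<omega>)) (real n) * ?D \<omega>)) \<partial>M)"
  proof (rule nn_integral_mono)
    fix \<omega>
    obtain n :: nat where n: "norm (u0 \<omega>) \<le> real n" using real_arch_simple by blast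
    show "ennreal (norm (u0 \<omega>) * ?D \<omega>) \<le> (SUP n. ennreal (min (norm (u0 \<omega>)) (real n) * ?D \<omega>))"
      by (rule SUP_upper2[of n]) (use n in \<open>auto simp: min_def\<close>)
  qed
  also have "\<dots> = (SUP n. \<integral>\<^sup>+\<omega>. ennreal (min (norm (u0 \<omega>)) (real n) * ?D \<omega>) \<partial>M)"
    by (rule nn_integral_monotone_convergence_SUP)
      (auto simp: incseq_def le_fun_def intro!: ennreal_leI mult_right_mono)
  also have "\<dots> < \<infinity>" using bound by (rule le_less_trans) simp
  finally have "integrable M (\<lambda>\<omega>. norm (u0 \<omega>) * ?D \<omega>)" by (simp add: integrable_iff_bounded)
  then have dom: "integrable M (\<lambda>\<omega>. norm (u0 \<omega>) + norm (u0 \<omega>) * ?D \<omega>)" using u0(3) by simp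
  show ?thesis
  proof (rule Bochner_Integration.integrable_bound[OF dom])
    show "(\<lambda>\<omega>. inner (S t (weak_partial i (u0 \<omega>))) (X \<omega>)) \<in> borel_measurable M" by measurable
    show "AE \<omega> in M. norm (inner (S t (weak_partial i (u0 \<omega>))) (X \<omega>)) \<le> norm (norm (u0 \<omega>) + norm (u0 \<omega>) * ?D \<omega>)"
      using u0(2) X_weak_partial[of i]
    proof eventually_elim
      case (elim \<omega>)
      let ?d = "norm (weak_partial i (X \<omega>))"
      have "\<bar>inner (S t (weak_partial i (u0 \<omega>))) (X \<omega>)\<bar> = \<bar>inner (S t (u0 \<omega>)) (weak_partial i (X \<omega>))\<bar>"
        using inner_weak_partial_left[OF schroedinger_weak_partial[OF S H1D[OF elim(1)]] elim(2)] by simp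
      also have "\<dots> \<le> norm (u0 \<omega>) * ?d"
        using Cauchy_Schwarz_ineq2[of "S t (u0 \<omega>)" "weak_partial i (X \<omega>)"] by simp
      also have "\<dots> \<le> norm (u0 \<omega>) * (1 + ?d\<^sup>2)"
      proof (rule mult_left_mono)
        have "0 \<le> ?d\<^sup>2 + 1 - 2 * ?d" using zero_le_power2[of "?d - 1"] by (simp add: power2_diff)
        then show "?d \<le> 1 + ?d\<^sup>2" using norm_ge_zero[of "weak_partial i (X \<omega>)"] by linarith
      qed simp
      finally show ?case by (simp add: algebra_simps)
    qed
  qed
qed

text \<open>The stochastic integral is orthogonal to bounded variables known at time 0. The
  hypothesis \<open>int\<close> furnishes the dominating function that extends this to the unbounded
  factor.\<close>

lemma cross_term_expectation:
  assumes u0: "u0 \<in> borel_measurable (F 0)"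
    and int: "integrable M (\<lambda>\<omega>. inner (S t (weak_partial i (u0 \<omega>))) (X \<omega>))"
  shows "expectation (\<lambda>\<omega>. inner (S t (weak_partial i (u0 \<omega>))) (X \<omega>)) = 0"
proof -
  define G where "G \<omega> = S t (weak_partial i (u0 \<omega>))" for \<omega>
  \<comment> \<open>Cutting to 0 rather than rescaling keeps each pairing with \<open>X\<close>
    equal either to the full one or to 0, hence dominated by it and eventually equal to it.\<close>
  define Gn where "Gn n \<omega> = (if norm (G \<omega>) \<le> real n then G \<omega> else 0)" for n \<omega>
  have G: "G \<in> borel_measurable (F 0)" unfolding G_def by (rule cross_term_measurable[OF u0])
  have Gn: "Gn n \<in> borel_measurable (F 0)" for n unfolding Gn_def using G by measurable
  have [measurable]: "Gn n \<in> borel_measurable M" "G \<in> borel_measurable M" for n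
    by (rule measurable_filtration[OF order_refl Gn], rule measurable_filtration[OF order_refl G])
  have int': "integrable M (\<lambda>\<omega>. inner (G \<omega>) (X \<omega>))" using int by (simp add: G_def)
  have "(\<lambda>n. expectation (\<lambda>\<omega>. inner (Gn n \<omega>) (X \<omega>))) \<longlonglongrightarrow> expectation (\<lambda>\<omega>. inner (G \<omega>) (X \<omega>))"
  proof (rule integral_dominated_convergence[OF _ _ integrable_norm[OF int']])
    show "AE \<omega> in M. (\<lambda>n. inner (Gn n \<omega>) (X \<omega>)) \<longlonglongrightarrow> inner (G \<omega>) (X \<omega>)"
    proof (rule AE_I2)
      fix \<omega>
      obtain m :: nat where "norm (G \<omega>) \<le> real m" using real_arch_simple by blast
      then have "eventually (\<lambda>n. inner (Gn n \<omega>) (X \<omega>) = inner (G \<omega>) (X \<omega>)) sequentially"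
        by (intro eventually_sequentiallyI[of m]) (simp add: Gn_def order_trans)
      then show "(\<lambda>n. inner (Gn n \<omega>) (X \<omega>)) \<longlonglongrightarrow> inner (G \<omega>) (X \<omega>)" by (rule tendsto_eventually)
    qed
    show "AE \<omega> in M. norm (inner (Gn n \<omega>) (X \<omega>)) \<le> norm (inner (G \<omega>) (X \<omega>))" for n
      by (intro AE_I2) (simp add: Gn_def)
  qed measurable
  moreover have "expectation (\<lambda>\<omega>. inner (Gn n \<omega>) (X \<omega>)) = 0" for n
    by (rule stochastic_integral_centred[OF X Gn, of _ "real n"]) (simp add: Gn_def)
  ultimately show ?thesis by (simp add: LIMSEQ_const_iff G_def)
qed

lemma Im_hs_cinner:
  "Im (hs_cinner e R (\<lambda>h. weak_partial i (R h))) = (\<Sum>j. inner (R (e j)) (cscale \<i> (weak_partial i (R (e j)))))"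
proof -
  have "summable (\<lambda>j. cinner (R (e j)) (weak_partial i (R (e j))))"
  proof (rule summable_comparison_test)
    have "norm (cinner (R (e j)) (weak_partial i (R (e j)))) \<le> (norm (R (e j)))\<^sup>2 + (norm (weak_partial i (R (e j))))\<^sup>2" for j
      using cmod_cinner_le[of "R (e j)" "weak_partial i (R (e j))"]
        sum_squares_bound[of "norm (R (e j))" "norm (weak_partial i (R (e j)))"] by linarith
    then show "\<exists>N. \<forall>j\<ge>N. norm (cinner (R (e j)) (weak_partial i (R (e j)))) \<le> (norm (R (e j)))\<^sup>2 + (norm (weak_partial i (R (e j))))\<^sup>2"
      by blast
    show "summable (\<lambda>j. (norm (R (e j)))\<^sup>2 + (norm (weak_partial i (R (e j))))\<^sup>2)"
      by (intro summable_add R_summable R_weak_partial_summable)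
  qed
  from bounded_linear.suminf[OF bounded_linear_Im this]
  show ?thesis by (simp add: hs_cinner_def Im_cinner)
qed

text \<open>Integrability of the cross term is reached in two ways: in the second claim from the
  first moment of \<open>u0\<close>, in the third from the integrability of the three momenta in the
  pointwise identity \<open>eq\<close>.\<close>

lemma momentum_evolution:
  assumes u0: "u0 \<in> borel_measurable (F 0)" "AE \<omega> in M. u0 \<omega> \<in> H1" "integrable M (\<lambda>\<omega>. momentum (u0 \<omega>))"
    and v: "v \<in> borel_measurable M" "AE \<omega> in M. v \<omega> = S t (u0 \<omega>) - cscale \<i> (X \<omega>)"
  shows "AE \<omega> in M. v \<omega> \<in> H1"
    "integrable M (\<lambda>\<omega>. norm (u0 \<omega>)) \<Longrightarrow> integrable M (\<lambda>\<omega>. momentum (v \<omega>))"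
    "integrable M (\<lambda>\<omega>. momentum (v \<omega>)) \<Longrightarrow> (\<integral>\<omega>. momentum (v \<omega>) \<partial>M) = (\<integral>\<omega>. momentum (u0 \<omega>) \<partial>M)
      - (2 * t) *\<^sub>R (\<chi> i. Im (hs_cinner e R (\<lambda>h. weak_partial i (R h))))"
proof -
  let ?C = "\<lambda>i \<omega>. inner (S t (weak_partial i (u0 \<omega>))) (X \<omega>)"
  have X_all: "AE \<omega> in M. \<forall>i\<in>UNIV. has_weak_partial i (X \<omega>) (weak_partial i (X \<omega>))"
    by (rule AE_finite_allI) (use X_weak_partial in auto)
  show "AE \<omega> in M. v \<omega> \<in> H1"
    using v(2) u0(2) X_all
  proof eventually_elim
    case (elim \<omega>)
    then have "has_weak_partial i (v \<omega>) (S t (weak_partial i (u0 \<omega>)) - cscale \<i> (weak_partial i (X \<omega>)))" for i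
      using momentum_mild(2)[OF H1D] by simp
    then show ?case unfolding H1_def by blast
  qed
  have eq: "AE \<omega> in M. momentum (v \<omega>) $ i = momentum (u0 \<omega>) $ i + momentum (X \<omega>) $ i + 4 * ?C i \<omega>" for i
    using v(2) u0(2) X_weak_partial[of i]
  proof eventually_elim
    case (elim \<omega>)
    show ?case unfolding elim(1) by (rule momentum_mild(1)[OF H1D[OF elim(2)] elim(3)])
  qed
  have u0_int: "integrable M (\<lambda>\<omega>. momentum (u0 \<omega>) $ i)" for i
    by (rule integrable_bounded_linear[OF bounded_linear_vec_nth u0(3)])
  have [measurable]: "(\<lambda>\<omega>. momentum (v \<omega>) $ i) \<in> borel_measurable M" for i
    using measurable_compose[OF v(1) borel_measurable_momentum]
    by (rule borel_measurable_bounded_linear[OF bounded_linear_vec_nth])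
  have C_meas [measurable]: "?C i \<in> borel_measurable M" for i
    using measurable_filtration[OF order_refl cross_term_measurable[OF u0(1)]] by measurable
  have meas: "(\<lambda>\<omega>. momentum (u0 \<omega>) $ i) \<in> borel_measurable M" "(\<lambda>\<omega>. momentum (X \<omega>) $ i) \<in> borel_measurable M" for i
    using u0_int momentum_X(1) by (simp_all add: borel_measurable_integrable)
  show "integrable M (\<lambda>\<omega>. momentum (v \<omega>))" if "integrable M (\<lambda>\<omega>. norm (u0 \<omega>))"
  proof (rule integrable_vec)
    fix i
    have "integrable M (\<lambda>\<omega>. momentum (u0 \<omega>) $ i + momentum (X \<omega>) $ i + 4 * ?C i \<omega>)"
      using u0_int momentum_X(1) cross_term_integrable[OF u0(1,2) that] by simp
    then show "integrable M (\<lambda>\<omega>. momentum (v \<omega>) $ i)"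
      by (subst integrable_cong_AE[OF _ _ eq]) (use meas in measurable)
  qed
  show "(\<integral>\<omega>. momentum (v \<omega>) \<partial>M) = (\<integral>\<omega>. momentum (u0 \<omega>) \<partial>M)
      - (2 * t) *\<^sub>R (\<chi> i. Im (hs_cinner e R (\<lambda>h. weak_partial i (R h))))"
    if int: "integrable M (\<lambda>\<omega>. momentum (v \<omega>))"
  proof (rule vec_eq_iff[THEN iffD2], rule allI)
    fix i
    have v_int: "integrable M (\<lambda>\<omega>. momentum (v \<omega>) $ i)"
      by (rule integrable_bounded_linear[OF bounded_linear_vec_nth int])
    \<comment> \<open>The cross term is recovered as a difference of integrable functions, which is
      what \<open>cross_term_expectation\<close> asks for.\<close>
    have diff_int: "integrable M (\<lambda>\<omega>. momentum (v \<omega>) $ i - momentum (u0 \<omega>) $ i - momentum (X \<omega>) $ i)"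
      using v_int u0_int momentum_X(1) by simp
    have diff_eq: "AE \<omega> in M. momentum (v \<omega>) $ i - momentum (u0 \<omega>) $ i - momentum (X \<omega>) $ i = 4 * ?C i \<omega>"
      using eq[of i] by eventually_elim simp
    have "integrable M (\<lambda>\<omega>. 4 * ?C i \<omega>)"
      by (rule integrable_cong_AE_imp[OF diff_int _ diff_eq]) measurable
    then have C_int: "integrable M (?C i)" by simp
    have "(\<integral>\<omega>. momentum (v \<omega>) \<partial>M) $ i = (\<integral>\<omega>. momentum (v \<omega>) $ i \<partial>M)"
      by (rule integral_bounded_linear[OF bounded_linear_vec_nth int, symmetric])
    also have "\<dots> = (\<integral>\<omega>. momentum (u0 \<omega>) $ i + momentum (X \<omega>) $ i + 4 * ?C i \<omega> \<partial>M)"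
      by (rule integral_cong_AE[OF _ _ eq]) (use meas in measurable)
    also have "\<dots> = (\<integral>\<omega>. momentum (u0 \<omega>) $ i \<partial>M) + (\<integral>\<omega>. momentum (X \<omega>) $ i \<partial>M)"
      using u0_int momentum_X(1) C_int cross_term_expectation[OF u0(1) C_int] by simp
    also have "(\<integral>\<omega>. momentum (u0 \<omega>) $ i \<partial>M) = (\<integral>\<omega>. momentum (u0 \<omega>) \<partial>M) $ i"
      by (rule integral_bounded_linear[OF bounded_linear_vec_nth u0(3)])
    finally show "(\<integral>\<omega>. momentum (v \<omega>) \<partial>M) $ i = ((\<integral>\<omega>. momentum (u0 \<omega>) \<partial>M)
      - (2 * t) *\<^sub>R (\<chi> i. Im (hs_cinner e R (\<lambda>h. weak_partial i (R h))))) $ i"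
      by (simp add: momentum_X(2) Im_hs_cinner)
  qed
qed

end

text \<open>The Bochner integral of a function that is not integrable has the default value 0. The
  identity is therefore stated where p(u(t)) is integrable, together with the first moment of
  \<open>u0\<close> as a sufficient condition and with the membership in \<open>H1\<close> that
  gives p(u(t)) its meaning.\<close>

theorem proposition3p9:
  fixes M :: "'w measure" and F :: "real \<Rightarrow> 'w measure"
    and e :: "nat \<Rightarrow> 'd::finite l2"
    and Q Qhalf :: "'d l2 \<Rightarrow> 'd l2"
    and W u :: "real \<Rightarrow> 'w \<Rightarrow> 'd l2" and u0 :: "'w \<Rightarrow> 'd l2"
    and S :: "real \<Rightarrow> 'd l2 \<Rightarrow> 'd l2"
  assumes "normal_filtration M F"
    and "orthonormal_basis e"
    and "nonneg_selfadjoint Q" and "is_sqrt_operator Q Qhalf"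
    and "Q_wiener_process M F Q W"
    and "schroedinger_group S"
    and "u0 \<in> borel_measurable (F 0)"
    and "mild_solution M F e Qhalf W S u0 u"
    and "AE \<omega> in M. u0 \<omega> \<in> H1" and "integrable M (\<lambda>\<omega>. momentum (u0 \<omega>))"
    and "hilbert_schmidt_H1 e Qhalf"
  shows "\<forall>t\<ge>0.
    (AE \<omega> in M. u t \<omega> \<in> H1) \<and>
    (integrable M (\<lambda>\<omega>. norm (u0 \<omega>)) \<longrightarrow> integrable M (\<lambda>\<omega>. momentum (u t \<omega>))) \<and>
    (integrable M (\<lambda>\<omega>. momentum (u t \<omega>)) \<longrightarrow>
      (\<integral>\<omega>. momentum (u t \<omega>) \<partial>M)
        = (\<integral>\<omega>. momentum (u0 \<omega>) \<partial>M)
          - (2 * t) *\<^sub>R (\<chi> i. Im (hs_cinner e Qhalf (\<lambda>h. weak_partial i (Qhalf h)))))"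
proof (intro allI impI)
  fix t :: real
  assume t: "0 \<le> t"
  \<comment> \<open>The norm of the Sobolev space dominates that of the base space, so the square
    root of \<open>Q\<close> is Hilbert-Schmidt there as well, as \<open>wiener_process\<close>
    requires.\<close>
  have "(norm u)\<^sup>2 \<le> (H1_norm u)\<^sup>2" for u :: "'d l2"
    unfolding H1_norm_def by (simp add: sum_nonneg)
  then have "\<exists>N. \<forall>j\<ge>N. norm ((norm (Qhalf (e j)))\<^sup>2) \<le> (H1_norm (Qhalf (e j)))\<^sup>2" by simp
  moreover have "summable (\<lambda>j. (H1_norm (Qhalf (e j)))\<^sup>2)"
    using assms(11) by (simp add: hilbert_schmidt_H1_def)
  ultimately have summ: "summable (\<lambda>j. (norm (Qhalf (e j)))\<^sup>2)" by (rule summable_comparison_test)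
  have wiener: "wiener_process M F e Q Qhalf W"
    by (intro wiener_process.intro wiener_process_axioms.intro assms(1-5) summ)
  obtain X where X: "has_stochastic_integral M e Qhalf W (\<lambda>r. S (t - r)) t X"
    and u: "AE \<omega> in M. u t \<omega> = S t (u0 \<omega>) - cscale \<i> (X \<omega>)"
    using assms(8) t unfolding mild_solution_def by blast
  have "u t \<in> borel_measurable (F t)"
    using assms(8) t unfolding mild_solution_def by blast
  then have u_meas: "u t \<in> borel_measurable M"
    by (rule wiener_process.measurable_filtration[OF wiener t])
  interpret schroedinger_convolution M F e Q Qhalf W S t X
    by (intro schroedinger_convolution.intro schroedinger_convolution_axioms.intro wiener assms(6,11) t X)
  note * = momentum_evolution[OF assms(7,9,10) u_meas u]
  show "(AE \<omega> in M. u t \<omega> \<in> H1) \<and>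
    (integrable M (\<lambda>\<omega>. norm (u0 \<omega>)) \<longrightarrow> integrable M (\<lambda>\<omega>. momentum (u t \<omega>))) \<and>
    (integrable M (\<lambda>\<omega>. momentum (u t \<omega>)) \<longrightarrow>
      (\<integral>\<omega>. momentum (u t \<omega>) \<partial>M)
        = (\<integral>\<omega>. momentum (u0 \<omega>) \<partial>M)
          - (2 * t) *\<^sub>R (\<chi> i. Im (hs_cinner e Qhalf (\<lambda>h. weak_partial i (Qhalf h)))))"
    using * by blast
qed

end
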